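(* Let $F$ define a rational curve $\mathcal C(F)$ and let $\mathcal P(\mathbf a,\gamma,t)=\left(\frac{p_1}{q_1},\frac{p_2}{q_2}\right)\in\mathbb F(t)^2\setminus\mathbb F^2$ be a proper parametrization of $\mathcal C(F)$ in reduced form (chosen polynomial of degree at most one if $\mathcal C(F)$ is a line). Let $\mathbf a^0\in\Omega_{\mathrm{proper}(\mathcal P)}$. Then $\mathcal C(F,\mathbf a^0)$ is a rational affine curve in $\overline{\mathbb K}^2$ properly parametrized by $\mathcal P(\mathbf a^0,\gamma^0,t)$.
   Context: **Specialization.** $\mathbb K$ is a computable field of characteristic zero with algebraic closure $\overline{\mathbb K}$; $\mathbf a=(a_1,\dots,a_n)$ are parameters (indeterminates), $\mathbb L=\mathbb K(\mathbf a)$, $\gamma$ is algebraic over $\mathbb L$, $\mathbb F=\mathbb L(\gamma)$, and $\mathbb S=\overline{\mathbb K}^{\,n}$. $\mathbb V(\cdot)\subset\mathbb S$ is the common zero set of polynomials in $\mathbb K[\mathbf a]$ ($\mathbb V(\emptyset)=\mathbb S$). Let $p(\mathbf a,t)=t^k+\sum_{i<k}\frac{N_i}{D_i}t^i$ ($N_i,D_i\in\mathbb K[\mathbf a]$ coprime) be the minimal polynomial of $\gamma$ over $\mathbb L$, $D=\mathrm{lcm}(D_0,\dots,D_{k-1})$, $\Omega_\gamma=\mathbb S\setminus\mathbb V(D)$. For $\mathbf a^0\in\Omega_\gamma$, $\gamma^0\in\overline{\mathbb K}$ is a root of $p(\mathbf a^0,t)$ (any fixed choice). Each $f\in\mathbb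 F$ is written canonically as $f=\sum_{i=0}^{k-1}\frac{U_i(\mathbf a)}{W(\mathbf a)}\gamma^i$ with $U_i,W\in\mathbb K[\mathbf a]$, $\gcd(U_0,\dots,U_{k-1},W)=1$; its denominator is $W$, its numerator is $\sum U_i\gamma^i$; if $W(\mathbf a^0)\ne0$ the specialization $f(\mathbf a^0)$ is obtained by substituting $(\mathbf a^0,\gamma^0)$ for $(\mathbf a,\gamma)$. Polynomials over $\mathbb F$ are specialized coefficientwise. $\mathrm{Norm}(f)=\prod_i f(\mathbf a,\gamma_i)\in\mathbb L$, over all roots $\gamma_i$ of $p(\mathbf a,t)$ in $\overline{\mathbb L}$. For a polynomial $H$ over $\mathbb F$ with set of nonzero coefficients $C_H$: $\Omega_{\mathrm{def}(H)}=\Omega_\gamma\setminus\mathbb V(\mathrm{lcm}\{\mathrm{denom}(C):C\in C_H\})$ and $\Omega_{\mathrm{nonZ}(H)}=\Omega_{\mathrm{def}(H)}\setminus\mathbb V(\{\mathrm{numer}(\mathrm{Norm}(\mathrm{numer}(C))):C\in C_H\})$ (so $\Omega_{\mathrm{nonZ}(0)}=\emptyset$). **Gcd sets.** For nonzero $f_1,f_2\in\mathbb F[u][v]$ let $g=\gcd_{\mathbb F[u][v]}(f_1,f_2)$ (a fixed choice), $f_i=f_i^*g$, $A_i,B\in\mathbb F[u]$ the leading coefficients w.r.t. $v$ of $f_i,g$, and $R=\mathrm{res}_v(f_1^*,f_2^* )$; $\Omega_{\gcd(f_1,f_2)}$ is the intersection of $\Omega_{\mathrm{def}(h)}$ for $h\in\{f_1,f_2,f_1^*,f_2^*,g,R\}$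 and $\Omega_{\mathrm{nonZ}(h)}$ for $h\in\{A_1,A_2,B,R\}$ (same definition in $\mathbb F[v]$). **Curves.** $F$ is a nonconstant polynomial in $x,y$ with coefficients in $\mathbb K[\mathbf a,\gamma_1]$, $\gamma_1$ algebraic over $\mathbb L$, irreducible over $\overline{\mathbb F}$; $\gamma$ is a primitive element of a finite extension of $\mathbb L(\gamma_1)$ over which the proper parametrization $\mathcal P$ is defined, so that $F\in\mathbb F[x,y]$. $\mathcal C(F)$ is the affine plane curve over $\overline{\mathbb F}$ defined by $F$, and $\mathcal C(F,\mathbf a^0)$ the zero set in $\overline{\mathbb K}^2$ of $F(\mathbf a^0,\gamma^0,x,y)$. A parametrization of a plane curve over an algebraically closed field is a non-constant pair of rational functions in $t$ satisfying the curve equation; it is proper if it is birational onto the curve (generically injective). A curve is rational if it is irreducible and has a parametrization. With $d=\deg F$ (total degree in $x,y$) and $g_d$ the form of degree $d$ of $F$, $\Omega_F=\Omega_{\mathrm{def}(F)}\cap\Omega_{\mathrm{nonZ}(g_d)}$. Reduced form: $\gcd(p_1,q_1)=\gcd(p_2,q_2)=1$. **The set $\Omega_{\mathrm{proper}(\mathcal P)}$.** If $\deg F=1$, then $\mathcal P=(\lambda_1t+\lambda_0,\mu_1t+\mu_0)\in\mathbb F[t]^2\setminus\mathbb F^2$ and $\Omega_{\mathrm{proper}(\mathcal P)}=\Omega_F\cap\Omega_{\mathrm{def}(\lambda_1t+\lambda_0)}\cap\Omega_{\mathrm{def}(\mu_1t+\mu_0)}\cap(\Omega_{\mathrm{nonZ}(\lambda_1)}\cup\Omega_{\mathrm{nonZ}(\mu_1)})$.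 If $\mathcal C(F)$ is not a line, $\Omega_{\mathrm{proper}(\mathcal P)}=\Omega_1\cap\Omega_2\cap\Omega_3\cap\Omega_4$ where $\Omega_1=\Omega_F$; $\Omega_2=\Omega_{\mathrm{def}(p_1)}\cap\Omega_{\mathrm{def}(p_2)}\cap\Omega_{\mathrm{nonZ}(q_1)}\cap\Omega_{\mathrm{nonZ}(q_2)}$; $\Omega_3=\Omega_{\gcd(G_1,G_2)}$ with $G_i=p_i(h)q_i(t)-p_i(t)q_i(h)\in\mathbb F[h][t]\setminus\{0\}$ (gcd in $\mathbb F[h][t]$, main variable $t$); $\Omega_4=\Omega_{\gcd(p_1,q_1)}\cap\Omega_{\gcd(p_2,q_2)}$ (in $\mathbb F[t]$). *)

theory Defs
  imports
    "HOL-Library.Poly_Mapping"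
    "HOL-Computational_Algebra.Computational_Algebra"
    "HOL-Algebra.Algebraic_Closure_Type"
    "Subresultants.Resultant_Prelim"
begin

text \<open>
  The parameters are indexed by a finite, linearly ordered type \<open>'n\<close> (so \<open>n = CARD('n)\<close>);
  the order is only used by the library to see that the polynomial ring is a domain.
  The ring \<open>K[a]\<close> is \<open>('n, 'k) ppoly\<close>, \<open>L = K(a)\<close> is its fraction field, the algebraic
  closure of \<open>K\<close> is \<open>'k alg_closure\<close> and the parameter space \<open>S\<close> is \<open>'n \<Rightarrow> 'k alg_closure\<close>.
\<close>

type_synonym ('n, 'k) ppoly = "('n \<Rightarrow>\<^sub>0 nat) \<Rightarrow>\<^sub>0 'k"

definition peval :: "('n::finite \<Rightarrow> 'k::field alg_closure) \<Rightarrow> ('n, 'k) ppoly \<Rightarrow> 'k alg_closure" where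
  "peval a P = (\<Sum>m\<in>Poly_Mapping.keys P. to_ac (Poly_Mapping.lookup P m) *
     (\<Prod>i\<in>UNIV. a i ^ Poly_Mapping.lookup m i))"

definition vanishing_set :: "('n::finite, 'k::field) ppoly set \<Rightarrow> ('n \<Rightarrow> 'k alg_closure) set" where
  "vanishing_set S = {a. \<forall>P\<in>S. peval a P = 0}"

text \<open>
  Least common multiples and the canonical representations below are determined only up to
  units of \<open>K[a]\<close>, i.e. nonzero constants.  A choice is fixed with \<open>SOME\<close>; vanishing sets and
  specializations do not depend on it.
\<close>

definition some_lcm :: "'a::comm_semiring_1 set \<Rightarrow> 'a" where
  "some_lcm S = (SOME m. (\<forall>x\<in>S. x dvd m) \<and> (\<forall>m'. (\<forall>x\<in>S. x dvd m') \<longrightarrow> m dvd m'))"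

definition canonL ::
  "('n::{finite,linorder}, 'k::field) ppoly fract \<Rightarrow> ('n, 'k) ppoly \<times> ('n, 'k) ppoly" where
  "canonL c = (SOME (N, D). D \<noteq> 0 \<and> c = Fract N D \<and> (\<forall>d. d dvd N \<and> d dvd D \<longrightarrow> d dvd 1))"

definition numerL :: "('n::{finite,linorder}, 'k::field) ppoly fract \<Rightarrow> ('n, 'k) ppoly" where
  "numerL c = fst (canonL c)"

definition denomL :: "('n::{finite,linorder}, 'k::field) ppoly fract \<Rightarrow> ('n, 'k) ppoly" where
  "denomL c = snd (canonL c)"

text \<open>
  The field \<open>\<F> = L(\<gamma>)\<close> is a field type \<open>'f\<close> together with an embedding \<open>\<phi>\<close> of \<open>L\<close> and an
  algebraic element \<open>\<gamma>\<close> that generates it.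
\<close>

definition simple_algebraic_extension :: "('l::field \<Rightarrow> 'f::field) \<Rightarrow> 'f \<Rightarrow> bool" where
  "simple_algebraic_extension \<phi> \<gamma> \<longleftrightarrow>
     field_hom \<phi> \<and>
     (\<exists>p. p \<noteq> 0 \<and> poly (map_poly \<phi> p) \<gamma> = 0) \<and>
     (\<forall>z. \<exists>p q. poly (map_poly \<phi> q) \<gamma> \<noteq> 0 \<and>
                z = poly (map_poly \<phi> p) \<gamma> / poly (map_poly \<phi> q) \<gamma>)"

definition min_poly :: "('l::field \<Rightarrow> 'f::field) \<Rightarrow> 'f \<Rightarrow> 'l poly" where
  "min_poly \<phi> \<gamma> =
     (THE p. lead_coeff p = 1 \<and> Factorial_Ring.irreducible p \<and> poly (map_poly \<phi> p) \<gamma> = 0)"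

text \<open>The numerators \<open>U\<^sub>i\<close> are kept as the coefficients of one polynomial \<open>U\<close>.\<close>

definition canonF ::
  "(('n::{finite,linorder}, 'k::field) ppoly fract \<Rightarrow> 'f::field) \<Rightarrow> 'f \<Rightarrow> 'f
    \<Rightarrow> ('n, 'k) ppoly poly \<times> ('n, 'k) ppoly" where
  "canonF \<phi> \<gamma> f = (SOME (U, W). W \<noteq> 0 \<and> degree U < degree (min_poly \<phi> \<gamma>) \<and>
     f = (\<Sum>i<degree (min_poly \<phi> \<gamma>). \<phi> (Fract (coeff U i) W) * \<gamma> ^ i) \<and>
     (\<forall>d. (\<forall>i. d dvd coeff U i) \<and> d dvd W \<longrightarrow> d dvd 1))"

definition denomF ::
  "(('n::{finite,linorder}, 'k::field) ppoly fract \<Rightarrow> 'f::field) \<Rightarrow> 'f \<Rightarrow> 'f \<Rightarrow> ('n, 'k) ppoly" where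
  "denomF \<phi> \<gamma> f = snd (canonF \<phi> \<gamma> f)"

definition numerF ::
  "(('n::{finite,linorder}, 'k::field) ppoly fract \<Rightarrow> 'f::field) \<Rightarrow> 'f \<Rightarrow> 'f \<Rightarrow> 'f" where
  "numerF \<phi> \<gamma> f = poly (map_poly (\<lambda>P. \<phi> (to_fract P)) (fst (canonF \<phi> \<gamma> f))) \<gamma>"

text \<open>
  The minimal polynomial is separable (characteristic zero), so its roots are simple and the
  product over all roots is a product over a set.  The product lies in (the image of) \<open>L\<close>.
\<close>

definition NormF ::
  "(('n::{finite,linorder}, 'k::field) ppoly fract \<Rightarrow> 'f::field) \<Rightarrow> 'f \<Rightarrow> 'f
    \<Rightarrow> ('n, 'k) ppoly fract" where
  "NormF \<phi> \<gamma> f = (case canonF \<phi> \<gamma> f of (U, W) \<Rightarrow>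
     of_ac (\<Prod>x | poly (map_poly to_ac (min_poly \<phi> \<gamma>)) x = 0.
              \<Sum>i<degree (min_poly \<phi> \<gamma>). to_ac (Fract (coeff U i) W) * x ^ i))"

definition spec_min_poly ::
  "(('n::{finite,linorder}, 'k::field) ppoly fract \<Rightarrow> 'f::field) \<Rightarrow> 'f
    \<Rightarrow> ('n \<Rightarrow> 'k alg_closure) \<Rightarrow> 'k alg_closure poly" where
  "spec_min_poly \<phi> \<gamma> a =
     map_poly (\<lambda>c. peval a (numerL c) / peval a (denomL c)) (min_poly \<phi> \<gamma>)"

definition spec ::
  "(('n::{finite,linorder}, 'k::field) ppoly fract \<Rightarrow> 'f::field) \<Rightarrow> 'f
    \<Rightarrow> ('n \<Rightarrow> 'k alg_closure) \<Rightarrow> 'k alg_closure \<Rightarrow> 'f \<Rightarrow> 'k alg_closure" where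
  "spec \<phi> \<gamma> a c f = (case canonF \<phi> \<gamma> f of (U, W) \<Rightarrow> poly (map_poly (peval a) U) c / peval a W)"

text \<open>
  The sets for a polynomial \<open>H\<close> over \<open>\<F>\<close> depend only on its set of nonzero coefficients, so they
  are defined on sets of elements of \<open>\<F>\<close>.  \<open>coeffs0\<close>, \<open>coeffs1\<close>, \<open>coeffs2\<close> give the nonzero
  \<open>\<F>\<close>-coefficients of elements of \<open>\<F>\<close>, \<open>\<F>[u]\<close>, \<open>\<F>[u][v]\<close>.
\<close>

definition coeffs0 :: "'f::zero \<Rightarrow> 'f set" where
  "coeffs0 c = {c} - {0}"

definition lift_coeffs :: "('r::zero \<Rightarrow> 'f set) \<Rightarrow> 'r poly \<Rightarrow> 'f set" where
  "lift_coeffs cf H = (\<Union>c\<in>set (coeffs H). cf c)"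

definition coeffs1 :: "'f::zero poly \<Rightarrow> 'f set" where
  "coeffs1 = lift_coeffs coeffs0"

definition coeffs2 :: "'f::zero poly poly \<Rightarrow> 'f set" where
  "coeffs2 = lift_coeffs coeffs1"

definition Omega_gamma ::
  "(('n::{finite,linorder}, 'k::field) ppoly fract \<Rightarrow> 'f::field) \<Rightarrow> 'f
    \<Rightarrow> ('n \<Rightarrow> 'k alg_closure) set" where
  "Omega_gamma \<phi> \<gamma> = UNIV - vanishing_set
     {some_lcm ((\<lambda>i. denomL (coeff (min_poly \<phi> \<gamma>) i)) ` {..<degree (min_poly \<phi> \<gamma>)})}"

definition Omega_def ::
  "(('n::{finite,linorder}, 'k::field) ppoly fract \<Rightarrow> 'f::field) \<Rightarrow> 'f \<Rightarrow> 'f set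
    \<Rightarrow> ('n \<Rightarrow> 'k alg_closure) set" where
  "Omega_def \<phi> \<gamma> C = Omega_gamma \<phi> \<gamma> - vanishing_set {some_lcm (denomF \<phi> \<gamma> ` C)}"

definition Omega_nonZ ::
  "(('n::{finite,linorder}, 'k::field) ppoly fract \<Rightarrow> 'f::field) \<Rightarrow> 'f \<Rightarrow> 'f set
    \<Rightarrow> ('n \<Rightarrow> 'k alg_closure) set" where
  "Omega_nonZ \<phi> \<gamma> C =
     Omega_def \<phi> \<gamma> C - vanishing_set ((\<lambda>c. numerL (NormF \<phi> \<gamma> (numerF \<phi> \<gamma> c))) ` C)"

definition is_gcd :: "'a::comm_semiring_1 \<Rightarrow> 'a \<Rightarrow> 'a \<Rightarrow> bool" where
  "is_gcd g f1 f2 \<longleftrightarrow> g dvd f1 \<and> g dvd f2 \<and> (\<forall>h. h dvd f1 \<and> h dvd f2 \<longrightarrow> h dvd g)"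

text \<open>
  \<open>Omega_gcd\<close> covers both \<open>\<F>[u][v]\<close> (\<open>'r = 'f poly\<close>, \<open>cf = coeffs1\<close>) and \<open>\<F>[v]\<close>
  (\<open>'r = 'f\<close>, \<open>cf = coeffs0\<close>); \<open>cf\<close> gives the nonzero \<open>\<F>\<close>-coefficients of an element of \<open>'r\<close>.
  The argument \<open>g\<close> is the chosen gcd of \<open>f1\<close> and \<open>f2\<close>, and \<open>div\<close> is exact division.
\<close>

definition Omega_gcd ::
  "(('n::{finite,linorder}, 'k::field) ppoly fract \<Rightarrow> 'f::field) \<Rightarrow> 'f
    \<Rightarrow> ('r::idom_divide \<Rightarrow> 'f set) \<Rightarrow> 'r poly \<Rightarrow> 'r poly \<Rightarrow> 'r poly
    \<Rightarrow> ('n \<Rightarrow> 'k alg_closure) set" where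
  "Omega_gcd \<phi> \<gamma> cf f1 f2 g =
     (let f1s = f1 div g; f2s = f2 div g; R = resultant f1s f2s
      in (\<Inter>h\<in>{f1, f2, f1s, f2s, g}. Omega_def \<phi> \<gamma> (lift_coeffs cf h)) \<inter> Omega_def \<phi> \<gamma> (cf R) \<inter>
         (\<Inter>c\<in>{lead_coeff f1, lead_coeff f2, lead_coeff g, R}. Omega_nonZ \<phi> \<gamma> (cf c)))"

text \<open>
  A polynomial in \<open>x, y\<close> is a polynomial in \<open>y\<close> (outer variable) with coefficients in \<open>k[x]\<close>.
\<close>

definition eval2 :: "'a::comm_ring_1 poly poly \<Rightarrow> 'a \<Rightarrow> 'a \<Rightarrow> 'a" where
  "eval2 f x y = poly (poly f [:y:]) x"

definition total_degree :: "'a::zero poly poly \<Rightarrow> nat" where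
  "total_degree f = Max (insert 0 {i + j | i j. coeff (coeff f j) i \<noteq> 0})"

definition top_form :: "'a::comm_ring_1 poly poly \<Rightarrow> 'a poly poly" where
  "top_form f = (let d = total_degree f
     in \<Sum>j\<le>d. monom (monom (coeff (coeff f j) (d - j)) (d - j)) j)"

definition zero_set2 :: "'a::comm_ring_1 poly poly set \<Rightarrow> ('a \<times> 'a) set" where
  "zero_set2 S = {(x, y). \<forall>f\<in>S. eval2 f x y = 0}"

definition affine_plane_curve :: "('a::alg_closed_field \<times> 'a) set \<Rightarrow> bool" where
  "affine_plane_curve C \<longleftrightarrow> (\<exists>f. total_degree f > 0 \<and> C = zero_set2 {f})"

text \<open>Irreducibility in the Zariski topology of the plane.\<close>

definition irreducible_set2 :: "('a::alg_closed_field \<times> 'a) set \<Rightarrow> bool" where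
  "irreducible_set2 C \<longleftrightarrow> C \<noteq> {} \<and>
     (\<forall>S T. C = zero_set2 S \<union> zero_set2 T \<longrightarrow> C = zero_set2 S \<or> C = zero_set2 T)"

text \<open>
  A pair of rational functions is given by numerators and nonzero denominators,
  \<open>(p1 / q1, p2 / q2)\<close>.  \<open>rat_defined\<close> says that both denominators are nonzero at \<open>t\<close>.
\<close>

definition rat_defined :: "'a::field poly \<Rightarrow> 'a poly \<Rightarrow> 'a \<Rightarrow> bool" where
  "rat_defined q1 q2 t \<longleftrightarrow> poly q1 t \<noteq> 0 \<and> poly q2 t \<noteq> 0"

definition rat_point ::
  "'a::field poly \<Rightarrow> 'a poly \<Rightarrow> 'a poly \<Rightarrow> 'a poly \<Rightarrow> 'a \<Rightarrow> 'a \<times> 'a" where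
  "rat_point p1 q1 p2 q2 t = (poly p1 t / poly q1 t, poly p2 t / poly q2 t)"

definition parametrizes ::
  "('a::alg_closed_field \<times> 'a) set \<Rightarrow> 'a poly \<Rightarrow> 'a poly \<Rightarrow> 'a poly \<Rightarrow> 'a poly \<Rightarrow> bool" where
  "parametrizes C p1 q1 p2 q2 \<longleftrightarrow> q1 \<noteq> 0 \<and> q2 \<noteq> 0 \<and>
     \<not> (\<exists>c1 c2. p1 = smult c1 q1 \<and> p2 = smult c2 q2) \<and>
     (\<forall>t. rat_defined q1 q2 t \<longrightarrow> rat_point p1 q1 p2 q2 t \<in> C)"

definition rational_curve :: "('a::alg_closed_field \<times> 'a) set \<Rightarrow> bool" where
  "rational_curve C \<longleftrightarrow> affine_plane_curve C \<and> irreducible_set2 C \<and>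
     (\<exists>p1 q1 p2 q2. parametrizes C p1 q1 p2 q2)"

text \<open>
  Birationality of \<open>t \<mapsto> (p1 / q1, p2 / q2)(t)\<close> onto an irreducible curve \<open>C\<close>: there is a
  rational map \<open>A / B\<close> from \<open>C\<close> to the line such that both composites are generically the
  identity.  The dense open subsets of the line and of an irreducible curve are the cofinite
  ones, so \<open>generically\<close> means \<open>with finitely many exceptions\<close>.
\<close>

definition birational_onto ::
  "('a::alg_closed_field \<times> 'a) set \<Rightarrow> 'a poly \<Rightarrow> 'a poly \<Rightarrow> 'a poly \<Rightarrow> 'a poly \<Rightarrow> bool" where
  "birational_onto C p1 q1 p2 q2 \<longleftrightarrow> (\<exists>A B.
     (\<forall>\<^sub>\<infinity>t. rat_defined q1 q2 t \<and>
        (case rat_point p1 q1 p2 q2 t of (x, y) \<Rightarrow>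
           eval2 B x y \<noteq> 0 \<and> eval2 A x y / eval2 B x y = t)) \<and>
     (\<forall>\<^sub>\<infinity>z. z \<in> C \<longrightarrow> (case z of (x, y) \<Rightarrow>
        eval2 B x y \<noteq> 0 \<and> rat_defined q1 q2 (eval2 A x y / eval2 B x y) \<and>
        rat_point p1 q1 p2 q2 (eval2 A x y / eval2 B x y) = (x, y))))"

definition properly_parametrizes ::
  "('a::alg_closed_field \<times> 'a) set \<Rightarrow> 'a poly \<Rightarrow> 'a poly \<Rightarrow> 'a poly \<Rightarrow> 'a poly \<Rightarrow> bool" where
  "properly_parametrizes C p1 q1 p2 q2 \<longleftrightarrow>
     parametrizes C p1 q1 p2 q2 \<and> birational_onto C p1 q1 p2 q2"

definition curve_closure :: "'f::field poly poly \<Rightarrow> ('f alg_closure \<times> 'f alg_closure) set" where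
  "curve_closure F = zero_set2 {map_poly (map_poly to_ac) F}"

definition spec_curve ::
  "(('n::{finite,linorder}, 'k::field) ppoly fract \<Rightarrow> 'f::field) \<Rightarrow> 'f
    \<Rightarrow> ('n \<Rightarrow> 'k alg_closure) \<Rightarrow> 'k alg_closure \<Rightarrow> 'f poly poly
    \<Rightarrow> ('k alg_closure \<times> 'k alg_closure) set" where
  "spec_curve \<phi> \<gamma> a c F = zero_set2 {map_poly (map_poly (spec \<phi> \<gamma> a c)) F}"

definition Omega_F ::
  "(('n::{finite,linorder}, 'k::field) ppoly fract \<Rightarrow> 'f::field) \<Rightarrow> 'f \<Rightarrow> 'f poly poly
    \<Rightarrow> ('n \<Rightarrow> 'k alg_closure) set" where
  "Omega_F \<phi> \<gamma> F = Omega_def \<phi> \<gamma> (coeffs2 F) \<inter> Omega_nonZ \<phi> \<gamma> (coeffs2 (top_form F))"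

text \<open>\<open>G p q = p(h) q(t) - p(t) q(h)\<close> in \<open>\<F>[h][t]\<close>; the outer variable is \<open>t\<close>.\<close>

definition G_poly :: "'f::comm_ring_1 poly \<Rightarrow> 'f poly \<Rightarrow> 'f poly poly" where
  "G_poly p q = smult p (map_poly (\<lambda>c. [:c:]) q) - smult q (map_poly (\<lambda>c. [:c:]) p)"

text \<open>
  The last three arguments are the chosen gcds of \<open>G\<^sub>1, G\<^sub>2\<close>, of \<open>p1, q1\<close> and of \<open>p2, q2\<close>.
  For a line, the parametrization is polynomial with components \<open>p1\<close> and \<open>p2\<close>.
\<close>

definition Omega_proper ::
  "(('n::{finite,linorder}, 'k::field) ppoly fract \<Rightarrow> 'f::field) \<Rightarrow> 'f \<Rightarrow> 'f poly poly
    \<Rightarrow> 'f poly \<Rightarrow> 'f poly \<Rightarrow> 'f poly \<Rightarrow> 'f poly \<Rightarrow> 'f poly poly \<Rightarrow> 'f poly \<Rightarrow> 'f poly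
    \<Rightarrow> ('n \<Rightarrow> 'k alg_closure) set" where
  "Omega_proper \<phi> \<gamma> F p1 q1 p2 q2 g g1 g2 =
    (if total_degree F = 1 then
       Omega_F \<phi> \<gamma> F \<inter> Omega_def \<phi> \<gamma> (coeffs1 p1) \<inter> Omega_def \<phi> \<gamma> (coeffs1 p2) \<inter>
       (Omega_nonZ \<phi> \<gamma> (coeffs0 (coeff p1 1)) \<union> Omega_nonZ \<phi> \<gamma> (coeffs0 (coeff p2 1)))
     else
       Omega_F \<phi> \<gamma> F \<inter>
       (Omega_def \<phi> \<gamma> (coeffs1 p1) \<inter> Omega_def \<phi> \<gamma> (coeffs1 p2) \<inter>
        Omega_nonZ \<phi> \<gamma> (coeffs1 q1) \<inter> Omega_nonZ \<phi> \<gamma> (coeffs1 q2)) \<inter>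
       Omega_gcd \<phi> \<gamma> coeffs1 (G_poly p1 q1) (G_poly p2 q2) g \<inter>
       (Omega_gcd \<phi> \<gamma> coeffs0 p1 q1 g1 \<inter> Omega_gcd \<phi> \<gamma> coeffs0 p2 q2 g2))"

end

theory Submission
  imports Defs
begin

text \<open>
  Specialization is a ring homomorphism \<open>\<sigma>\<close> on the ring of those elements of \<open>\<F>\<close> whose denominator
  does not vanish at \<open>a\<^sup>0\<close>.  This uses that \<open>K[a]\<close> is factorial (Gauss' lemma, one variable at a time);
  an element is not sent to zero if its norm is not, because the norm is the determinant of a
  multiplication matrix and this determinant can be specialized.

  Generically \<open>gcd(G\<^sub>1, G\<^sub>2) = (t - h) w(h)\<close>, since the parametrization is injective up to finitely many
  points and the characteristic is zero.  The conditions on leading coefficients and resultants carry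
  this gcd over to the specialization, where \<open>p\<^sub>i(t) - x\<^sub>i q\<^sub>i(t)\<close>, \<open>x\<^sub>i = p\<^sub>i(h) / q\<^sub>i(h)\<close>, therefore have the gcd
  \<open>t - h\<close>.  Gcds do not change under field extensions, so \<open>h\<close> is a rational function of \<open>x\<^sub>1, x\<^sub>2\<close>: the
  specialized parametrization has a rational inverse.

  Finally, the equation of a curve parametrized by \<open>(p\<^sub>1/q\<^sub>1, p\<^sub>2/q\<^sub>2)\<close> has degree at most
  \<open>max (deg p\<^sub>2) (deg q\<^sub>2)\<close> in \<open>x\<close> and \<open>max (deg p\<^sub>1) (deg q\<^sub>1)\<close> in \<open>y\<close>, and at least this if the
  parametrization is proper.  These degrees do not drop, so the specialized \<open>F\<close> has no room for a
  factor besides the equation of the parametrized curve, and it is irreducible.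
\<close>

section \<open>Polynomials over subrings of an integral domain\<close>

text \<open>K[a] is one type for any number of variables, so an induction on the variables has to
  run through subrings of that type; hence primes, units and factorizations relative to a set.
  Likewise \<open>spec\<close> is a total function that respects sums and products only on the
  localization at \<open>a0\<close>; hence homomorphisms on a set. Factoriality matters because a
  reduced denominator divides every other denominator: an element is defined at \<open>a0\<close> as
  soon as one of its representations is.

  The roots of the specialized minimal polynomial are not interchangeable: a nonzero element may
  vanish at one of them and not at another. A norm that is nonzero at \<open>a0\<close> rules out
  all of them at once.

  The obstacle at the end is that an irreducible polynomial can become reducible under
  specialization. Vanishing along the parametrization only makes the equation of the image a factor.
  The cofactor is controlled by the two partial degrees, since these can be read off from a proper
  parametrization: a dimension count bounds them from above, the points of a generic fibre from
  below. Counting these points needs simple roots, which the Wronskian supplies in characteristic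
  zero.\<close>

definition subring_set :: "'a::comm_ring_1 set \<Rightarrow> bool" where
  "subring_set A \<longleftrightarrow> 0 \<in> A \<and> 1 \<in> A \<and> (\<forall>x\<in>A. \<forall>y\<in>A. x + y \<in> A \<and> x * y \<in> A) \<and> (\<forall>x\<in>A. - x \<in> A)"

lemma subring_setD:
  assumes "subring_set A"
  shows "0 \<in> A" "1 \<in> A" "x \<in> A \<Longrightarrow> y \<in> A \<Longrightarrow> x + y \<in> A" "x \<in> A \<Longrightarrow> y \<in> A \<Longrightarrow> x * y \<in> A"
    "x \<in> A \<Longrightarrow> - x \<in> A" "x \<in> A \<Longrightarrow> y \<in> A \<Longrightarrow> x - y \<in> A"
  using assms diff_conv_add_uminus[of x y] unfolding subring_set_def by metis+

lemma subring_set_UNIV [simp]: "subring_set UNIV"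
  by (simp add: subring_set_def)

lemma subring_set_sum: "subring_set A \<Longrightarrow> (\<And>x. x \<in> S \<Longrightarrow> f x \<in> A) \<Longrightarrow> sum f S \<in> A"
  by (induction S rule: infinite_finite_induct) (auto simp: subring_setD)

lemma subring_set_prod: "subring_set A \<Longrightarrow> (\<And>x. x \<in> S \<Longrightarrow> f x \<in> A) \<Longrightarrow> prod f S \<in> A"
  by (induction S rule: infinite_finite_induct) (auto simp: subring_setD)

lemma subring_set_power: "subring_set A \<Longrightarrow> x \<in> A \<Longrightarrow> x ^ n \<in> A"
  by (induction n) (auto simp: subring_setD)

lemma subring_set_prod_list: "subring_set A \<Longrightarrow> set xs \<subseteq> A \<Longrightarrow> prod_list xs \<in> A"
  by (induction xs) (auto simp: subring_setD)

definition polys_over :: "'a::zero set \<Rightarrow> 'a poly set" where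
  "polys_over A = {f. \<forall>i. coeff f i \<in> A}"

lemma coeff_polys_over: "f \<in> polys_over A \<Longrightarrow> coeff f i \<in> A"
  by (simp add: polys_over_def)

lemma polys_over_UNIV [simp]: "polys_over UNIV = UNIV"
  by (simp add: polys_over_def)

lemma subring_polys_over:
  assumes "subring_set A"
  shows "subring_set (polys_over A)"
  using assms unfolding subring_set_def[of "polys_over A"]
  by (auto simp: polys_over_def subring_setD coeff_mult coeff_pCons one_pCons split: nat.splits intro!: subring_set_sum)

lemma const_polys_over [simp]: "0 \<in> A \<Longrightarrow> [:a:] \<in> polys_over A \<longleftrightarrow> a \<in> A"
  by (auto simp: polys_over_def coeff_pCons split: nat.splits)

lemma monom_polys_over: "0 \<in> A \<Longrightarrow> a \<in> A \<Longrightarrow> monom a n \<in> polys_over A"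
  by (auto simp: polys_over_def)

lemma smult_polys_over: "subring_set A \<Longrightarrow> a \<in> A \<Longrightarrow> f \<in> polys_over A \<Longrightarrow> smult a f \<in> polys_over A"
  by (auto simp: polys_over_def subring_setD)

text \<open>Multiplying by a power of the leading coefficient replaces dividing by it, so quotient
  and remainder keep their coefficients in \<open>A\<close>.\<close>

lemma pseudo_division_over:
  fixes f d :: "'a::idom poly"
  assumes A: "subring_set A" and d: "d \<in> polys_over A" "d \<noteq> 0" and f: "f \<in> polys_over A"
  shows "\<exists>n. \<exists>q\<in>polys_over A. \<exists>r\<in>polys_over A.
           smult (lead_coeff d ^ n) f = q * d + r \<and> (r = 0 \<or> degree r < degree d)"
  using f
\<comment> \<open>Zero gets a smaller measure than the nonzero constants; otherwise dividing a
  constant by a constant would not lower the measure.\<close>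
proof (induction "if f = 0 then 0 else Suc (degree f)" arbitrary: f rule: less_induct)
  case less
  note S = subring_polys_over[OF A]
  show ?case
  proof (cases "f = 0 \<or> degree f < degree d")
    case True
    then show ?thesis using less.prems subring_setD(1)[OF S]
      by (intro exI[of _ 0] bexI[of _ 0] bexI[of _ f]) auto
  next
    case False
    define m where "m = monom (lead_coeff f) (degree f - degree d)"
    define f1 where "f1 = smult (lead_coeff d) f - m * d"
    have m: "m \<in> polys_over A" unfolding m_def
      using less.prems by (intro monom_polys_over) (auto simp: subring_setD A polys_over_def)
    have lc: "lead_coeff d \<in> A" using d by (simp add: polys_over_def)
    have f1: "f1 \<in> polys_over A" unfolding f1_def
      by (intro subring_setD[OF S] smult_polys_over A lc less.prems m d)
    have "degree (m * d) \<le> degree f"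
      using degree_mult_le[of m d] degree_monom_le[of "lead_coeff f" "degree f - degree d"] False
      unfolding m_def by linarith
    hence dle: "degree f1 \<le> degree f" unfolding f1_def
      by (intro degree_diff_le) (auto intro: order.trans[OF degree_smult_le])
    have "coeff (m * d) (degree f) = lead_coeff f * lead_coeff d"
      using False unfolding m_def by (simp add: coeff_monom_mult)
    hence "coeff f1 (degree f) = 0" by (simp add: f1_def)
    hence "f1 = 0 \<or> degree f1 < degree f" using dle
      by (metis le_neq_implies_less leading_coeff_0_iff)
    hence "(if f1 = 0 then 0 else Suc (degree f1)) < (if f = 0 then 0 else Suc (degree f))"
      using False by auto
    from less.hyps[OF this f1] obtain n q r where
      IH: "q \<in> polys_over A" "r \<in> polys_over A" "smult (lead_coeff d ^ n) f1 = q * d + r"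
        "r = 0 \<or> degree r < degree d" by blast
    have "smult (lead_coeff d ^ Suc n) f = (q + smult (lead_coeff d ^ n) m) * d + r"
    proof -
      have "smult (lead_coeff d ^ Suc n) f = smult (lead_coeff d ^ n) (f1 + m * d)"
        by (simp add: f1_def mult.commute)
      also have "\<dots> = q * d + r + smult (lead_coeff d ^ n) m * d"
        by (simp add: smult_add_right IH(3))
      finally show ?thesis by (simp add: algebra_simps)
    qed
    moreover have "q + smult (lead_coeff d ^ n) m \<in> polys_over A"
      by (intro subring_setD[OF S] IH smult_polys_over A m subring_set_power lc)
    ultimately show ?thesis using IH by blast
  qed
qed

section \<open>Divisibility, primes and factorizations relative to a subring\<close>

definition dvd_in :: "'a::comm_ring_1 set \<Rightarrow> 'a \<Rightarrow> 'a \<Rightarrow> bool" where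
  "dvd_in A x y \<longleftrightarrow> (\<exists>z\<in>A. y = x * z)"

definition prime_in :: "'a::comm_ring_1 set \<Rightarrow> 'a \<Rightarrow> bool" where
  "prime_in A p \<longleftrightarrow> p \<in> A \<and> p \<noteq> 0 \<and> \<not> dvd_in A p 1 \<and>
     (\<forall>x\<in>A. \<forall>y\<in>A. dvd_in A p (x * y) \<longrightarrow> dvd_in A p x \<or> dvd_in A p y)"

definition irreducible_in :: "'a::comm_ring_1 set \<Rightarrow> 'a \<Rightarrow> bool" where
  "irreducible_in A p \<longleftrightarrow> p \<in> A \<and> p \<noteq> 0 \<and> \<not> dvd_in A p 1 \<and>
     (\<forall>x\<in>A. \<forall>y\<in>A. p = x * y \<longrightarrow> dvd_in A x 1 \<or> dvd_in A y 1)"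

definition prime_product :: "'a::comm_ring_1 set \<Rightarrow> 'a \<Rightarrow> 'a list \<Rightarrow> 'a \<Rightarrow> bool" where
  "prime_product A u ps x \<longleftrightarrow>
     u \<in> A \<and> dvd_in A u 1 \<and> (\<forall>p\<in>set ps. prime_in A p) \<and> x = u * prod_list ps"

text \<open>Existence is all that is demanded: factors that are prime, not merely irreducible, make
  the factorization unique.\<close>

definition factorial_in :: "'a::comm_ring_1 set \<Rightarrow> bool" where
  "factorial_in A \<longleftrightarrow> (\<forall>x\<in>A. x \<noteq> 0 \<longrightarrow> (\<exists>u ps. prime_product A u ps x))"

lemma dvd_in_UNIV [simp]: "dvd_in UNIV = (dvd)"
  by (auto simp: dvd_in_def dvd_def fun_eq_iff)

lemma prime_in_UNIV [simp]: "prime_in UNIV = prime_elem"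
  by (auto simp: prime_in_def prime_elem_def fun_eq_iff)

lemma irreducible_in_UNIV [simp]: "irreducible_in UNIV = Factorial_Ring.irreducible"
  by (auto simp: irreducible_in_def Factorial_Ring.irreducible_def fun_eq_iff)

lemma dvd_in_mult: "subring_set A \<Longrightarrow> dvd_in A p x \<Longrightarrow> y \<in> A \<Longrightarrow> dvd_in A p (x * y)"
  unfolding dvd_in_def by (metis mult.assoc subring_setD(4))

lemma dvd_in_mult2: "subring_set A \<Longrightarrow> dvd_in A p x \<Longrightarrow> y \<in> A \<Longrightarrow> dvd_in A p (y * x)"
  using dvd_in_mult[of A p x y] by (simp add: mult.commute)

lemma dvd_in_self: "subring_set A \<Longrightarrow> dvd_in A p p"
  unfolding dvd_in_def by (metis mult_1_right subring_setD(2))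

lemma dvd_in_0: "subring_set A \<Longrightarrow> dvd_in A p 0"
  unfolding dvd_in_def by (metis mult_zero_right subring_setD(1))

lemma dvd_in_add: "subring_set A \<Longrightarrow> dvd_in A p x \<Longrightarrow> dvd_in A p y \<Longrightarrow> dvd_in A p (x + y)"
  unfolding dvd_in_def by (metis distrib_left subring_setD(3))

lemma dvd_in_uminus: "subring_set A \<Longrightarrow> dvd_in A p x \<Longrightarrow> dvd_in A p (- x)"
  unfolding dvd_in_def by (metis mult_minus_right subring_setD(5))

lemma dvd_in_sum:
  "subring_set A \<Longrightarrow> (\<And>x. x \<in> S \<Longrightarrow> dvd_in A p (f x)) \<Longrightarrow> dvd_in A p (sum f S)"
  by (induction S rule: infinite_finite_induct) (auto simp: dvd_in_0 dvd_in_add)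

lemma dvd_in_trans: "subring_set A \<Longrightarrow> dvd_in A x y \<Longrightarrow> dvd_in A y z \<Longrightarrow> dvd_in A x z"
  unfolding dvd_in_def by (metis mult.assoc subring_setD(4))

lemma prime_product_in: "subring_set A \<Longrightarrow> prime_product A u ps x \<Longrightarrow> x \<in> A"
  unfolding prime_product_def prime_in_def by (auto intro!: subring_setD subring_set_prod_list)

lemma prime_product_nonzero:
  fixes x :: "'a::idom"
  assumes "prime_product A u ps x" shows "x \<noteq> 0"
proof -
  have "u \<noteq> 0" using assms by (auto simp: prime_product_def dvd_in_def)
  moreover have "0 \<notin> set ps" using assms by (auto simp: prime_product_def prime_in_def)
  ultimately show ?thesis using assms by (simp add: prime_product_def prod_list_zero_iff)
qed

lemma prime_product_mult:
  assumes A: "subring_set A" and "prime_product A u ps x" "prime_product A v qs y"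
  shows "prime_product A (u * v) (ps @ qs) (x * y)"
proof -
  obtain a b where "a \<in> A" "1 = u * a" "b \<in> A" "1 = v * b"
    using assms by (auto simp: prime_product_def dvd_in_def)
  moreover have "u * v * (a * b) = (u * a) * (v * b)" by (simp add: algebra_simps)
  ultimately have "dvd_in A (u * v) 1"
    unfolding dvd_in_def by (intro bexI[of _ "a * b"]) (auto simp: subring_setD[OF A] simp flip: \<open>1 = u * a\<close> \<open>1 = v * b\<close>)
  thus ?thesis using assms by (auto simp: prime_product_def algebra_simps subring_setD)
qed

lemma prime_in_dvd_prod_list:
  assumes A: "subring_set A" and p: "prime_in A p" and "set xs \<subseteq> A" "dvd_in A p (prod_list xs)"
  shows "\<exists>x\<in>set xs. dvd_in A p x"
  using assms(3,4)
proof (induction xs)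
  case Nil
  then show ?case using p by (auto simp: prime_in_def)
next
  case (Cons a xs)
  hence "dvd_in A p a \<or> dvd_in A p (prod_list xs)"
    using p subring_set_prod_list[OF A, of xs] by (auto simp: prime_in_def)
  then show ?case using Cons by auto
qed

lemma unit_in_cancel:
  assumes A: "subring_set A" and "u \<in> A" "dvd_in A u 1" "x \<in> A" "dvd_in A p (u * x)"
  shows "dvd_in A p x"
proof -
  obtain v where v: "v \<in> A" "1 = u * v" using assms by (auto simp: dvd_in_def)
  have "dvd_in A p (u * x * v)" by (rule dvd_in_mult[OF A assms(5) v(1)])
  moreover have "u * x * v = x" using v(2) by (metis mult.assoc mult.commute mult_1_right)
  ultimately show ?thesis by simp
qed

text \<open>\<open>p\<close> divides one of the primes \<open>ps\<close>, and two primes of which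
  one divides the other differ by a unit; that unit is absorbed into \<open>v\<close>. The lengths
  drive inductions on the number of primes.\<close>

lemma prime_product_cancel:
  fixes p :: "'a::idom"
  assumes A: "subring_set A" and x: "prime_product A u ps (p * y)" and p: "prime_in A p" "y \<in> A"
  shows "\<exists>v qs. prime_product A v qs y \<and> length ps = Suc (length qs)"
proof -
  have ps: "set ps \<subseteq> A" using x by (auto simp: prime_product_def prime_in_def)
  have "dvd_in A p (u * prod_list ps)"
    using x p dvd_in_mult[OF A dvd_in_self[OF A] p(2), of p] by (simp add: prime_product_def)
  hence "dvd_in A p (prod_list ps)"
    using unit_in_cancel[OF A] x subring_set_prod_list[OF A ps] by (auto simp: prime_product_def)
  then obtain q where q: "q \<in> set ps" "dvd_in A p q"
    using prime_in_dvd_prod_list[OF A p(1) ps] by blast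
  have qp: "prime_in A q" using q x by (auto simp: prime_product_def)
  obtain w where w: "w \<in> A" "q = p * w" using q by (auto simp: dvd_in_def)
  have "dvd_in A w 1"
  proof -
    have "dvd_in A q (p * w)" using dvd_in_self[OF A, of q] w by simp
    hence "dvd_in A q p \<or> dvd_in A q w" using qp p w by (auto simp: prime_in_def)
    then show ?thesis
    proof
      assume "dvd_in A q p"
      then obtain z where z: "z \<in> A" "p = p * w * z" using w by (auto simp: dvd_in_def)
      have "p * (w * z) = p * 1" by (metis z(2) mult.assoc mult_1_right)
      moreover have "p \<noteq> 0" using p by (simp add: prime_in_def)
      ultimately have "w * z = 1" by simp
      thus ?thesis using z(1) unfolding dvd_in_def by metis
    next
      assume "dvd_in A q w"
      then obtain z where z: "z \<in> A" "w = p * w * z" using w by (auto simp: dvd_in_def)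
      have "w * (p * z) = w * 1" by (metis z(2) mult.assoc mult.commute mult_1_right)
      moreover have "w \<noteq> 0" using w qp by (auto simp: prime_in_def)
      ultimately have "p * z = 1" by simp
      hence "dvd_in A p 1" using z(1) unfolding dvd_in_def by metis
      thus ?thesis using p by (auto simp: prime_in_def)
    qed
  qed
  obtain as bs where s: "ps = as @ q # bs" using q(1) by (meson split_list)
  have "p * y = p * (u * w * prod_list (as @ bs))"
    using x w by (simp add: prime_product_def s algebra_simps)
  moreover have "p \<noteq> 0" using p by (simp add: prime_in_def)
  ultimately have "y = u * w * prod_list (as @ bs)" using mult_left_cancel by blast
  moreover have "prime_product A (u * w) (as @ bs) (u * w * prod_list (as @ bs))"
    using prime_product_mult[OF A, of u "as @ bs" "u * prod_list (as @ bs)" w "[]" w]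
      x s w \<open>dvd_in A w 1\<close> by (auto simp: prime_product_def algebra_simps)
  ultimately show ?thesis using s by (intro exI[of _ "u * w"] exI[of _ "as @ bs"]) auto
qed

section \<open>Gauss' lemma and elimination over a factorial subring\<close>

lemma dvd_in_const_iff:
  assumes A: "subring_set A" and f: "f \<in> polys_over A"
  shows "dvd_in (polys_over A) [:p:] f \<longleftrightarrow> (\<forall>i. dvd_in A p (coeff f i))"
proof
  assume "dvd_in (polys_over A) [:p:] f"
  thus "\<forall>i. dvd_in A p (coeff f i)" by (auto simp: dvd_in_def polys_over_def)
next
  assume "\<forall>i. dvd_in A p (coeff f i)"
  then obtain z where z: "\<And>i. z i \<in> A" "\<And>i. coeff f i = p * z i"
    unfolding dvd_in_def by metis
  define h where "h = (\<Sum>i\<le>degree f. monom (z i) i)"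
  have "h \<in> polys_over A" unfolding h_def
    by (intro subring_set_sum subring_polys_over A monom_polys_over subring_setD z)
  moreover have "f = [:p:] * h"
  proof -
    have "f = (\<Sum>i\<le>degree f. monom (coeff f i) i)" by (simp add: poly_as_sum_of_monoms)
    also have "\<dots> = smult p h" by (simp add: h_def z smult_sum2 smult_monom)
    finally show ?thesis by simp
  qed
  ultimately show "dvd_in (polys_over A) [:p:] f" by (auto simp: dvd_in_def)
qed

text \<open>In each factor take the first coefficient that \<open>p\<close> does not divide; the
  coefficient of the product at the sum of the two indices is then not divisible by \<open>p\<close>
  either.\<close>

lemma prime_in_const:
  fixes p :: "'a::idom"
  assumes A: "subring_set A" and p: "prime_in A p"
  shows "prime_in (polys_over A) [:p:]"
proof -
  note S = subring_polys_over[OF A]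
  have pA: "p \<in> A" "p \<noteq> 0" "\<not> dvd_in A p 1" using p by (auto simp: prime_in_def)
  have "\<not> dvd_in (polys_over A) [:p:] 1"
    using pA dvd_in_const_iff[OF A subring_setD(2)[OF S], of p] by (auto dest!: spec[of _ 0])
  moreover have "dvd_in (polys_over A) [:p:] f \<or> dvd_in (polys_over A) [:p:] g"
    if fg: "f \<in> polys_over A" "g \<in> polys_over A" and d: "dvd_in (polys_over A) [:p:] (f * g)" for f g
  proof (rule ccontr)
    assume "\<not> ?thesis"
    hence "\<exists>i. \<not> dvd_in A p (coeff f i)" "\<exists>i. \<not> dvd_in A p (coeff g i)"
      using dvd_in_const_iff[OF A] fg by auto
    then obtain i j where i: "\<not> dvd_in A p (coeff f i)" "\<And>k. k < i \<Longrightarrow> dvd_in A p (coeff f k)"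
      and j: "\<not> dvd_in A p (coeff g j)" "\<And>k. k < j \<Longrightarrow> dvd_in A p (coeff g k)"
      using exists_least_iff[of "\<lambda>i. \<not> dvd_in A p (coeff f i)"]
        exists_least_iff[of "\<lambda>i. \<not> dvd_in A p (coeff g i)"] by auto
    have "dvd_in A p (coeff (f * g) (i + j))"
      using d dvd_in_const_iff[OF A subring_setD(4)[OF S fg]] by blast
    also have "coeff (f * g) (i + j) = coeff f i * coeff g j +
        (\<Sum>k\<in>{..i+j} - {i}. coeff f k * coeff g (i + j - k))"
      unfolding coeff_mult by (subst sum.remove[of _ i]) auto
    finally have 1: "dvd_in A p (coeff f i * coeff g j +
        (\<Sum>k\<in>{..i+j} - {i}. coeff f k * coeff g (i + j - k)))" .
    have "dvd_in A p (\<Sum>k\<in>{..i+j} - {i}. coeff f k * coeff g (i + j - k))"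
    proof (rule dvd_in_sum[OF A])
      fix k assume "k \<in> {..i+j} - {i}"
      hence "k < i \<or> i + j - k < j" by auto
      thus "dvd_in A p (coeff f k * coeff g (i + j - k))"
        using i(2) j(2) fg by (auto intro: dvd_in_mult[OF A] dvd_in_mult2[OF A] coeff_polys_over)
    qed
    from dvd_in_add[OF A 1 dvd_in_uminus[OF A this]]
    have "dvd_in A p (coeff f i * coeff g j)" by simp
    thus False using p i j fg coeff_polys_over unfolding prime_in_def by blast
  qed
  ultimately show ?thesis using pA A by (auto simp: prime_in_def subring_setD)
qed

lemma unit_in_const:
  assumes A: "subring_set A" and "u \<in> A" "dvd_in A u 1"
  shows "dvd_in (polys_over A) [:u:] 1"
proof -
  obtain v where "v \<in> A" "1 = u * v" using assms by (auto simp: dvd_in_def)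
  thus ?thesis unfolding dvd_in_def
    by (intro bexI[of _ "[:v:]"]) (auto simp: one_pCons subring_setD[OF A] mult.commute)
qed

lemma unit_in_degree_0:
  fixes f :: "'a::idom poly"
  assumes "dvd_in B f 1" shows "degree f = 0"
  using assms unfolding dvd_in_def
  by (metis add_eq_0_iff_both_eq_0 degree_1 degree_mult_eq mult_eq_0_iff zero_neq_one)

text \<open>By \<open>prime_in_const\<close> every prime of \<open>c\<close> can be cancelled from
  \<open>q\<close> or from \<open>d\<close>. Only the constant \<open>a\<close> taken from
  \<open>d\<close> is recorded, because \<open>d\<close> is the polynomial to be recovered.\<close>

lemma gauss_distribute:
  fixes f q d :: "'a::idom poly"
  assumes A: "subring_set A" and c: "prime_product A u ps c"
    and "f \<in> polys_over A" "q \<in> polys_over A" "d \<in> polys_over A" "smult c f = q * d"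
  shows "\<exists>q'\<in>polys_over A. \<exists>d'\<in>polys_over A. \<exists>a\<in>A. a \<noteq> 0 \<and> f = q' * d' \<and> d = smult a d'"
  using assms(2-)
proof (induction ps arbitrary: c q d)
  case Nil
  then obtain v where v: "v \<in> A" "1 = u * v" by (auto simp: prime_product_def dvd_in_def)
  have cu: "c = u" using Nil.prems(1) by (simp add: prime_product_def)
  have "smult v (smult c f) = smult (u * v) f" unfolding cu smult_smult by (simp only: mult.commute)
  hence "f = smult v (smult c f)" by (simp flip: v(2))
  also have "\<dots> = smult v (q * d)" by (simp add: Nil)
  finally show ?case using Nil v
    by (intro bexI[of _ "smult v q"] bexI[of _ d] bexI[of _ 1])
      (auto simp: smult_polys_over[OF A] subring_setD[OF A])
next
  case (Cons p ps)
  note S = subring_polys_over[OF A]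
  have p: "prime_in A p" using Cons.prems by (simp add: prime_product_def)
  have pp: "prime_in (polys_over A) [:p:]" by (rule prime_in_const[OF A p])
  define c' where "c' = u * prod_list ps"
  have c': "prime_product A u ps c'" "c = p * c'" using Cons.prems
    by (auto simp: prime_product_def c'_def)
  have c'f: "smult c' f \<in> polys_over A"
    by (intro smult_polys_over A prime_product_in[OF A c'(1)] Cons.prems)
  have eq: "[:p:] * smult c' f = q * d" using Cons.prems(5) by (simp add: c' mult.commute)
  hence "dvd_in (polys_over A) [:p:] (q * d)" using c'f unfolding dvd_in_def by metis
  hence "dvd_in (polys_over A) [:p:] q \<or> dvd_in (polys_over A) [:p:] d"
    using pp Cons.prems by (auto simp: prime_in_def)
  thus ?case
  proof
    assume "dvd_in (polys_over A) [:p:] q"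
    then obtain q1 where q1: "q1 \<in> polys_over A" "q = [:p:] * q1" by (auto simp: dvd_in_def)
    have "[:p:] * smult c' f = [:p:] * (q1 * d)" unfolding eq q1(2) by (simp add: mult.assoc)
    moreover have "[:p:] \<noteq> 0" using p by (simp add: prime_in_def)
    ultimately have "smult c' f = q1 * d" using mult_left_cancel by blast
    from Cons.IH[OF c'(1) Cons.prems(2) q1(1) Cons.prems(4) this] show ?thesis .
  next
    assume "dvd_in (polys_over A) [:p:] d"
    then obtain d1 where d1: "d1 \<in> polys_over A" "d = [:p:] * d1" by (auto simp: dvd_in_def)
    have "[:p:] * smult c' f = [:p:] * (q * d1)" unfolding eq d1(2) by (simp add: algebra_simps)
    moreover have "[:p:] \<noteq> 0" using p by (simp add: prime_in_def)
    ultimately have "smult c' f = q * d1" using mult_left_cancel by blast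
    from Cons.IH[OF c'(1) Cons.prems(2,3) d1(1) this] obtain q' d' a where
      *: "q' \<in> polys_over A" "d' \<in> polys_over A" "a \<in> A" "a \<noteq> 0" "f = q' * d'" "d1 = smult a d'"
      by blast
    have "d = smult (p * a) d'" using * d1 by (simp add: mult.commute)
    moreover have "p * a \<in> A" "p * a \<noteq> 0" using * p by (auto simp: prime_in_def subring_setD[OF A])
    ultimately show ?thesis using * by blast
  qed
qed

text \<open>Moving the primes of \<open>c\<close> out of \<open>w * f\<close> changes
  \<open>f\<close> only by a constant \<open>a\<close>; since \<open>f\<close> is irreducible of
  positive degree, \<open>a\<close> is a unit.\<close>

lemma irreducible_in_dvd_smult:
  fixes f g :: "'a::idom poly"
  assumes A: "subring_set A" and c: "prime_product A u ps c"
    and f: "irreducible_in (polys_over A) f" "degree f > 0" and g: "g \<in> polys_over A"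
    and d: "dvd_in (polys_over A) f (smult c g)"
  shows "dvd_in (polys_over A) f g"
proof -
  have fA: "f \<in> polys_over A" using f by (simp add: irreducible_in_def)
  note S = subring_polys_over[OF A]
  obtain w where w: "w \<in> polys_over A" "smult c g = w * f"
    using d by (auto simp: dvd_in_def mult.commute)
  from gauss_distribute[OF A c g w(1) fA w(2)] obtain q' d' a where
    *: "q' \<in> polys_over A" "d' \<in> polys_over A" "a \<in> A" "a \<noteq> 0" "g = q' * d'" "f = smult a d'" by blast
  have "f = [:a:] * d'" using * by simp
  moreover have "\<not> dvd_in (polys_over A) d' 1" using unit_in_degree_0[of _ d'] f *
    by (metis degree_smult_eq less_not_refl)
  ultimately have "dvd_in (polys_over A) [:a:] 1"
    using f * unfolding irreducible_in_def by (metis A const_polys_over subring_setD(1))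
  then obtain b where b: "b \<in> polys_over A" "1 = [:a:] * b" by (auto simp: dvd_in_def)
  have "d' = f * b" using b(2) \<open>f = [:a:] * d'\<close> by (metis mult.assoc mult.commute mult_1_right)
  thus ?thesis using * b S unfolding dvd_in_def by (metis mult.assoc mult.commute subring_setD(4))
qed

text \<open>A substitute for Bezout's identity over the fraction field. A combination of
  \<open>f\<close> and \<open>g\<close> of least degree, if it is not constant, divides both up to
  constants, and Gauss' lemma turns this into divisibility by \<open>f\<close>.\<close>

lemma irreducible_in_eliminate:
  fixes f g :: "'a::idom poly"
  assumes A: "subring_set A" and fact: "factorial_in A"
    and f: "irreducible_in (polys_over A) f" "degree f > 0" and g: "g \<in> polys_over A"
  shows "dvd_in (polys_over A) f g \<or>
    (\<exists>d\<in>A. d \<noteq> 0 \<and> (\<exists>u\<in>polys_over A. \<exists>v\<in>polys_over A. [:d:] = u * f + v * g))"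
proof -
  note S = subring_polys_over[OF A]
  have fA: "f \<in> polys_over A" "f \<noteq> 0" using f by (auto simp: irreducible_in_def)
  define J where "J = {h. h \<noteq> 0 \<and> (\<exists>u\<in>polys_over A. \<exists>v\<in>polys_over A. h = u * f + v * g)}"
  have "f = 1 * f + 0 * g" by simp
  hence "f \<in> J" using fA subring_setD(1,2)[OF S] unfolding J_def by blast
  then obtain d where d: "d \<in> J" "\<And>h. h \<in> J \<Longrightarrow> degree d \<le> degree h"
    using ex_has_least_nat[of "\<lambda>h. h \<in> J" f degree] by blast
  obtain u v where uv: "u \<in> polys_over A" "v \<in> polys_over A" "d = u * f + v * g" "d \<noteq> 0"
    using d by (auto simp: J_def)
  have dA: "d \<in> polys_over A" unfolding uv by (intro subring_setD[OF S] uv fA g)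
  show ?thesis
  proof (cases "degree d = 0")
    case True
    then obtain c where "d = [:c:]" by (metis degree_0_id)
    moreover from this have "c \<in> A" "c \<noteq> 0" using uv(4) dA A by (auto simp: subring_setD)
    ultimately show ?thesis using uv(1-3) by metis
  next
    case False
    \<comment> \<open>Pseudo-division by \<open>d\<close> leaves a remainder that is again a
      combination of \<open>f\<close> and \<open>g\<close>, so by minimality of the degree it is
      zero.\<close>
    have red: "\<exists>c\<in>A. c \<noteq> 0 \<and> (\<exists>q\<in>polys_over A. smult c h = q * d)"
      if h: "h \<in> polys_over A" "\<exists>s\<in>polys_over A. \<exists>t\<in>polys_over A. h = s * f + t * g" for h
    proof -
      obtain n q r where *: "q \<in> polys_over A" "r \<in> polys_over A"
        "smult (lead_coeff d ^ n) h = q * d + r" "r = 0 \<or> degree r < degree d"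
        using pseudo_division_over[OF A dA uv(4) h(1)] by blast
      obtain s t where st: "s \<in> polys_over A" "t \<in> polys_over A" "h = s * f + t * g" using h by blast
      have lc: "lead_coeff d ^ n \<in> A" using dA by (auto intro!: subring_set_power[OF A] coeff_polys_over)
      have "r = smult (lead_coeff d ^ n) h - q * d" using * by simp
      also have "\<dots> = (smult (lead_coeff d ^ n) s - q * u) * f + (smult (lead_coeff d ^ n) t - q * v) * g"
        unfolding st uv(3)
        by (simp add: algebra_simps smult_add_right)
      finally have "r = 0 \<or> r \<in> J" unfolding J_def
        using * uv st lc by (blast intro: subring_setD[OF S] smult_polys_over[OF A])
      hence "r = 0" using d(2)[of r] *(4) by auto
      thus ?thesis using *(1,3) lc uv(4) by (intro bexI[of _ "lead_coeff d ^ n"]) (auto simp del: uv(3))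
    qed
    have "\<exists>s\<in>polys_over A. \<exists>t\<in>polys_over A. f = s * f + t * g"
      by (intro bexI[of _ 1] bexI[of _ 0]) (auto simp: subring_setD[OF S])
    from red[OF fA(1) this] obtain c q where c: "c \<in> A" "c \<noteq> 0" "q \<in> polys_over A" "smult c f = q * d"
      by blast
    obtain u1 ps where "prime_product A u1 ps c" using fact c by (auto simp: factorial_in_def)
    from gauss_distribute[OF A this fA(1) c(3) dA c(4)] obtain q' d' a where
      *: "q' \<in> polys_over A" "d' \<in> polys_over A" "a \<in> A" "a \<noteq> 0" "f = q' * d'" "d = smult a d'" by blast
    \<comment> \<open>In \<open>f = q' * d'\<close> the factor \<open>d'\<close> has positive
      degree, so irreducibility makes \<open>q'\<close> a unit and \<open>d'\<close> an associate of
      \<open>f\<close>.\<close>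
    have "\<not> dvd_in (polys_over A) d' 1" using unit_in_degree_0[of _ d'] False * by auto
    hence "dvd_in (polys_over A) q' 1" using * f by (auto simp: irreducible_in_def)
    then obtain b where b: "b \<in> polys_over A" "1 = q' * b" by (auto simp: dvd_in_def)
    have d'f: "d' = f * b" using b(2) *(5) by (metis mult.assoc mult.commute mult_1_right)
    have "\<exists>s\<in>polys_over A. \<exists>t\<in>polys_over A. g = s * f + t * g"
      by (intro bexI[of _ 0] bexI[of _ 1]) (auto simp: subring_setD[OF S])
    from red[OF g this] obtain c' r where c': "c' \<in> A" "c' \<noteq> 0" "r \<in> polys_over A" "smult c' g = r * d"
      by blast
    obtain u2 qs where pp: "prime_product A u2 qs c'" using fact c' by (auto simp: factorial_in_def)
    have "smult c' g = r * smult a (f * b)" using c'(4) *(6) unfolding d'f by (simp only:)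
    hence "smult c' g = f * (r * smult a b)" by (simp add: ac_simps)
    moreover have "r * smult a b \<in> polys_over A"
      by (intro subring_setD[OF S] smult_polys_over[OF A] c' * b)
    ultimately have "dvd_in (polys_over A) f (smult c' g)" unfolding dvd_in_def by blast
    from irreducible_in_dvd_smult[OF A pp f g this] show ?thesis by blast
  qed
qed

text \<open>If \<open>f\<close> does not divide \<open>g\<close>, the eliminated constant
  \<open>c = u * f + v * g\<close> makes \<open>c * h\<close> a multiple of \<open>f\<close>, and
  the constant can be cancelled.\<close>

lemma irreducible_in_imp_prime_in:
  fixes f :: "'a::idom poly"
  assumes A: "subring_set A" and fact: "factorial_in A"
    and f: "irreducible_in (polys_over A) f" "degree f > 0"
  shows "prime_in (polys_over A) f"
proof -
  note S = subring_polys_over[OF A]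
  have fA: "f \<in> polys_over A" using f by (auto simp: irreducible_in_def)
  have "dvd_in (polys_over A) f h"
    if gh: "g \<in> polys_over A" "h \<in> polys_over A" and d: "dvd_in (polys_over A) f (g * h)"
      and n: "\<not> dvd_in (polys_over A) f g" for g h
  proof -
    obtain c u v where c: "c \<in> A" "c \<noteq> 0" "u \<in> polys_over A" "v \<in> polys_over A" "[:c:] = u * f + v * g"
      using irreducible_in_eliminate[OF A fact f gh(1)] n by blast
    obtain u1 ps where pp: "prime_product A u1 ps c" using fact c by (auto simp: factorial_in_def)
    have "smult c h = [:c:] * h" by simp
    also have "\<dots> = f * (u * h) + (g * h) * v" unfolding c by (simp add: algebra_simps)
    finally have "smult c h = f * (u * h) + (g * h) * v" .
    moreover have "dvd_in (polys_over A) f (f * (u * h) + (g * h) * v)"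
      by (intro dvd_in_add[OF S] dvd_in_mult[OF S] d c dvd_in_self[OF S] subring_setD[OF S] gh)
    ultimately show ?thesis using irreducible_in_dvd_smult[OF A pp f gh(2)] by simp
  qed
  thus ?thesis using f unfolding prime_in_def irreducible_in_def by blast
qed

lemma lead_coeff_dvd_in:
  fixes f g :: "'a::idom poly"
  assumes "g \<in> polys_over A" "f = [:p:] * g"
  shows "lead_coeff g \<in> A" "lead_coeff f = p * lead_coeff g"
  using assms by (auto simp: lead_coeff_mult coeff_polys_over)

text \<open>Two nested inductions: splitting off a constant prime keeps the degree but shortens the
  factorization of the leading coefficient, while a nontrivial factorization of a primitive
  polynomial lowers the degree.\<close>

theorem factorial_in_polys_over:
  fixes A :: "'a::idom set"
  assumes A: "subring_set A" and fact: "factorial_in A"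
  shows "factorial_in (polys_over A)"
proof -
  note S = subring_polys_over[OF A]
  have "\<exists>u ps. prime_product (polys_over A) u ps f"
    if "f \<in> polys_over A" "f \<noteq> 0" "degree f = n" for f n
    using that
  proof (induction n arbitrary: f rule: less_induct)
    case (less n)
    \<comment> \<open>The primitive case, without constant prime divisors: every divisor of degree
      zero is a unit, so both factors of a nontrivial product have smaller degree than
      \<open>f\<close>.\<close>
    have prim: "\<exists>u ps. prime_product (polys_over A) u ps f"
      if f: "f \<in> polys_over A" "f \<noteq> 0" "degree f = n"
        and np: "\<nexists>p. prime_in A p \<and> dvd_in (polys_over A) [:p:] f" for f
    proof -
      have const_unit: "dvd_in (polys_over A) g 1"
        if g: "g \<in> polys_over A" "degree g = 0" "dvd_in (polys_over A) g f" for g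
      proof -
        obtain c where c: "g = [:c:]" using g by (metis degree_0_id)
        have "c \<in> A" "c \<noteq> 0" using c g f A by (auto simp: dvd_in_def subring_setD)
        then obtain u ps where pp: "prime_product A u ps c" using fact by (auto simp: factorial_in_def)
        have "ps = []"
        proof (rule ccontr)
          assume "ps \<noteq> []"
          then obtain p qs where ps: "ps = p # qs" by (cases ps) auto
          have p: "prime_in A p" using pp ps by (simp add: prime_product_def)
          have "prime_product A u qs (u * prod_list qs)" using pp ps by (simp add: prime_product_def)
          from prime_product_in[OF A this] have "dvd_in A p c"
            using pp ps unfolding dvd_in_def prime_product_def by (auto simp: algebra_simps)
          hence "dvd_in (polys_over A) [:p:] g" using dvd_in_const_iff[OF A g(1)] c
            by (auto simp: coeff_pCons dvd_in_0[OF A] split: nat.splits)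
          hence "dvd_in (polys_over A) [:p:] f" using g dvd_in_trans[OF S] by blast
          thus False using np p by blast
        qed
        hence "dvd_in A c 1" "c \<in> A" using pp \<open>c \<in> A\<close> by (auto simp: prime_product_def)
        thus ?thesis using unit_in_const[OF A] c by simp
      qed
      show ?thesis
      proof (cases "dvd_in (polys_over A) f 1")
        case True
        thus ?thesis using f by (intro exI[of _ f] exI[of _ "[]"]) (simp add: prime_product_def)
      next
        case nonunit: False
        hence deg: "degree f > 0" using const_unit[OF f(1)] dvd_in_self[OF S, of f] by blast
        show ?thesis
        proof (cases "irreducible_in (polys_over A) f")
          case True
          from irreducible_in_imp_prime_in[OF A fact this deg] show ?thesis
            by (intro exI[of _ 1] exI[of _ "[f]"])
              (auto simp: prime_product_def subring_setD[OF S] dvd_in_self[OF S])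
        next
          case False
          then obtain g h where gh: "g \<in> polys_over A" "h \<in> polys_over A" "f = g * h"
            "\<not> dvd_in (polys_over A) g 1" "\<not> dvd_in (polys_over A) h 1"
            using f nonunit by (auto simp: irreducible_in_def)
          have "dvd_in (polys_over A) g f" "dvd_in (polys_over A) h f"
            using gh by (auto simp: dvd_in_def mult.commute)
          hence "degree g > 0" "degree h > 0" using const_unit gh by blast+
          moreover have "g \<noteq> 0" "h \<noteq> 0" using gh f by auto
          moreover have "degree g + degree h = n"
            using f gh \<open>g \<noteq> 0\<close> \<open>h \<noteq> 0\<close> by (simp add: degree_mult_eq)
          ultimately obtain u ps v qs where
            "prime_product (polys_over A) u ps g" "prime_product (polys_over A) v qs h"
            using less.IH[of "degree g" g] less.IH[of "degree h" h] gh by auto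
          from prime_product_mult[OF S this] show ?thesis using gh by blast
        qed
      qed
    qed
    \<comment> \<open>The general case: a constant prime dividing \<open>f\<close> divides its
      leading coefficient, so only finitely many can be removed before \<open>f\<close> is
      primitive.\<close>
    have "\<exists>u ps. prime_product (polys_over A) u ps f"
      if "prime_product A v qs (lead_coeff f)" "f \<in> polys_over A" "f \<noteq> 0" "degree f = n" for v qs f
      using that
    proof (induction "length qs" arbitrary: f v qs rule: less_induct)
      case (less qs f v)
      show ?case
      proof (cases "\<exists>p. prime_in A p \<and> dvd_in (polys_over A) [:p:] f")
        case True
        then obtain p g where p: "prime_in A p" "g \<in> polys_over A" "f = [:p:] * g"
          by (auto simp: dvd_in_def)
        have "prime_product A v qs (p * lead_coeff g)" "lead_coeff g \<in> A"
          using less.prems p lead_coeff_dvd_in[OF p(2,3)] by auto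
        from prime_product_cancel[OF A this(1) p(1) this(2)] obtain v' qs' where
          *: "prime_product A v' qs' (lead_coeff g)" "length qs = Suc (length qs')" by blast
        have "p \<noteq> 0" "g \<noteq> 0" using p less.prems by (auto simp: prime_in_def)
        hence "degree g = n" using p less.prems by simp
        then obtain u ps where "prime_product (polys_over A) u ps g"
          using less.hyps[of qs' v' g] * p \<open>g \<noteq> 0\<close> by auto
        moreover have "prime_product (polys_over A) 1 [[:p:]] [:p:]" using prime_in_const[OF A p(1)]
          by (simp add: prime_product_def dvd_in_self[OF S] subring_setD[OF S])
        ultimately show ?thesis using prime_product_mult[OF S] p(3) by blast
      next
        case False
        thus ?thesis using prim less.prems by blast
      qed
    qed
    thus ?case using less.prems fact coeff_polys_over unfolding factorial_in_def
      by (metis leading_coeff_0_iff)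
  qed
  thus ?thesis by (auto simp: factorial_in_def)
qed

section \<open>Polynomials in several variables\<close>

text \<open>The common generalization of \<open>peval\<close>, where the target is the closure of K,
  and of \<open>split_var\<close>, where the target is a polynomial ring over K[a].\<close>

definition poly_eval ::
  "('k::comm_ring_1 \<Rightarrow> 'r::comm_ring_1) \<Rightarrow> ('n::finite \<Rightarrow> 'r) \<Rightarrow> ('n, 'k) ppoly \<Rightarrow> 'r" where
  "poly_eval h a P = (\<Sum>m\<in>Poly_Mapping.keys P. h (Poly_Mapping.lookup P m) *
     (\<Prod>i\<in>UNIV. a i ^ Poly_Mapping.lookup m i))"

lemma poly_mapping_sum_single:
  "P = (\<Sum>m\<in>Poly_Mapping.keys P. Poly_Mapping.single m (Poly_Mapping.lookup P m))"
  by (rule poly_mapping_eqI)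
    (auto simp: lookup_sum lookup_single when_def sum.delta not_in_keys_iff_lookup_eq_zero)

context
  fixes h :: "'k::comm_ring_1 \<Rightarrow> 'r::comm_ring_1" and a :: "'n::finite \<Rightarrow> 'r"
  assumes h: "h 0 = 0" "h 1 = 1" "\<And>x y. h (x + y) = h x + h y" "\<And>x y. h (x * y) = h x * h y"
begin

lemma poly_eval_superset:
  assumes "finite T" "Poly_Mapping.keys P \<subseteq> T"
  shows "poly_eval h a P = (\<Sum>m\<in>T. h (Poly_Mapping.lookup P m) * (\<Prod>i\<in>UNIV. a i ^ Poly_Mapping.lookup m i))"
  unfolding poly_eval_def using assms h(1)
  by (intro sum.mono_neutral_left) (auto simp: not_in_keys_iff_lookup_eq_zero)

lemma poly_eval_add: "poly_eval h a (P + Q) = poly_eval h a P + poly_eval h a Q"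
proof -
  let ?T = "Poly_Mapping.keys P \<union> Poly_Mapping.keys Q"
  have "Poly_Mapping.keys (P + Q) \<subseteq> ?T" by (rule keys_add)
  thus ?thesis
    by (simp add: poly_eval_superset[of ?T] lookup_add h sum.distrib[symmetric] distrib_right)
qed

lemma poly_eval_0: "poly_eval h a 0 = 0"
  by (simp add: poly_eval_def)

lemma poly_eval_single:
  "poly_eval h a (Poly_Mapping.single m c) = h c * (\<Prod>i\<in>UNIV. a i ^ Poly_Mapping.lookup m i)"
  using h(1) by (subst poly_eval_superset[of "{m}"]) auto

lemma poly_eval_sum: "poly_eval h a (sum f S) = (\<Sum>x\<in>S. poly_eval h a (f x))"
  by (induction S rule: infinite_finite_induct) (auto simp: poly_eval_add poly_eval_0)

lemma poly_eval_1: "poly_eval h a 1 = 1"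
  using poly_eval_single[of 0 1] h(2) by simp

lemma poly_eval_mult: "poly_eval h a (P * Q) = poly_eval h a P * poly_eval h a Q"
proof -
  let ?s = "\<lambda>P m. Poly_Mapping.single m (Poly_Mapping.lookup P m)"
  have "P * Q = (\<Sum>m\<in>Poly_Mapping.keys P. ?s P m) * (\<Sum>n\<in>Poly_Mapping.keys Q. ?s Q n)"
    by (simp flip: poly_mapping_sum_single)
  also have "\<dots> = (\<Sum>m\<in>Poly_Mapping.keys P. \<Sum>n\<in>Poly_Mapping.keys Q. ?s P m * ?s Q n)"
    by (rule sum_product)
  finally have "poly_eval h a (P * Q) =
      (\<Sum>m\<in>Poly_Mapping.keys P. \<Sum>n\<in>Poly_Mapping.keys Q. poly_eval h a (?s P m * ?s Q n))"
    by (simp only: poly_eval_sum)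
  also have "\<dots> = (\<Sum>m\<in>Poly_Mapping.keys P. \<Sum>n\<in>Poly_Mapping.keys Q.
      poly_eval h a (?s P m) * poly_eval h a (?s Q n))"
    by (simp add: mult_single poly_eval_single h lookup_add power_add prod.distrib ac_simps)
  also have "\<dots> = (\<Sum>m\<in>Poly_Mapping.keys P. poly_eval h a (?s P m)) *
      (\<Sum>n\<in>Poly_Mapping.keys Q. poly_eval h a (?s Q n))"
    by (rule sum_product[symmetric])
  also have "\<dots> = poly_eval h a P * poly_eval h a Q"
    by (simp flip: poly_eval_sum poly_mapping_sum_single)
  finally show ?thesis .
qed

lemma poly_eval_hom: "comm_ring_hom (poly_eval h a)"
  by unfold_locales (auto simp: poly_eval_0 poly_eval_1 poly_eval_add poly_eval_mult)

end

section \<open>Polynomials in some of the variables\<close>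

definition Var :: "'n \<Rightarrow> ('n, 'k::comm_ring_1) ppoly" where
  "Var i = Poly_Mapping.single (Poly_Mapping.single i 1) 1"

lemma Var_power: "Var i ^ n = Poly_Mapping.single (Poly_Mapping.single i n) 1"
  by (induction n) (auto simp: Var_def mult_single simp flip: single_add)

lemma single_sum_1:
  "finite S \<Longrightarrow> Poly_Mapping.single (\<Sum>i\<in>S. f i) (1::'k::comm_ring_1) = (\<Prod>i\<in>S. Poly_Mapping.single (f i) 1)"
proof (induction S rule: finite_induct)
  case (insert x F)
  have "Poly_Mapping.single (\<Sum>i\<in>insert x F. f i) (1::'k) =
      Poly_Mapping.single (f x) 1 * Poly_Mapping.single (\<Sum>i\<in>F. f i) 1"
    using insert(1,2) by (simp add: mult_single)
  thus ?case using insert by simp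
qed simp

lemma single_conv_Var:
  fixes m :: "'n::finite \<Rightarrow>\<^sub>0 nat" and c :: "'k::comm_ring_1"
  shows "Poly_Mapping.single m c = Poly_Mapping.single 0 c * (\<Prod>i\<in>UNIV. Var i ^ Poly_Mapping.lookup m i)"
proof -
  have "m = (\<Sum>i\<in>UNIV. Poly_Mapping.single i (Poly_Mapping.lookup m i))"
    by (rule poly_mapping_eqI) (auto simp: lookup_sum lookup_single when_def)
  hence "Poly_Mapping.single m (1::'k) = (\<Prod>i\<in>UNIV. Var i ^ Poly_Mapping.lookup m i)"
    unfolding Var_power by (metis (no_types) finite_UNIV single_sum_1)
  moreover have "Poly_Mapping.single m c = Poly_Mapping.single 0 c * Poly_Mapping.single m 1"
    by (simp add: mult_single)
  ultimately show ?thesis by simp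
qed

text \<open>The subring generated over the constants by the listed variables, built one variable at
  a time so that each step is an image of a polynomial ring over the previous subring.\<close>

primrec polys_in :: "'n list \<Rightarrow> ('n, 'k::comm_ring_1) ppoly set" where
  "polys_in [] = Set.range (Poly_Mapping.single 0)"
| "polys_in (i # is) = (\<lambda>f. poly f (Var i)) ` polys_over (polys_in is)"

lemma subring_hom_image:
  assumes "subring_set A" "comm_ring_hom \<Phi>"
  shows "subring_set (\<Phi> ` A)"
proof -
  interpret comm_ring_hom \<Phi> by fact
  show ?thesis using subring_setD[OF assms(1)] unfolding subring_set_def
    by (auto simp flip: hom_add hom_mult hom_uminus intro: image_eqI[of _ _ 0] image_eqI[of _ _ 1])
qed

lemma poly_hom: "comm_ring_hom (\<lambda>f. poly f (x::'a::comm_ring_1))"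
  by unfold_locales auto

lemma subring_polys_in: "subring_set (polys_in is :: ('n, 'k::comm_ring_1) ppoly set)"
proof (induction "is")
  case Nil
  have "comm_ring_hom (Poly_Mapping.single 0 :: 'k \<Rightarrow> ('n, 'k) ppoly)"
    by unfold_locales (auto simp: single_add mult_single)
  from subring_hom_image[OF subring_set_UNIV this] show ?case by simp
next
  case (Cons i "is")
  show ?case unfolding polys_in.simps
    by (rule subring_hom_image[OF subring_polys_over[OF Cons] poly_hom])
qed

lemma const_in_polys_in: "Poly_Mapping.single 0 c \<in> (polys_in is :: ('n, 'k::comm_ring_1) ppoly set)"
proof (induction "is")
  case (Cons i "is")
  have "poly [:Poly_Mapping.single 0 c:] (Var i) = (Poly_Mapping.single 0 c :: ('n, 'k) ppoly)" by simp
  moreover have "[:Poly_Mapping.single 0 c:] \<in> polys_over (polys_in is :: ('n, 'k) ppoly set)"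
    by (subst const_polys_over) (rule subring_setD(1)[OF subring_polys_in], rule Cons)
  ultimately show ?case unfolding polys_in.simps by (metis imageI)
qed auto

lemma Var_in_polys_in: "i \<in> set is \<Longrightarrow> Var i \<in> (polys_in is :: ('n, 'k::comm_ring_1) ppoly set)"
proof (induction "is")
  case (Cons j "is")
  note S = subring_polys_in[of "is", where 'k = 'k]
  show ?case
  proof (cases "i = j")
    case True
    have "poly [:0, 1:] (Var j) = (Var j :: ('n, 'k) ppoly)" by simp
    moreover have "[:0, 1:] \<in> polys_over (polys_in is :: ('n, 'k) ppoly set)"
      using subring_setD[OF S] by (auto simp: polys_over_def coeff_pCons split: nat.splits)
    ultimately show ?thesis unfolding polys_in.simps True by (metis imageI)
  next
    case False
    hence "Var i \<in> (polys_in is :: ('n, 'k) ppoly set)" using Cons by auto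
    moreover have "poly [:Var i :: ('n, 'k) ppoly:] (Var j) = Var i" by simp
    ultimately show ?thesis unfolding polys_in.simps using subring_setD(1)[OF S]
      by (metis const_polys_over imageI)
  qed
qed auto

lemma polys_in_UNIV:
  assumes "set is = (UNIV :: 'n::finite set)"
  shows "polys_in is = (UNIV :: ('n, 'k::comm_ring_1) ppoly set)"
proof -
  note S = subring_polys_in[of "is"]
  have "P \<in> polys_in is" for P :: "('n, 'k) ppoly"
    using assms by (subst poly_mapping_sum_single, intro subring_set_sum[OF S], subst single_conv_Var)
      (intro subring_setD(4)[OF S] const_in_polys_in subring_set_prod[OF S] subring_set_power[OF S], auto intro: Var_in_polys_in)
  thus ?thesis by auto
qed

text \<open>Separating the variable \<open>i\<close>: a left inverse of \<open>f \<mapsto> f(X\<^sub>i)\<close> on polynomials free of \<open>X\<^sub>i\<close>.\<close>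

definition split_var :: "'n \<Rightarrow> ('n::finite, 'k::comm_ring_1) ppoly \<Rightarrow> ('n, 'k) ppoly poly" where
  "split_var i = poly_eval (\<lambda>c. [:Poly_Mapping.single 0 c:]) (\<lambda>j. if j = i then [:0, 1:] else [:Var j:])"

lemma split_var_hom: "comm_ring_hom (split_var i)"
  unfolding split_var_def by (rule poly_eval_hom) (auto simp: single_add mult_single one_pCons mult.commute)

lemma split_var_const: "split_var i (Poly_Mapping.single 0 c) = [:Poly_Mapping.single 0 c:]"
  unfolding split_var_def by (subst poly_eval_single) (auto simp: single_add mult_single mult.commute)

lemma split_var_Var: "split_var i (Var j) = (if j = i then [:0, 1:] else [:Var j:])"
proof -
  let ?a = "\<lambda>j. if j = i then [:0, 1:] else [:Var j :: ('a,'b) ppoly:]"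
  have "split_var i (Var j :: ('a,'b) ppoly) =
      [:Poly_Mapping.single 0 1:] * (\<Prod>k\<in>UNIV. ?a k ^ Poly_Mapping.lookup (Poly_Mapping.single j 1) k)"
    unfolding split_var_def Var_def by (subst poly_eval_single) (auto simp: single_add mult_single one_pCons mult.commute)
  also have "(\<Prod>k\<in>UNIV. ?a k ^ Poly_Mapping.lookup (Poly_Mapping.single j 1) k) =
      (\<Prod>k\<in>UNIV. if k = j then ?a k else 1)"
    by (intro prod.cong) (auto simp: lookup_single when_def)
  also have "\<dots> = ?a j" by simp
  finally show ?thesis by simp
qed

lemma poly_map_const: "poly (map_poly (\<lambda>c. [:c:]) f) [:x:] = [:poly f (x::'a::comm_ring_1):]"
  by (induction f) (auto simp: map_poly_pCons)

lemma split_var_free: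
  assumes "i \<notin> set is" "P \<in> polys_in is"
  shows "split_var i P = [:P:]"
  using assms
proof (induction "is" arbitrary: P)
  case Nil
  then show ?case by (auto simp: split_var_const)
next
  case (Cons j "is")
  interpret s: comm_ring_hom "split_var i" by (rule split_var_hom)
  obtain f where f: "f \<in> polys_over (polys_in is)" "P = poly f (Var j)" using Cons by auto
  have "split_var i P = poly (map_poly (split_var i) f) (split_var i (Var j))"
    by (simp add: f)
  also have "split_var i (Var j) = [:Var j:]" using Cons by (auto simp: split_var_Var)
  also have "map_poly (split_var i) f = map_poly (\<lambda>c. [:c:]) f"
    using Cons f by (intro poly_eqI) (auto simp: polys_over_def coeff_map_poly)
  finally show ?case by (simp add: f poly_map_const)
qed

text \<open>Yields the injectivity of evaluation at \<open>Var i\<close>: this variable is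
  transcendental over the subring of the variables in the list, so the tower of subrings really
  consists of polynomial rings.\<close>

lemma split_var_poly_Var:
  fixes f :: "('n::finite, 'k::comm_ring_1) ppoly poly"
  assumes "i \<notin> set is" "f \<in> polys_over (polys_in is)"
  shows "split_var i (poly f (Var i)) = f"
proof -
  interpret s: comm_ring_hom "split_var i :: ('n, 'k) ppoly \<Rightarrow> _" by (rule split_var_hom)
  have "split_var i (poly f (Var i)) = poly (map_poly (split_var i) f) [:0, 1:]"
    using s.poly_map_poly[of f "Var i"] by (simp add: split_var_Var)
  also have "map_poly (split_var i) f = map_poly (\<lambda>c. [:c:]) f"
    using split_var_free[OF assms(1), where 'b = 'k] assms(2)
    by (intro poly_eqI) (simp add: polys_over_def coeff_map_poly)
  also have "poly \<dots> [:0, 1:] = f"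
    by (induction f) (auto simp: map_poly_pCons)
  finally show ?thesis .
qed

section \<open>Transport of factorizations along a homomorphism\<close>

lemma dvd_in_image:
  assumes hom: "comm_ring_hom \<Phi>" and S: "subring_set C" and inj: "inj_on \<Phi> C"
    and xy: "x \<in> C" "y \<in> C"
  shows "dvd_in (\<Phi> ` C) (\<Phi> x) (\<Phi> y) \<longleftrightarrow> dvd_in C x y"
proof -
  interpret comm_ring_hom \<Phi> by fact
  have "\<Phi> y = \<Phi> x * \<Phi> z \<longleftrightarrow> y = x * z" if "z \<in> C" for z
    using inj_on_eq_iff[OF inj xy(2) subring_setD(4)[OF S xy(1) that]] by (simp add: hom_mult)
  thus ?thesis unfolding dvd_in_def by blast
qed

text \<open>Injectivity is asked on \<open>C\<close> only, because evaluation at a variable is not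
  injective on all polynomials over K[a].\<close>

lemma prime_in_image:
  assumes hom: "comm_ring_hom \<Phi>" and S: "subring_set C" and inj: "inj_on \<Phi> C"
    and p: "prime_in C p"
  shows "prime_in (\<Phi> ` C) (\<Phi> p)"
proof -
  interpret comm_ring_hom \<Phi> by fact
  note d = dvd_in_image[OF hom S inj]
  have pC: "p \<in> C" "p \<noteq> 0" "\<not> dvd_in C p 1" using p by (auto simp: prime_in_def)
  have "\<Phi> p \<noteq> 0" using inj_on_eq_iff[OF inj pC(1) subring_setD(1)[OF S]] pC by simp
  moreover have "\<not> dvd_in (\<Phi> ` C) (\<Phi> p) 1"
    using d[OF pC(1) subring_setD(2)[OF S]] pC by simp
  moreover have "dvd_in (\<Phi> ` C) (\<Phi> p) (\<Phi> x) \<or> dvd_in (\<Phi> ` C) (\<Phi> p) (\<Phi> y)"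
    if "x \<in> C" "y \<in> C" "dvd_in (\<Phi> ` C) (\<Phi> p) (\<Phi> x * \<Phi> y)" for x y
    using that d[OF pC(1)] p subring_setD(4)[OF S that(1,2)] unfolding prime_in_def
    by (metis hom_mult)
  ultimately show ?thesis using pC(1) by (auto simp: prime_in_def)
qed

lemma factorial_in_image:
  assumes hom: "comm_ring_hom \<Phi>" and S: "subring_set C" and inj: "inj_on \<Phi> C"
    and fact: "factorial_in C"
  shows "factorial_in (\<Phi> ` C)"
  unfolding factorial_in_def
proof (intro ballI impI)
  interpret comm_ring_hom \<Phi> by fact
  fix y assume "y \<in> \<Phi> ` C" "y \<noteq> 0"
  then obtain x where "x \<in> C" "y = \<Phi> x" "\<Phi> x \<noteq> 0" by blast
  moreover from this have "x \<noteq> 0" by auto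
  ultimately have x: "x \<in> C" "y = \<Phi> x" "x \<noteq> 0" by auto
  then obtain u ps where *: "prime_product C u ps x" using fact by (auto simp: factorial_in_def)
  hence "dvd_in (\<Phi> ` C) (\<Phi> u) 1"
    using dvd_in_image[OF hom S inj, of u 1] subring_setD(2)[OF S] by (auto simp: prime_product_def)
  hence "prime_product (\<Phi> ` C) (\<Phi> u) (map \<Phi> ps) y"
    using * x prime_in_image[OF hom S inj] by (auto simp: prime_product_def hom_distribs)
  thus "\<exists>u ps. prime_product (\<Phi> ` C) u ps y" by blast
qed

lemma factorial_in_field: "factorial_in (UNIV :: 'a::field set)"
  unfolding factorial_in_def prime_product_def
  by (auto intro!: exI[of _ "[]"] simp: dvd_field_iff)

lemma factorial_in_polys_in:
  assumes "distinct is"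
  shows "factorial_in (polys_in is :: ('n::{finite,linorder}, 'k::field) ppoly set)"
  using assms
proof (induction "is")
  case Nil
  have hom: "comm_ring_hom (Poly_Mapping.single 0 :: 'k \<Rightarrow> ('n, 'k) ppoly)"
    by unfold_locales (auto simp: single_add mult_single)
  show ?case unfolding polys_in.simps
    by (rule factorial_in_image[OF hom subring_set_UNIV _ factorial_in_field]) (metis inj_onI lookup_single_eq)
next
  case (Cons i "is")
  note S = subring_polys_in[of "is", where 'k = 'k]
  have "inj_on (\<lambda>f. poly f (Var i)) (polys_over (polys_in is :: ('n, 'k) ppoly set))"
    using split_var_poly_Var[of i "is"] Cons.prems by (intro inj_on_inverseI[of _ "split_var i"]) auto
  from factorial_in_image[OF poly_hom subring_polys_over[OF S] this factorial_in_polys_over[OF S]]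
  show ?case using Cons by simp
qed

theorem factorial_in_ppoly: "factorial_in (UNIV :: ('n::{finite,linorder}, 'k::field) ppoly set)"
proof -
  obtain "is" :: "'n list" where "set is = UNIV" "distinct is"
    using finite_distinct_list[of "UNIV :: 'n set"] by auto
  thus ?thesis using factorial_in_polys_in[of "is"] polys_in_UNIV[of "is"] by metis
qed

text \<open>A prime \<open>p\<close> of \<open>W\<close> cannot divide all \<open>U i\<close>, so it
  divides \<open>B\<close> and can be cancelled on both sides. This is what makes the denominator of
  a reduced representation divide the denominator of any other one, also for several numerators at
  once.\<close>

lemma factorial_coprime_dvd:
  fixes W B :: "'a::idom"
  assumes "prime_product UNIV u ps W" "\<And>i. W dvd U i * B"
    and "\<And>d. (\<And>i. d dvd U i) \<Longrightarrow> d dvd W \<Longrightarrow> d dvd 1"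
  shows "W dvd B"
  using assms
proof (induction ps arbitrary: W B)
  case Nil
  then show ?case by (auto simp: prime_product_def)
next
  case (Cons p ps)
  define W' where "W' = u * prod_list ps"
  have W: "W = p * W'" and pp: "prime_product UNIV u ps W'" and p: "prime_elem p"
    using Cons.prems(1) by (auto simp: prime_product_def W'_def)
  obtain i where i: "\<not> p dvd U i" using Cons.prems(3)[of p] p W by (auto simp: prime_elem_def)
  have "p dvd U i * B" using Cons.prems(2)[of i] unfolding W by (rule dvd_mult_left)
  hence "p dvd B" using i p by (auto simp: prime_elem_def)
  then obtain B' where B: "B = p * B'" by auto
  have p0: "p \<noteq> 0" using p by auto
  have "W' dvd U i * B'" for i
  proof -
    have "p * W' dvd p * (U i * B')" using Cons.prems(2)[of i] by (simp add: W B ac_simps)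
    thus ?thesis using p0 by simp
  qed
  moreover have "d dvd 1" if "\<And>i. d dvd U i" "d dvd W'" for d
    using Cons.prems(3)[of d] that by (simp add: W)
  ultimately have "W' dvd B'" by (rule Cons.IH[OF pp])
  thus ?case using W B by simp
qed

text \<open>As long as \<open>W\<close> and the coefficients of \<open>U\<close> have a common
  nonunit divisor, a prime of that divisor is cancelled, and the number of primes of
  \<open>W\<close> decreases. The numerators are the coefficients of one polynomial, so a constant
  polynomial covers ordinary fractions.\<close>

lemma factorial_reduce:
  fixes W :: "'a::idom" and U :: "'a poly"
  assumes fact: "factorial_in (UNIV :: 'a set)" and W: "W \<noteq> 0"
  shows "\<exists>d U' W'. W = d * W' \<and> U = smult d U' \<and> W' \<noteq> 0 \<and>
    (\<forall>e. (\<forall>i. e dvd coeff U' i) \<and> e dvd W' \<longrightarrow> e dvd 1)"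
proof -
  obtain u ps where "prime_product UNIV u ps W" using fact W by (auto simp: factorial_in_def)
  thus ?thesis
  proof (induction "length ps" arbitrary: u ps W U rule: less_induct)
    case (less ps)
    have W0: "W \<noteq> 0" using prime_product_nonzero[OF less.prems] .
    show ?case
    proof (cases "\<forall>e. (\<forall>i. e dvd coeff U i) \<and> e dvd W \<longrightarrow> e dvd 1")
      case True
      thus ?thesis using W0 by (intro exI[of _ 1] exI[of _ U] exI[of _ W]) auto
    next
      case False
      then obtain e where e: "\<And>i. e dvd coeff U i" "e dvd W" "\<not> e dvd 1" by auto
      have "e \<noteq> 0" using e W0 by auto
      then obtain v qs where vq: "prime_product UNIV v qs e" using fact by (auto simp: factorial_in_def)
      have "qs \<noteq> []" using vq e by (auto simp: prime_product_def)
      then obtain p qs' where qs: "qs = p # qs'" by (cases qs) auto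
      have p: "prime_in UNIV p" "p dvd e" using vq by (auto simp: prime_product_def qs)
      obtain W1 where W1: "W = p * W1" using p e by (meson dvd_def dvd_trans)
      have "[:p:] dvd U" using p e dvd_trans by (auto simp: const_poly_dvd_iff)
      then obtain U1 where U1: "U = smult p U1" by auto
      obtain v' rs where "prime_product UNIV v' rs W1" "length ps = Suc (length rs)"
        using prime_product_cancel[OF subring_set_UNIV _ p(1)] less.prems W1 by blast
      from less.hyps[OF _ this(1), of U1] this(2) obtain d U' W' where
        "W1 = d * W'" "U1 = smult d U'" "W' \<noteq> 0" "\<forall>e. (\<forall>i. e dvd coeff U' i) \<and> e dvd W' \<longrightarrow> e dvd 1"
        by auto
      thus ?thesis using W1 U1 by (intro exI[of _ "p * d"] exI[of _ U'] exI[of _ W']) (auto simp: ac_simps)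
    qed
  qed
qed

text \<open>Cancelling common factors gives \<open>x = d * n\<close>, \<open>y = d * D\<close> with
  \<open>n\<close>, \<open>D\<close> coprime, and \<open>d * n * D\<close> is the multiple sought.
  If one of them is zero, zero is the only common multiple.\<close>

lemma factorial_lcm2:
  fixes x y :: "'a::idom"
  assumes fact: "factorial_in (UNIV :: 'a set)"
  shows "\<exists>m. x dvd m \<and> y dvd m \<and> (\<forall>m'. x dvd m' \<and> y dvd m' \<longrightarrow> m dvd m')"
proof (cases "x = 0 \<or> y = 0")
  case True
  thus ?thesis by (intro exI[of _ 0]) auto
next
  case False
  then obtain d N D where *: "y = d * D" "[:x:] = smult d N"
      "\<forall>e. (\<forall>i. e dvd coeff N i) \<and> e dvd D \<longrightarrow> e dvd 1" "D \<noteq> 0"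
    using factorial_reduce[OF fact, of y "[:x:]"] by blast
  define n where "n = coeff N 0"
  have d0: "d \<noteq> 0" using * False by auto
  have x: "x = d * n" using arg_cong[OF *(2), of "\<lambda>p. coeff p 0"] by (simp add: n_def)
  have "degree N = 0" using arg_cong[OF *(2), of degree] d0 by simp
  hence cop: "e dvd 1" if "e dvd n" "e dvd D" for e
    using *(3)[rule_format, of e] that by (auto simp: n_def coeff_pCons elim!: degree_eq_zeroE split: nat.splits)
  have "x * D dvd m'" if m': "x dvd m'" "y dvd m'" for m'
  proof -
    obtain a b where ab: "m' = x * a" "m' = y * b" using m' unfolding dvd_def by blast
    have "d * (n * a) = d * (D * b)" using ab x *(1) by (metis mult.assoc)
    hence "n * a = D * b" using d0 by simp
    hence "D dvd n * a" by simp
    moreover obtain u ps where "prime_product UNIV u ps D" using fact *(4) by (auto simp: factorial_in_def)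
    ultimately have "D dvd a" using factorial_coprime_dvd[of u ps D "\<lambda>_::unit. n" a] cop by auto
    thus ?thesis using ab by simp
  qed
  moreover have "y dvd x * D" using x *(1) by (metis dvd_triv_left mult.commute mult.left_commute)
  moreover have "x dvd x * D" by simp
  ultimately show ?thesis by blast
qed

text \<open>Guarantees that the choice in \<open>some_lcm\<close> picks a genuine least common
  multiple.\<close>

lemma factorial_lcm_exists:
  fixes S :: "'a::idom set"
  assumes fact: "factorial_in (UNIV :: 'a set)" and "finite S"
  shows "\<exists>m. (\<forall>x\<in>S. x dvd m) \<and> (\<forall>m'. (\<forall>x\<in>S. x dvd m') \<longrightarrow> m dvd m')"
  using assms(2)
proof (induction S rule: finite_induct)
  case (insert y S)
  then obtain m where m: "\<forall>x\<in>S. x dvd m" "\<forall>m'. (\<forall>x\<in>S. x dvd m') \<longrightarrow> m dvd m'" by blast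
  obtain l where l: "m dvd l" "y dvd l" "\<forall>m'. m dvd m' \<and> y dvd m' \<longrightarrow> l dvd m'"
    using factorial_lcm2[OF fact, of m y] by blast
  show ?case
  proof (intro exI[of _ l] conjI ballI allI impI)
    fix x assume "x \<in> insert y S"
    thus "x dvd l" using m(1) l(2) by (auto intro: dvd_trans[OF _ l(1)])
  next
    fix m' assume "\<forall>x\<in>insert y S. x dvd m'"
    thus "l dvd m'" using m(2) l(3) by simp
  qed
qed (auto intro: exI[of _ 1])

lemma dvd_some_lcm:
  fixes S :: "'a::idom set"
  assumes "factorial_in (UNIV :: 'a set)" "finite S" "x \<in> S"
  shows "x dvd some_lcm S"
  using someI_ex[OF factorial_lcm_exists[OF assms(1,2)]] assms(3) unfolding some_lcm_def by blast

section \<open>Homomorphisms on subrings\<close>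

lemma poly_altdef_le:
  assumes "degree p \<le> n"
  shows "poly p (x :: 'a::comm_semiring_1) = (\<Sum>i\<le>n. coeff p i * x ^ i)"
  unfolding poly_altdef using assms by (intro sum.mono_neutral_left) (auto intro: le_degree)

text \<open>Models evaluation at a point: a total function that is a homomorphism only where
  denominators do not vanish. Outside \<open>R\<close> nothing is assumed about it.\<close>

locale partial_hom =
  fixes R :: "'a::comm_ring_1 set" and \<sigma> :: "'a \<Rightarrow> 'b::comm_ring_1"
  assumes subring: "subring_set R"
    and hom_0: "\<sigma> 0 = 0" and hom_1: "\<sigma> 1 = 1"
    and hom_add: "x \<in> R \<Longrightarrow> y \<in> R \<Longrightarrow> \<sigma> (x + y) = \<sigma> x + \<sigma> y"
    and hom_mult: "x \<in> R \<Longrightarrow> y \<in> R \<Longrightarrow> \<sigma> (x * y) = \<sigma> x * \<sigma> y"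
begin

lemmas R = subring_setD[OF subring]

lemma hom_uminus: "x \<in> R \<Longrightarrow> \<sigma> (- x) = - \<sigma> x"
  using hom_add[of "- x" x] R by (simp add: hom_0 eq_neg_iff_add_eq_0)

lemma hom_diff: "x \<in> R \<Longrightarrow> y \<in> R \<Longrightarrow> \<sigma> (x - y) = \<sigma> x - \<sigma> y"
  using hom_add[of x "- y"] R by (simp add: hom_uminus)

lemma hom_sum: "(\<And>x. x \<in> S \<Longrightarrow> f x \<in> R) \<Longrightarrow> \<sigma> (sum f S) = (\<Sum>x\<in>S. \<sigma> (f x))"
  by (induction S rule: infinite_finite_induct)
    (auto simp: hom_0 hom_add subring_set_sum[OF subring])

lemma hom_prod: "(\<And>x. x \<in> S \<Longrightarrow> f x \<in> R) \<Longrightarrow> \<sigma> (prod f S) = (\<Prod>x\<in>S. \<sigma> (f x))"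
  by (induction S rule: infinite_finite_induct)
    (auto simp: hom_1 hom_mult subring_set_prod[OF subring])

lemma hom_power: "x \<in> R \<Longrightarrow> \<sigma> (x ^ n) = \<sigma> x ^ n"
  by (induction n) (auto simp: hom_1 hom_mult subring_set_power[OF subring])

lemma hom_of_int: "\<sigma> (of_int n) = of_int n" and of_int_closed: "of_int n \<in> R"
proof -
  have "of_nat m \<in> R \<and> \<sigma> (of_nat m) = of_nat m" for m
    by (induction m) (auto simp: hom_0 hom_1 hom_add R)
  hence "of_int n \<in> R \<and> \<sigma> (of_int n) = of_int n"
    by (cases n rule: int_cases2) (auto simp: hom_uminus R)
  thus "\<sigma> (of_int n) = of_int n" "of_int n \<in> R" by auto
qed

lemma coeff_hom [simp]: "coeff (map_poly \<sigma> f) i = \<sigma> (coeff f i)"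
  by (simp add: coeff_map_poly hom_0)

lemma partial_hom_map_poly: "partial_hom (polys_over R) (map_poly \<sigma>)"
proof
  show "subring_set (polys_over R)" by (rule subring_polys_over[OF subring])
  show "map_poly \<sigma> 0 = 0" "map_poly \<sigma> 1 = 1" by (auto simp: hom_0 hom_1)
  fix f g assume fg: "f \<in> polys_over R" "g \<in> polys_over R"
  hence c: "coeff f i \<in> R" "coeff g i \<in> R" for i by (auto simp: polys_over_def)
  show "map_poly \<sigma> (f + g) = map_poly \<sigma> f + map_poly \<sigma> g"
    by (rule poly_eqI) (simp add: hom_add c)
  show "map_poly \<sigma> (f * g) = map_poly \<sigma> f * map_poly \<sigma> g"
    by (rule poly_eqI) (simp add: coeff_mult hom_sum hom_mult c R)
qed

lemma map_poly_smult: "c \<in> R \<Longrightarrow> f \<in> polys_over R \<Longrightarrow> map_poly \<sigma> (smult c f) = smult (\<sigma> c) (map_poly \<sigma> f)"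
  by (rule poly_eqI) (simp add: hom_mult coeff_polys_over)

lemma degree_map_poly_eq: "\<sigma> (lead_coeff f) \<noteq> 0 \<Longrightarrow> degree (map_poly \<sigma> f) = degree f"
  by (metis degree_map_poly hom_0 leading_coeff_0_iff)

lemma hom_det:
  assumes A: "A \<in> carrier_mat n n" and el: "\<And>i j. i < n \<Longrightarrow> j < n \<Longrightarrow> A $$ (i, j) \<in> R"
  shows "det A \<in> R" "\<sigma> (det A) = det (map_mat \<sigma> A)"
proof -
  have p: "i < n \<Longrightarrow> p permutes {0..<n} \<Longrightarrow> p i < n" for p i
    using permutes_in_image[of p "{0..<n}" i] by auto
  have in1: "(\<Prod>i = 0..<n. A $$ (i, p i)) \<in> R" if "p permutes {0..<n}" for p
    using that p by (auto intro!: subring_set_prod[OF subring] el)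
  have in2: "of_int (sign p) * (\<Prod>i = 0..<n. A $$ (i, p i)) \<in> R" if "p permutes {0..<n}" for p
    by (intro R of_int_closed in1 that)
  show "det A \<in> R" unfolding det_def'[OF A] by (intro subring_set_sum[OF subring] in2) auto
  have "\<sigma> (det A) = (\<Sum>p | p permutes {0..<n}. \<sigma> (of_int (sign p) * (\<Prod>i = 0..<n. A $$ (i, p i))))"
    unfolding det_def'[OF A] by (intro hom_sum in2) auto
  also have "\<dots> = (\<Sum>p | p permutes {0..<n}. of_int (sign p) * (\<Prod>i = 0..<n. map_mat \<sigma> A $$ (i, p i)))"
  proof (intro sum.cong refl)
    fix p assume "p \<in> {p. p permutes {0..<n}}"
    hence pp: "p permutes {0..<n}" by simp
    have "\<sigma> (of_int (sign p) * (\<Prod>i = 0..<n. A $$ (i, p i))) =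
        of_int (sign p) * (\<Prod>i = 0..<n. \<sigma> (A $$ (i, p i)))"
    proof -
      have "\<sigma> (\<Prod>i = 0..<n. A $$ (i, p i)) = (\<Prod>i = 0..<n. \<sigma> (A $$ (i, p i)))"
        by (rule hom_prod) (auto intro: el p[OF _ pp])
      thus ?thesis by (simp only: hom_mult[OF of_int_closed in1[OF pp]] hom_of_int)
    qed
    also have "(\<Prod>i = 0..<n. \<sigma> (A $$ (i, p i))) = (\<Prod>i = 0..<n. map_mat \<sigma> A $$ (i, p i))"
      using A p[OF _ pp] by (intro prod.cong) auto
    finally show "\<sigma> (of_int (sign p) * (\<Prod>i = 0..<n. A $$ (i, p i))) =
        of_int (sign p) * (\<Prod>i = 0..<n. map_mat \<sigma> A $$ (i, p i))" .
  qed
  also have "\<dots> = det (map_mat \<sigma> A)" using A by (subst det_def'[of _ n]) auto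
  finally show "\<sigma> (det A) = det (map_mat \<sigma> A)" .
qed

text \<open>The size of the Sylvester matrix depends on the degrees; if no leading coefficient is
  lost, the matrix is mapped entry by entry, and so is its determinant.\<close>

lemma hom_resultant:
  assumes f: "f \<in> polys_over R" "degree (map_poly \<sigma> f) = degree f"
    and g: "g \<in> polys_over R" "degree (map_poly \<sigma> g) = degree g"
  shows "resultant f g \<in> R" "\<sigma> (resultant f g) = resultant (map_poly \<sigma> f) (map_poly \<sigma> g)"
proof -
  let ?n = "degree f + degree g"
  have S: "sylvester_mat f g \<in> carrier_mat ?n ?n" by (rule sylvester_carrier_mat)
  have el: "sylvester_mat f g $$ (i, j) \<in> R" if "i < ?n" "j < ?n" for i j
    using that f g by (subst sylvester_index_mat) (auto simp: polys_over_def R)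
  have "map_mat \<sigma> (sylvester_mat f g) = sylvester_mat (map_poly \<sigma> f) (map_poly \<sigma> g)"
    unfolding sylvester_mat_def f(2) g(2) by (rule sylvester_mat_sub_map) (rule hom_0)
  thus "resultant f g \<in> R" "\<sigma> (resultant f g) = resultant (map_poly \<sigma> f) (map_poly \<sigma> g)"
    unfolding resultant_def using hom_det[OF S el] by simp_all
qed

end

text \<open>A common root \<open>x\<close> puts the vector of the powers of \<open>x\<close>,
  highest first, into the kernel of the Sylvester matrix: each row evaluates \<open>f\<close> or
  \<open>g\<close> times a power of the variable.\<close>

lemma resultant_common_root:
  fixes f g :: "'a::field poly"
  assumes x: "poly f x = 0" "poly g x = 0" and f0: "f \<noteq> 0"
  shows "resultant f g = 0"
proof -
  define m where "m = degree f"
  define n where "n = degree g"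
  \<comment> \<open>Ensures that the vector \<open>v\<close> has an entry at index
    \<open>m + n - 1\<close>; it is \<open>x ^ 0 = 1\<close> and shows that \<open>v\<close> is not
    zero.\<close>
  have m: "m > 0" unfolding m_def using x(1) f0 by (auto intro!: gr0I elim!: degree_eq_zeroE)
  define S where "S = sylvester_mat f g"
  define v where "v = vec (m + n) (\<lambda>j. x ^ (m + n - 1 - j))"
  have S: "S \<in> carrier_mat (m + n) (m + n)" unfolding S_def m_def n_def by (rule sylvester_carrier_mat)
  have "S *\<^sub>v v = 0\<^sub>v (m + n)"
  proof (rule eq_vecI)
    fix i assume i': "i < dim_vec (0\<^sub>v (m + n) :: 'a vec)"
    hence i: "i < m + n" by simp
    have *: "(S *\<^sub>v v) $ i = (\<Sum>j = 0..<m+n. S $$ (i, j) * x ^ (m + n - 1 - j))"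
      using S i by (auto simp: v_def scalar_prod_def)
    show "(S *\<^sub>v v) $ i = 0\<^sub>v (m + n) $ i"
    proof (cases "i < n")
      case True
      have "(\<Sum>j = 0..<m+n. S $$ (i, j) * x ^ (m + n - 1 - j)) =
          (\<Sum>j\<in>{i..i+m}. coeff f (m + i - j) * x ^ (m + n - 1 - j))"
        using True i unfolding S_def m_def n_def
        by (intro sum.mono_neutral_cong_right) (auto simp: sylvester_index_mat)
      also have "\<dots> = (\<Sum>k\<le>m. coeff f k * x ^ (n - 1 - i + k))"
        using True by (intro sum.reindex_bij_witness[of _ "\<lambda>k. m + i - k" "\<lambda>j. m + i - j"])
          (auto intro!: arg_cong[of _ _ "\<lambda>k. x ^ k"])
      also have "\<dots> = x ^ (n - 1 - i) * poly f x"
        by (simp add: poly_altdef m_def sum_distrib_left power_add ac_simps)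
      finally show ?thesis using * x i by simp
    next
      case False
      have "(\<Sum>j = 0..<m+n. S $$ (i, j) * x ^ (m + n - 1 - j)) =
          (\<Sum>j\<in>{i-n..i}. coeff g (i - j) * x ^ (m + n - 1 - j))"
        using False i unfolding S_def m_def n_def
        by (intro sum.mono_neutral_cong_right) (auto simp: sylvester_index_mat)
      also have "\<dots> = (\<Sum>k\<le>n. coeff g k * x ^ (m + n - 1 - i + k))"
        using False i by (intro sum.reindex_bij_witness[of _ "\<lambda>k. i - k" "\<lambda>j. i - j"])
          (auto intro!: arg_cong[of _ _ "\<lambda>k. x ^ k"])
      also have "\<dots> = x ^ (m + n - 1 - i) * poly g x"
        by (simp add: poly_altdef n_def sum_distrib_left power_add ac_simps)
      finally show ?thesis using * x i by simp
    qed
  qed (use S in auto)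
  moreover have "v \<in> carrier_vec (m + n)" by (simp add: v_def)
  moreover have "v $ (m + n - 1) = 1" using m by (simp add: v_def)
  hence "v \<noteq> 0\<^sub>v (m + n)" using m by auto
  ultimately have "det S = 0" using det_0_iff_vec_prod_zero_field[OF S] by blast
  thus ?thesis by (simp add: S_def resultant_def)
qed

lemma to_ac_hom: "field_hom to_ac"
  by unfold_locales auto

interpretation to_ac: field_hom "to_ac :: 'a::field \<Rightarrow> 'a alg_closure"
  by (rule to_ac_hom)

interpretation to_ac_poly: map_poly_inj_idom_hom "to_ac :: 'a::field \<Rightarrow> 'a alg_closure" ..

text \<open>A nonconstant common divisor is sure to have a root only in the algebraic closure, so
  the resultant is carried there first.\<close>

lemma resultant_nonzero_coprime:
  fixes f g d :: "'a::field poly"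
  assumes res: "resultant f g \<noteq> 0" and f0: "f \<noteq> 0" and d: "d dvd f" "d dvd g"
  shows "degree d = 0"
proof (rule ccontr)
  assume "degree d \<noteq> 0"
  hence "degree (map_poly to_ac d) > 0" by simp
  then obtain x where x: "poly (map_poly to_ac d) x = 0"
    using alg_closed_imp_poly_has_root by blast
  have "map_poly to_ac d dvd map_poly to_ac f" "map_poly to_ac d dvd map_poly to_ac g"
    using d by (auto intro: to_ac_poly.hom_dvd)
  hence "poly (map_poly to_ac f) x = 0" "poly (map_poly to_ac g) x = 0"
    using x by (auto elim!: dvdE)
  hence "resultant (map_poly to_ac f) (map_poly to_ac g) = 0"
    using f0 by (intro resultant_common_root[of _ x]) auto
  thus False using res by (simp add: to_ac.resultant_hom)
qed

section \<open>Specialization of norms\<close>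

lemma monic_division_over:
  fixes f d :: "'a::idom poly"
  assumes "subring_set A" "d \<in> polys_over A" "lead_coeff d = 1" "f \<in> polys_over A" "degree d > 0"
  shows "\<exists>q\<in>polys_over A. \<exists>r\<in>polys_over A. f = q * d + r \<and> degree r < degree d"
proof -
  have "d \<noteq> 0" using assms(3) by auto
  from pseudo_division_over[OF assms(1,2) this assms(4)] obtain n q r where
    "q \<in> polys_over A" "r \<in> polys_over A" "smult (lead_coeff d ^ n) f = q * d + r"
    "r = 0 \<or> degree r < degree d" by blast
  thus ?thesis using assms(3,5) by (intro bexI[of _ q] bexI[of _ r]) auto
qed

lemma card_roots_separable:
  fixes p :: "'a::alg_closed_field poly"
  assumes p0: "p \<noteq> 0" and sep: "\<And>x. poly p x = 0 \<Longrightarrow> poly (pderiv p) x \<noteq> 0"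
  shows "card {x. poly p x = 0} = degree p"
proof -
  obtain A where A: "size A = degree p" "p = smult (lead_coeff p) (\<Prod>x\<in>#A. [:-x, 1:])"
    using alg_closed_imp_factorization[OF p0] by blast
  have "set_mset A = {x. poly p x = 0}"
    using p0 by (subst A(2)) (auto simp: poly_prod_mset prod_mset_zero_iff)
  moreover have "count A x = 1" if "x \<in># A" for x
  proof (rule ccontr)
    assume "count A x \<noteq> 1"
    obtain B where B: "A = add_mset x B" using multi_member_split[OF \<open>x \<in># A\<close>] by blast
    hence "count B x \<noteq> 0" using \<open>count A x \<noteq> 1\<close> by simp
    hence "x \<in># B" by (simp add: count_eq_zero_iff)
    then obtain C where "B = add_mset x C" using multi_member_split[OF \<open>x \<in># B\<close>] by blast
    hence C: "A = add_mset x (add_mset x C)" using B by simp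
    define q where "q = smult (lead_coeff p) (\<Prod>x\<in>#C. [:-x, 1:])"
    define l where "l = [:-x, 1:]"
    have "p = l * (l * q)" unfolding l_def by (subst A(2)) (simp add: C q_def)
    moreover have "poly l x = 0" by (simp add: l_def)
    ultimately have "poly p x = 0" "poly (pderiv p) x = 0" by (simp_all add: pderiv_mult)
    thus False using sep by blast
  qed
  ultimately have "size A = card {x. poly p x = 0}"
    unfolding size_multiset_overloaded_eq by simp
  thus ?thesis using A by simp
qed

text \<open>A kernel vector of the transpose is the coefficient vector of a nonzero polynomial of
  degree below \<open>k\<close> with \<open>k\<close> distinct roots.\<close>

lemma vandermonde_nonzero:
  fixes xs :: "'a::field list"
  assumes "distinct xs" "length xs = k"
  shows "det (mat k k (\<lambda>(i, j). (xs ! j) ^ i)) \<noteq> 0"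
proof
  define V where "V = mat k k (\<lambda>(i, j). (xs ! j) ^ i)"
  assume "det (mat k k (\<lambda>(i, j). (xs ! j) ^ i)) = 0"
  hence "det (transpose_mat V) = 0" by (simp add: V_def det_transpose[of _ k])
  moreover have "transpose_mat V \<in> carrier_mat k k" by (simp add: V_def)
  ultimately obtain w where w: "w \<in> carrier_vec k" "w \<noteq> 0\<^sub>v k" "transpose_mat V *\<^sub>v w = 0\<^sub>v k"
    using det_0_iff_vec_prod_zero_field by blast
  define p where "p = (\<Sum>i<k. monom (w $ i) i)"
  have cp: "coeff p i = (if i < k then w $ i else 0)" for i
    by (auto simp: p_def coeff_sum)
  have "poly p (xs ! j) = 0" if "j < k" for j
  proof -
    have "(transpose_mat V *\<^sub>v w) $ j = (\<Sum>i = 0..<k. (xs ! j) ^ i * w $ i)"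
      using that w(1) by (auto simp: V_def scalar_prod_def)
    hence "(\<Sum>i = 0..<k. (xs ! j) ^ i * w $ i) = 0" using w(3) that by simp
    thus ?thesis by (simp add: p_def poly_sum poly_monom mult.commute atLeast0LessThan)
  qed
  hence sub: "set xs \<subseteq> {x. poly p x = 0}" using assms by (auto simp: set_conv_nth)
  obtain i where "i < k" "w $ i \<noteq> 0" using w(1,2) by (metis carrier_vecD eq_vecI index_zero_vec)
  hence p0: "p \<noteq> 0" using cp[of i] by auto
  have "k = card (set xs)" using assms by (simp add: distinct_card)
  also have "\<dots> \<le> card {x. poly p x = 0}"
    by (rule card_mono[OF _ sub]) (rule poly_roots_finite[OF p0])
  also have "\<dots> \<le> degree p" by (rule poly_roots_degree[OF p0])
  also have "degree p < k" using cp \<open>i < k\<close> p0 by (metis leading_coeff_0_iff)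
  finally show False by simp
qed

text \<open>
  The norm of \<open>r\<close> is the determinant of multiplication by \<open>r\<close> modulo \<open>m\<close>.  The vectors
  \<open>(1, x, x\<^sup>2, \<dots>)\<close>, \<open>x\<close> a root of \<open>m\<close>, are eigenvectors; after specialization the vector of
  the root \<open>c\<close> lies in the kernel.
\<close>

lemma norm_specialization:
  fixes R :: "'a::field set" and \<sigma> :: "'a \<Rightarrow> 'b::field"
  assumes hom: "partial_hom R \<sigma>"
    and m: "m \<in> polys_over R" "lead_coeff m = 1" "degree m > 0"
    and sep: "card {x. poly (map_poly to_ac m) x = 0} = degree m"
    and r: "r \<in> polys_over R"
    and c: "poly (map_poly \<sigma> m) c = 0" "poly (map_poly \<sigma> r) c = 0"
  shows "\<exists>n\<in>R. \<sigma> n = 0 \<and> to_ac n = (\<Prod>x | poly (map_poly to_ac m) x = 0. poly (map_poly to_ac r) x)"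
proof -
  interpret \<sigma>: partial_hom R \<sigma> by fact
  interpret \<sigma>p: partial_hom "polys_over R" "map_poly \<sigma>" by (rule \<sigma>.partial_hom_map_poly)
  define k where "k = degree m"
  define roots where "roots = {x. poly (map_poly to_ac m) x = 0}"
  have k0: "k > 0" using m(3) by (simp add: k_def)
  \<comment> \<open>Row \<open>i\<close> of the matrix will hold the remainder \<open>s i\<close> of
    \<open>monom 1 i * r\<close> modulo \<open>m\<close>; since \<open>m\<close> is monic, the
    entries stay in \<open>R\<close>.\<close>
  have ex: "\<exists>q s. q \<in> polys_over R \<and> s \<in> polys_over R \<and> monom 1 i * r = q * m + s \<and> degree s < k" for i
    using monic_division_over[OF \<sigma>.subring m(1,2) _ m(3), of "monom 1 i * r"] r
      \<sigma>p.R(4)[OF monom_polys_over[OF \<sigma>.R(1,2)] r] by (auto simp: k_def)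
  then obtain q s where qs: "\<And>i. q i \<in> polys_over R" "\<And>i. s i \<in> polys_over R"
    "\<And>i. monom 1 i * r = q i * m + s i" "\<And>i. degree (s i) < k" by metis
  define M where "M = mat k k (\<lambda>(i, j). coeff (s i) j)"
  have M: "M \<in> carrier_mat k k" by (simp add: M_def)
  have el: "M $$ (i, j) \<in> R" if "i < k" "j < k" for i j
    using that qs(2) by (auto simp: M_def polys_over_def)
  have row: "(\<Sum>j<k. coeff (s i) j * x ^ j) = poly (s i) x" for i x
  proof -
    have "poly (s i) x = (\<Sum>j\<le>k - 1. coeff (s i) j * x ^ j)"
      using qs(4)[of i] by (intro poly_altdef_le) auto
    moreover have "{..k - 1} = {..<k}" using k0 by auto
    ultimately show ?thesis by simp
  qed
  have "\<sigma> (det M) = 0"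
  proof -
    have A: "map_mat \<sigma> M \<in> carrier_mat k k" using M by simp
    \<comment> \<open>Row \<open>i\<close> applied to the powers of \<open>c\<close> gives the
      specialized remainder at \<open>c\<close>, which is \<open>c ^ i\<close> times the value of
      \<open>r\<close> minus a multiple of the value of \<open>m\<close>; both values are
      zero.\<close>
    define v where "v = vec k (\<lambda>j. c ^ j)"
    have "map_mat \<sigma> M *\<^sub>v v = 0\<^sub>v k"
    proof (rule eq_vecI)
      fix i assume "i < dim_vec (0\<^sub>v k :: 'b vec)"
      hence i: "i < k" by simp
      have "(map_mat \<sigma> M *\<^sub>v v) $ i = (\<Sum>j<k. \<sigma> (coeff (s i) j) * c ^ j)"
        using i by (auto simp: M_def v_def scalar_prod_def atLeast0LessThan)
      also have "\<dots> = (\<Sum>j\<le>k - 1. coeff (map_poly \<sigma> (s i)) j * c ^ j)"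
        using k0 by (intro sum.cong) auto
      also have "\<dots> = poly (map_poly \<sigma> (s i)) c"
        using qs(4)[of i] degree_map_poly_le[of \<sigma> "s i"]
        by (intro poly_altdef_le[symmetric]) linarith
      also have "\<dots> = 0"
      proof -
        have "map_poly \<sigma> (monom 1 i) * map_poly \<sigma> r = map_poly \<sigma> (q i) * map_poly \<sigma> m + map_poly \<sigma> (s i)"
          using arg_cong[OF qs(3)[of i], of "map_poly \<sigma>"] qs(1,2) m(1) r
            monom_polys_over[OF \<sigma>.R(1,2)]
          by (simp add: \<sigma>p.hom_add \<sigma>p.hom_mult \<sigma>p.R)
        from arg_cong[OF this, of "\<lambda>p. poly p c"] c show ?thesis by simp
      qed
      finally show "(map_mat \<sigma> M *\<^sub>v v) $ i = 0\<^sub>v k $ i" using i by simp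
    qed (use M in auto)
    moreover have "v \<in> carrier_vec k" by (simp add: v_def)
    moreover have "v $ 0 = 1" using k0 by (simp add: v_def)
    hence "v \<noteq> 0\<^sub>v k" using k0 by auto
    ultimately have "det (map_mat \<sigma> M) = 0" using det_0_iff_vec_prod_zero_field[OF A] by blast
    thus ?thesis using \<sigma>.hom_det(2)[OF M el] by simp
  qed
  moreover have "to_ac (det M) = (\<Prod>x\<in>roots. poly (map_poly to_ac r) x)"
  proof -
    have "m \<noteq> 0" using m by auto
    hence "finite roots" unfolding roots_def by (intro poly_roots_finite) simp
    then obtain xs where xs: "set xs = roots" "distinct xs" using finite_distinct_list by blast
    have len: "length xs = k" using xs sep distinct_card[of xs] by (simp add: roots_def k_def)
    \<comment> \<open>The columns of \<open>V\<close> are the eigenvectors of the roots and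
      \<open>D\<close> holds the eigenvalues, the values of \<open>r\<close>; cancelling the
      Vandermonde determinant leaves the product of the eigenvalues.\<close>
    define V where "V = mat k k (\<lambda>(i, j). (xs ! j) ^ i)"
    define N where "N = map_mat to_ac M"
    define d where "d = (\<lambda>j. poly (map_poly to_ac r) (xs ! j))"
    define D where "D = mat k k (\<lambda>(i, j). if i = j then d i else 0)"
    have carr: "V \<in> carrier_mat k k" "N \<in> carrier_mat k k" "D \<in> carrier_mat k k"
      using M by (auto simp: V_def N_def D_def)
    have "N * V = V * D"
    proof (rule eq_matI)
      fix i j assume "i < dim_row (V * D)" "j < dim_col (V * D)"
      hence ij: "i < k" "j < k" using carr by auto
      have "poly (map_poly to_ac m) (xs ! j) = 0" using xs len ij nth_mem[of j xs] by (auto simp: roots_def)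
      moreover have "map_poly to_ac (monom 1 i) * map_poly to_ac r =
          map_poly to_ac (q i) * map_poly to_ac m + map_poly to_ac (s i)"
        using arg_cong[OF qs(3)[of i], of "map_poly to_ac"]
        by (simp only: to_ac_poly.hom_add to_ac_poly.hom_mult)
      from arg_cong[OF this, of "\<lambda>p. poly p (xs ! j)"]
      have "(xs ! j) ^ i * d j = poly (map_poly to_ac (q i)) (xs ! j) * poly (map_poly to_ac m) (xs ! j)
          + poly (map_poly to_ac (s i)) (xs ! j)"
        by (simp add: d_def poly_monom)
      ultimately have "(xs ! j) ^ i * d j = poly (map_poly to_ac (s i)) (xs ! j)" by simp
      also have "\<dots> = (\<Sum>l\<le>k - 1. to_ac (coeff (s i) l) * (xs ! j) ^ l)"
        using qs(4)[of i] by (subst poly_altdef_le[of _ "k - 1"]) auto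
      also have "\<dots> = (\<Sum>l<k. to_ac (coeff (s i) l) * (xs ! j) ^ l)"
        using k0 by (intro sum.cong) auto
      also have "\<dots> = (N * V) $$ (i, j)"
        using ij carr by (auto simp: N_def V_def M_def scalar_prod_def atLeast0LessThan)
      finally have 1: "(N * V) $$ (i, j) = (xs ! j) ^ i * d j" by simp
      have "(V * D) $$ (i, j) = (\<Sum>l = 0..<k. (xs ! l) ^ i * (if l = j then d l else 0))"
        using ij carr by (auto simp: V_def D_def scalar_prod_def)
      also have "\<dots> = (\<Sum>l = 0..<k. if l = j then (xs ! l) ^ i * d l else 0)"
        by (intro sum.cong) auto
      also have "\<dots> = (xs ! j) ^ i * d j" using ij by (simp add: sum.delta)
      finally show "(N * V) $$ (i, j) = (V * D) $$ (i, j)" using 1 by simp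
    qed (use carr in auto)
    hence "det N * det V = det V * det D" using carr by (metis det_mult)
    moreover have "det V \<noteq> 0" unfolding V_def by (rule vandermonde_nonzero[OF xs(2) len])
    ultimately have "det N = det D" by simp
    also have "det D = prod_list (diag_mat D)"
      by (rule det_upper_triangular[of _ k]) (auto simp: D_def)
    also have "\<dots> = (\<Prod>i = 0..<k. d i)"
      unfolding prod_list_diag_prod by (rule prod.cong) (auto simp: D_def)
    also have "\<dots> = (\<Prod>x\<in>roots. poly (map_poly to_ac r) x)"
      unfolding d_def using bij_betw_nth[OF xs(2), of "{0..<k}" roots] xs(1) len
      by (intro prod.reindex_bij_betw) (auto simp: atLeast0LessThan)
    also have "det N = to_ac (det M)" unfolding N_def by (simp add: to_ac.hom_det)
    finally show ?thesis .
  qed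
  ultimately show ?thesis using \<sigma>.hom_det(1)[OF M el] unfolding roots_def by blast
qed

section \<open>Specialization of rational functions\<close>

lemma peval_eq_poly_eval: "peval a = poly_eval to_ac a"
  by (rule ext) (simp add: peval_def poly_eval_def)

lemma peval_hom: "comm_ring_hom (peval a)"
  unfolding peval_eq_poly_eval by (rule poly_eval_hom) auto

text \<open>Brings all coefficients to one denominator. The multiplicative set \<open>M\<close> will
  be all nonzero denominators or those not vanishing at the point, so that clearing denominators
  does not leave the localization.\<close>

lemma map_poly_Fract_exists:
  fixes h :: "'a::idom fract poly"
  assumes M: "1 \<in> M" "0 \<notin> M" "\<And>x y. x \<in> M \<Longrightarrow> y \<in> M \<Longrightarrow> x * y \<in> M"
    and h: "h \<in> polys_over {c. \<exists>N D. D \<in> M \<and> c = Fract N D}"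
  shows "\<exists>U. \<exists>W\<in>M. h = map_poly (\<lambda>u. Fract u W) U \<and> degree U = degree h"
proof -
  have 0: "(0 :: 'a fract) = Fract 0 W" for W by (simp add: fract_collapse)
  have "\<exists>U. \<exists>W\<in>M. h = map_poly (\<lambda>u. Fract u W) U" using h
  proof (induction h)
    case 0
    show ?case using M(1) by (intro exI[of _ 0] bexI[of _ 1]) auto
  next
    case (pCons c h)
    have "h \<in> polys_over {c. \<exists>N D. D \<in> M \<and> c = Fract N D}"
      using pCons.prems by (auto simp: polys_over_def) (metis coeff_pCons_Suc)
    then obtain U W where UW: "W \<in> M" "h = map_poly (\<lambda>u. Fract u W) U" using pCons.IH by blast
    have "coeff (pCons c h) 0 \<in> {c. \<exists>N D. D \<in> M \<and> c = Fract N D}"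
      using pCons.prems unfolding polys_over_def by blast
    then obtain N D where ND: "D \<in> M" "c = Fract N D" by auto
    have nz: "W \<noteq> 0" "D \<noteq> 0" using UW ND M(2) by auto
    have "pCons c h = map_poly (\<lambda>u. Fract u (D * W)) (pCons (N * W) (smult D U))"
    proof (rule poly_eqI)
      fix i
      show "coeff (pCons c h) i = coeff (map_poly (\<lambda>u. Fract u (D * W)) (pCons (N * W) (smult D U))) i"
        using nz by (cases i) (auto simp: UW ND coeff_map_poly 0[symmetric] coeff_pCons eq_fract split: nat.splits)
    qed
    thus ?case using M(3)[OF ND(1) UW(1)] by blast
  qed
  then obtain U W where UW: "W \<in> M" "h = map_poly (\<lambda>u. Fract u W) U" by blast
  have W0: "W \<noteq> 0" using UW M(2) by auto
  have "Fract u W = 0 \<longleftrightarrow> u = 0" for u using W0 by (simp add: Zero_fract_def eq_fract)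
  hence "coeff h i = 0 \<longleftrightarrow> coeff U i = 0" for i
    unfolding UW by (subst coeff_map_poly) auto
  hence "degree U = degree h" unfolding degree_def by simp
  thus ?thesis using UW by blast
qed

locale fract_specialization =
  fixes a0 :: "'n::{finite,linorder} \<Rightarrow> 'k::field alg_closure"
begin

abbreviation "ev \<equiv> peval a0"

sublocale ev: comm_ring_hom ev by (rule peval_hom)

text \<open>The localization of K[a] at the point \<open>a0\<close>; evaluation at this point
  extends to it.\<close>

definition "regL = {c :: ('n, 'k) ppoly fract. \<exists>N D. ev D \<noteq> 0 \<and> c = Fract N D}"

definition "val c = ev (numerL c) / ev (denomL c)"

lemma regL_altdef: "regL = {c. \<exists>N D. D \<in> {D. ev D \<noteq> 0} \<and> c = Fract N D}"
  by (simp add: regL_def)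

lemma canonL:
  fixes c :: "('n, 'k) ppoly fract"
  shows "denomL c \<noteq> 0" "c = Fract (numerL c) (denomL c)"
    "e dvd numerL c \<Longrightarrow> e dvd denomL c \<Longrightarrow> e dvd 1"
proof -
  let ?P = "\<lambda>(N, D). D \<noteq> 0 \<and> c = Fract N D \<and> (\<forall>d. d dvd N \<and> d dvd D \<longrightarrow> d dvd 1)"
  obtain N D where ND: "c = Fract N D" "D \<noteq> 0" by (cases c) auto
  obtain d U' W' where *: "D = d * W'" "[:N:] = smult d U'" "W' \<noteq> 0"
    "\<forall>e. (\<forall>i. e dvd coeff U' i) \<and> e dvd W' \<longrightarrow> e dvd 1"
    using factorial_reduce[OF factorial_in_ppoly ND(2), of "[:N:]"] by metis
  have d0: "d \<noteq> 0" using * ND by auto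
  have N: "N = d * coeff U' 0" using arg_cong[OF *(2), of "\<lambda>p. coeff p 0"] by simp
  have "coeff U' i = 0" if "i \<noteq> 0" for i
    using arg_cong[OF *(2), of "\<lambda>p. coeff p i"] d0 that by (auto simp: coeff_pCons split: nat.splits)
  hence "e dvd coeff U' i" if "e dvd coeff U' 0" for e i using that by (cases "i = 0") auto
  hence cop: "\<forall>e. e dvd coeff U' 0 \<and> e dvd W' \<longrightarrow> e dvd 1" using *(4) by blast
  have "c = Fract (coeff U' 0) W'" using ND N * d0 by (simp add: eq_fract)
  hence "?P (coeff U' 0, W')" using cop *(3) by simp
  hence "?P (canonL c)" unfolding canonL_def by (rule someI)
  thus "denomL c \<noteq> 0" "c = Fract (numerL c) (denomL c)"
    "e dvd numerL c \<Longrightarrow> e dvd denomL c \<Longrightarrow> e dvd 1"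
    unfolding numerL_def denomL_def by (auto simp: case_prod_unfold)
qed

text \<open>The denominator of the canonical fraction divides \<open>D\<close>, so it cannot vanish
  at the point if \<open>D\<close> does not; the values agree by cross-multiplication.\<close>

lemma val_Fract:
  assumes "ev D \<noteq> 0"
  shows "ev (denomL (Fract N D)) \<noteq> 0" "val (Fract N D) = ev N / ev D"
proof -
  let ?n = "numerL (Fract N D)" and ?d = "denomL (Fract N D)"
  have D0: "D \<noteq> 0" using assms by auto
  have eq: "N * ?d = ?n * D" using canonL(2)[of "Fract N D"] canonL(1)[of "Fract N D"] D0
    by (metis eq_fract(1))
  obtain u ps where pp: "prime_product UNIV u ps ?d"
    using factorial_in_ppoly canonL(1)[of "Fract N D"] by (auto simp: factorial_in_def)
  have "?d dvd ?n * D" using eq by (metis dvd_triv_right)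
  hence "?d dvd D"
    using factorial_coprime_dvd[OF pp, of "\<lambda>_::unit. ?n" D] canonL(3)[of _ "Fract N D"] by blast
  thus 1: "ev ?d \<noteq> 0" using assms by (metis dvd_def ev.hom_mult mult_zero_left)
  show "val (Fract N D) = ev N / ev D" using arg_cong[OF eq, of ev] 1 assms
    unfolding val_def by (simp add: ev.hom_mult field_simps)
qed

lemma in_regL_iff: "c \<in> regL \<longleftrightarrow> ev (denomL c) \<noteq> 0"
proof
  assume "c \<in> regL"
  then obtain N D where "ev D \<noteq> 0" "c = Fract N D" by (auto simp: regL_def)
  thus "ev (denomL c) \<noteq> 0" using val_Fract by blast
next
  assume "ev (denomL c) \<noteq> 0"
  thus "c \<in> regL" unfolding regL_def using canonL(2)[of c] by blast
qed

lemma val_hom: "partial_hom regL val"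
proof
  show "subring_set regL" unfolding subring_set_def
  proof (intro conjI ballI)
    show "0 \<in> regL" "1 \<in> regL" unfolding regL_def by (auto simp: Zero_fract_def One_fract_def)
        (metis ev.hom_one zero_neq_one)+
    fix x y assume "x \<in> regL" "y \<in> regL"
    then obtain N D N' D' where *: "ev D \<noteq> 0" "x = Fract N D" "ev D' \<noteq> 0" "y = Fract N' D'"
      by (auto simp: regL_def)
    hence nz: "D \<noteq> 0" "D' \<noteq> 0" "ev (D * D') \<noteq> 0" by (auto simp: ev.hom_mult)
    show "x + y \<in> regL" "x * y \<in> regL" unfolding regL_def using * nz by (simp_all) blast+
    show "- x \<in> regL" unfolding regL_def using * by auto
  qed
  have "val (Fract 0 1) = 0" "val (Fract 1 1) = 1" by (subst val_Fract; simp)+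
  thus "val 0 = 0" "val 1 = 1" by (simp_all add: Zero_fract_def One_fract_def)
  fix x y assume "x \<in> regL" "y \<in> regL"
  then obtain N D N' D' where *: "ev D \<noteq> 0" "x = Fract N D" "ev D' \<noteq> 0" "y = Fract N' D'"
    by (auto simp: regL_def)
  hence nz: "D \<noteq> 0" "D' \<noteq> 0" "ev (D * D') \<noteq> 0" by (auto simp: ev.hom_mult)
  have v: "val x = ev N / ev D" "val y = ev N' / ev D'" using * val_Fract(2) by auto
  have "x + y = Fract (N * D' + N' * D) (D * D')" using * nz by simp
  hence "val (x + y) = ev (N * D' + N' * D) / ev (D * D')" using val_Fract(2)[OF nz(3)] by simp
  also have "\<dots> = ev N / ev D + ev N' / ev D'"
    unfolding ev.hom_mult ev.hom_add using *(1,3) by (simp add: add_frac_eq)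
  finally show "val (x + y) = val x + val y" unfolding v .
  have "x * y = Fract (N * N') (D * D')" using * by simp
  hence "val (x * y) = ev (N * N') / ev (D * D')" using val_Fract(2)[OF nz(3)] by simp
  thus "val (x * y) = val x * val y" unfolding v by (simp add: ev.hom_mult)
qed

sublocale val: partial_hom regL val by (rule val_hom)

end

section \<open>Minimal polynomials\<close>

locale simple_extension =
  fixes \<phi> :: "'l::field \<Rightarrow> 'f::field" and \<gamma> :: 'f
  assumes ext: "simple_algebraic_extension \<phi> \<gamma>"
begin

sublocale \<phi>: field_hom \<phi> using ext by (simp add: simple_algebraic_extension_def)

abbreviation "m \<equiv> min_poly \<phi> \<gamma>"
abbreviation "E h \<equiv> poly (map_poly \<phi> h) \<gamma>"

lemma E_hom: "comm_ring_hom (\<lambda>h. E h)"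
proof -
  interpret p: map_poly_idom_hom \<phi> ..
  show ?thesis by unfold_locales (auto simp: p.hom_add p.hom_mult)
qed

sublocale E: comm_ring_hom "\<lambda>h. E h" by (rule E_hom)

text \<open>A monic annihilator of least degree divides every annihilator of
  \<open>\<gamma>\<close>. Hence it is irreducible, and any other monic irreducible annihilator
  equals it, which makes the description in \<open>min_poly\<close> definite.\<close>

lemma min_poly: "lead_coeff m = 1" "Factorial_Ring.irreducible m" "E m = 0"
  and min_poly_dvd_iff: "E f = 0 \<longleftrightarrow> m dvd f"
  and min_poly_degree: "degree m > 0"
proof -
  let ?P = "\<lambda>p. lead_coeff p = 1 \<and> Factorial_Ring.irreducible p \<and> E p = 0"
  obtain p0 where "p0 \<noteq> 0" "E p0 = 0" using ext by (auto simp: simple_algebraic_extension_def)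
  then obtain p1 where p1: "p1 \<noteq> 0" "E p1 = 0" "\<And>q. q \<noteq> 0 \<Longrightarrow> E q = 0 \<Longrightarrow> degree p1 \<le> degree q"
    using ex_has_least_nat[of "\<lambda>p. p \<noteq> 0 \<and> E p = 0" p0 degree] by blast
  define p where "p = smult (inverse (lead_coeff p1)) p1"
  have p: "p \<noteq> 0" "lead_coeff p = 1" "degree p = degree p1" using p1 by (auto simp: p_def)
  have Ep: "E p = 0" unfolding p_def using p1 by (simp add: \<phi>.map_poly_hom_smult)
  have dvd: "p dvd f" if "E f = 0" for f
  proof -
    have "f = p * (f div p) + f mod p" by simp
    hence "E f = E p * E (f div p) + E (f mod p)" by (metis E.hom_add E.hom_mult)
    hence "E (f mod p) = 0" using that Ep by simp
    hence "f mod p = 0" using p1(3)[of "f mod p"] degree_mod_less[OF p(1), of f] p(3) by force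
    thus ?thesis by auto
  qed
  have deg: "degree p > 0"
  proof (rule ccontr)
    assume "\<not> degree p > 0"
    hence "p = 1" using p(2) by (auto elim!: degree_eq_zeroE simp: one_pCons)
    thus False using Ep by simp
  qed
  have unit: "a dvd 1" if "p = a * b" "E b = 0" for a b
  proof -
    have b0: "b \<noteq> 0" "a \<noteq> 0" using that p by auto
    hence "degree p \<le> degree b" using p1(3)[of b] that p by simp
    hence "degree a = 0" using that(1) b0 by (simp add: degree_mult_eq)
    thus ?thesis using b0 by (simp add: is_unit_iff_degree)
  qed
  have irr: "Factorial_Ring.irreducible p"
  proof (rule Factorial_Ring.irreducibleI)
    show "p \<noteq> 0" by fact
    show "\<not> p dvd 1" using deg p by (simp add: is_unit_iff_degree)
    fix a b assume ab: "p = a * b"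
    hence "E a * E b = 0" using Ep by (metis E.hom_mult)
    thus "a dvd 1 \<or> b dvd 1" using unit[of a b] unit[of b a] ab by (auto simp: mult.commute)
  qed
  have uniq: "q = p" if q: "?P q" for q
  proof -
    obtain r where r: "q = p * r" using dvd[of q] q by (auto elim!: dvdE)
    hence "r dvd 1" using q Factorial_Ring.irreducibleD[of q p r] deg p by (auto simp: is_unit_iff_degree)
    then obtain c where c: "r = [:c:]" unfolding is_unit_poly_iff by blast
    have "lead_coeff q = c" unfolding r c using p by (simp add: lead_coeff_mult)
    hence "c = 1" using q by auto
    thus ?thesis using r c by simp
  qed
  have Pp: "?P p" using p irr Ep by blast
  have mp: "m = p" unfolding min_poly_def
    by (rule the_equality[where P = ?P]) (fact Pp, fact uniq)
  show "lead_coeff m = 1" "Factorial_Ring.irreducible m" "E m = 0" "degree m > 0"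
    unfolding mp by (fact p irr Ep deg)+
  show "E f = 0 \<longleftrightarrow> m dvd f" unfolding mp
  proof
    assume "p dvd f"
    then obtain g where "f = p * g" by (auto elim!: dvdE)
    hence "E f = E p * E g" by (metis E.hom_mult)
    thus "E f = 0" using Ep by simp
  qed (rule dvd)
qed

lemma E_eqD: "E f = E g \<Longrightarrow> degree f < degree m \<Longrightarrow> degree g < degree m \<Longrightarrow> f = g"
proof -
  assume *: "E f = E g" "degree f < degree m" "degree g < degree m"
  hence "m dvd f - g" using min_poly_dvd_iff[of "f - g"] by (simp add: E.hom_minus)
  moreover have "degree (f - g) < degree m" using * degree_diff_less by blast
  ultimately show "f = g" using dvd_imp_degree_le[of m "f - g"] by force
qed

text \<open>Elements are given as quotients; the identity \<open>[:d:] = u * m + v * q\<close>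
  evaluated at \<open>\<gamma>\<close> inverts the denominator, and reduction modulo
  \<open>m\<close> lowers the degree.\<close>

lemma E_surj: "\<exists>h. degree h < degree m \<and> z = E h"
proof -
  obtain p q where pq: "E q \<noteq> 0" "z = E p / E q" using ext
    unfolding simple_algebraic_extension_def by blast
  have "\<not> m dvd q" using pq min_poly_dvd_iff by blast
  hence "\<exists>d. d \<noteq> 0 \<and> (\<exists>u v. [:d:] = u * m + v * q)"
    using irreducible_in_eliminate[OF subring_set_UNIV factorial_in_field, of m q]
      min_poly(2) min_poly_degree by simp
  then obtain d u v where d: "d \<noteq> 0" "[:d:] = u * m + v * q" by blast
  have "E [:d:] = E u * E m + E v * E q" unfolding d by (simp only: E.hom_add E.hom_mult)
  hence dv: "\<phi> d = E v * E q" using min_poly(3) by (simp add: \<phi>.map_poly_pCons_hom)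
  define h where "h = smult (inverse d) (p * v) mod m"
  have "smult (inverse d) (p * v) = m * (smult (inverse d) (p * v) div m) + h" by (simp add: h_def)
  hence "E (smult (inverse d) (p * v)) = E h" using min_poly(3) by (metis E.hom_add E.hom_mult add_0 mult_zero_left)
  moreover have "E (smult (inverse d) (p * v)) = inverse (\<phi> d) * (E p * E v)"
    by (simp add: \<phi>.map_poly_hom_smult \<phi>.hom_inverse E.hom_mult)
  moreover have "inverse (\<phi> d) * (E p * E v) = z"
  proof -
    have "\<phi> d \<noteq> 0" using d(1) by simp
    hence "E v \<noteq> 0" "E q \<noteq> 0" unfolding dv by auto
    thus ?thesis unfolding dv pq(2) by (simp add: field_simps)
  qed
  moreover have "degree h < degree m" unfolding h_def
    using degree_mod_less[of m "smult (inverse d) (p * v)"] min_poly_degree by force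
  ultimately show ?thesis by metis
qed

text \<open>The derivative is a nonzero polynomial of smaller degree, so the irreducible
  \<open>m\<close> does not divide it and some nonzero constant is a combination of the two: no root
  is double.\<close>

lemma min_poly_separable:
  assumes char0: "\<And>n. n > 0 \<Longrightarrow> (of_nat n :: 'l) \<noteq> 0"
  shows "card {x. poly (map_poly to_ac m) x = 0} = degree m"
proof -
  have "coeff (pderiv m) (degree m - 1) = of_nat (degree m)"
    using min_poly(1) min_poly_degree by (simp add: coeff_pderiv)
  hence "pderiv m \<noteq> 0" using char0[OF min_poly_degree] by auto
  moreover have "degree (pderiv m) < degree m"
    using degree_pderiv_le[of m] min_poly_degree by linarith
  ultimately have "\<not> m dvd pderiv m" using dvd_imp_degree_le[of m "pderiv m"] by linarith
  hence "\<exists>d. d \<noteq> 0 \<and> (\<exists>u v. [:d:] = u * m + v * pderiv m)"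
    using irreducible_in_eliminate[OF subring_set_UNIV factorial_in_field, of m "pderiv m"]
      min_poly(2) min_poly_degree by simp
  then obtain d u v where d: "d \<noteq> 0" "[:d:] = u * m + v * pderiv m" by blast
  have "m \<noteq> 0" using min_poly_degree by auto
  have "poly (pderiv (map_poly to_ac m)) x \<noteq> 0" if "poly (map_poly to_ac m) x = 0" for x
  proof
    assume 0: "poly (pderiv (map_poly to_ac m)) x = 0"
    have "map_poly to_ac [:d:] = map_poly to_ac u * map_poly to_ac m + map_poly to_ac v * pderiv (map_poly to_ac m)"
      unfolding d by (simp only: to_ac_poly.hom_add to_ac_poly.hom_mult to_ac.map_poly_pderiv)
    from arg_cong[OF this, of "\<lambda>p. poly p x"] 0 that d(1) show False by (simp add: to_ac.map_poly_pCons_hom)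
  qed
  hence "card {x. poly (map_poly to_ac m) x = 0} = degree (map_poly to_ac m)"
    using \<open>m \<noteq> 0\<close> by (intro card_roots_separable) auto
  thus ?thesis by simp
qed

end

section \<open>Specialization in the extension field\<close>

locale specialization =
  fract_specialization a0 + simple_extension \<phi> \<gamma>
  for a0 :: "'n::{finite,linorder} \<Rightarrow> 'k::field_char_0 alg_closure"
    and \<phi> :: "('n, 'k) ppoly fract \<Rightarrow> 'f::field" and \<gamma> :: 'f +
  fixes \<gamma>0 :: "'k alg_closure"
  assumes Omega: "a0 \<in> Omega_gamma \<phi> \<gamma>"
    and root: "poly (spec_min_poly \<phi> \<gamma> a0) \<gamma>0 = 0"
begin

abbreviation "S h \<equiv> poly (map_poly val h) \<gamma>0"
abbreviation "sp \<equiv> spec \<phi> \<gamma> a0 \<gamma>0"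

lemma of_nat_fract_nonzero: "n > 0 \<Longrightarrow> (of_nat n :: ('n, 'k) ppoly fract) \<noteq> 0"
  by (simp add: of_nat_fract Zero_fract_def eq_fract)

lemma of_nat_ext_nonzero: "n > 0 \<Longrightarrow> (of_nat n :: 'f) \<noteq> 0"
  using of_nat_fract_nonzero[of n] \<phi>.hom_0_iff[of "of_nat n"] by (simp add: \<phi>.hom_of_nat)

lemma S_hom: "partial_hom (polys_over regL) (\<lambda>h. S h)"
proof -
  interpret p: partial_hom "polys_over regL" "map_poly val" by (rule val.partial_hom_map_poly)
  show ?thesis
    by unfold_locales (auto simp: p.subring p.hom_0 p.hom_1 p.hom_add p.hom_mult)
qed

sublocale S: partial_hom "polys_over regL" "\<lambda>h. S h" by (rule S_hom)

lemma S_min_poly: "S m = 0"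
  using root by (simp add: spec_min_poly_def val_def[abs_def])

lemma ev_some_lcm:
  assumes "finite C" "ev (some_lcm C) \<noteq> 0" "x \<in> C"
  shows "ev x \<noteq> 0"
proof -
  obtain z where "some_lcm C = x * z"
    using dvd_some_lcm[OF factorial_in_ppoly assms(1,3)] by (auto elim: dvdE)
  thus ?thesis using assms(2) by (auto simp: ev.hom_mult)
qed

lemma min_poly_over: "m \<in> polys_over regL"
  unfolding polys_over_def
proof (intro CollectI allI)
  fix i
  consider "i < degree m" | "i = degree m" | "i > degree m" by linarith
  thus "coeff m i \<in> regL"
  proof cases
    case 1
    have "ev (some_lcm ((\<lambda>i. denomL (coeff m i)) ` {..<degree m})) \<noteq> 0"
      using Omega by (simp add: Omega_gamma_def vanishing_set_def)
    from ev_some_lcm[OF _ this] 1 show ?thesis by (simp add: in_regL_iff)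
  next
    case 2
    thus ?thesis using min_poly(1) val.R(2) by simp
  next
    case 3
    thus ?thesis using val.R(1) by (simp add: coeff_eq_0)
  qed
qed

text \<open>Since \<open>m\<close> is monic over \<open>regL\<close>, division by it stays over
  \<open>regL\<close>. It changes neither the element of the field nor the specialized value,
  because \<open>m\<close> vanishes at \<open>\<gamma>\<close> and its specialization at
  \<open>\<gamma>0\<close>.\<close>

lemma reduce_over:
  assumes h: "h \<in> polys_over regL"
  shows "\<exists>r\<in>polys_over regL. degree r < degree m \<and> E r = E h \<and> S r = S h"
proof -
  obtain q r where qr: "q \<in> polys_over regL" "r \<in> polys_over regL" "h = q * m + r" "degree r < degree m"
    using monic_division_over[OF val.subring min_poly_over min_poly(1) h min_poly_degree] by blast
  have "E h = E q * E m + E r" unfolding qr(3) by (simp only: E.hom_add E.hom_mult)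
  moreover have "S h = S q * S m + S r" unfolding qr(3)
    using qr min_poly_over by (simp only: S.hom_add S.hom_mult S.R)
  ultimately show ?thesis using qr min_poly(3) S_min_poly by auto
qed

text \<open>The condition under the choice operator of \<open>canonF\<close>, with the sum over
  powers of \<open>\<gamma>\<close> read as the value of a polynomial over the fraction
  field.\<close>

definition "canonical z U W \<longleftrightarrow> W \<noteq> 0 \<and> degree U < degree m \<and> z = E (map_poly (\<lambda>u. Fract u W) U) \<and>
     (\<forall>d. (\<forall>i. d dvd coeff U i) \<and> d dvd W \<longrightarrow> d dvd 1)"

lemma Fract_0: "Fract 0 W = 0"
  by (simp add: fract_collapse)

lemma E_map_Fract:
  assumes "degree U < degree m"
  shows "E (map_poly (\<lambda>u. Fract u W) U) = (\<Sum>i<degree m. \<phi> (Fract (coeff U i) W) * \<gamma> ^ i)"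
proof -
  have "degree (map_poly \<phi> (map_poly (\<lambda>u. Fract u W) U)) \<le> degree m - 1"
    using assms degree_map_poly_le[of "\<lambda>u. Fract u W" U] by auto
  hence "E (map_poly (\<lambda>u. Fract u W) U) = (\<Sum>i\<le>degree m - 1. \<phi> (Fract (coeff U i) W) * \<gamma> ^ i)"
    by (subst poly_altdef_le) (auto simp: coeff_map_poly Fract_0)
  also have "{..degree m - 1} = {..<degree m}" using min_poly_degree by auto
  finally show ?thesis .
qed

lemma canonF_canonical: "case canonF \<phi> \<gamma> z of (U, W) \<Rightarrow> canonical z U W"
proof -
  obtain h where h: "degree h < degree m" "z = E h" using E_surj by blast
  have "h \<in> polys_over {c. \<exists>N D. D \<in> {D. D \<noteq> 0} \<and> c = Fract N D}"
    unfolding polys_over_def using Fract_cases_nonzero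
    by (auto simp: polys_over_def) (metis Fract_cases)
  from map_poly_Fract_exists[OF _ _ _ this] obtain U W where
    UW: "W \<noteq> 0" "h = map_poly (\<lambda>u. Fract u W) U" "degree U = degree h" by auto
  obtain d U' W' where *: "W = d * W'" "U = smult d U'" "W' \<noteq> 0"
      "\<forall>e. (\<forall>i. e dvd coeff U' i) \<and> e dvd W' \<longrightarrow> e dvd 1"
    using factorial_reduce[OF factorial_in_ppoly UW(1)] by metis
  have d0: "d \<noteq> 0" using * UW by auto
  have "h = map_poly (\<lambda>u. Fract u W') U'"
    using d0 * UW by (intro poly_eqI) (simp add: coeff_map_poly Fract_0 eq_fract)
  moreover have "degree U' < degree m" using * d0 h UW by simp
  ultimately have "canonical z U' W'" using * h by (simp add: canonical_def)
  hence ex: "\<exists>p. case p of (U, W) \<Rightarrow> canonical z U W" by auto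
  have "canonF \<phi> \<gamma> z = (SOME p. case p of (U, W) \<Rightarrow> canonical z U W)"
    unfolding canonF_def canonical_def
    by (intro arg_cong[of _ _ Eps] ext) (auto simp: E_map_Fract)
  thus ?thesis using someI_ex[OF ex] by simp
qed

text \<open>Connects the canonical representation with an arbitrary one over \<open>regL\<close>.
  After reduction modulo \<open>m\<close> both are polynomials of degree below that of
  \<open>m\<close>, hence equal, and comparing coefficients shows that \<open>W\<close> divides a
  denominator not vanishing at \<open>a0\<close>.\<close>

lemma canonF_E:
  assumes h: "h \<in> polys_over regL" and c: "canonF \<phi> \<gamma> (E h) = (U, W)"
  shows "ev W \<noteq> 0" "poly (map_poly ev U) \<gamma>0 / ev W = S h"
    "map_poly (\<lambda>u. Fract u W) U \<in> polys_over regL" "S (map_poly (\<lambda>u. Fract u W) U) = S h"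
proof -
  have can: "canonical (E h) U W" using canonF_canonical[of "E h"] c by simp
  obtain r where r: "r \<in> polys_over regL" "degree r < degree m" "E r = E h" "S r = S h"
    using reduce_over[OF h] by blast
  have "r \<in> polys_over {c. \<exists>N D. D \<in> {D. ev D \<noteq> 0} \<and> c = Fract N D}"
    using r(1) by (simp add: regL_altdef)
  from map_poly_Fract_exists[OF _ _ _ this] obtain U0 W0 where
    UW: "ev W0 \<noteq> 0" "r = map_poly (\<lambda>u. Fract u W0) U0" by (auto simp: ev.hom_mult)
  define r' where "r' = map_poly (\<lambda>u. Fract u W) U"
  have "degree r' < degree m" using can degree_map_poly_le[of "\<lambda>u. Fract u W" U]
    unfolding r'_def canonical_def by linarith
  moreover have "E r' = E r" using can r by (simp add: canonical_def r'_def)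
  ultimately have rr: "r' = r" using E_eqD r(2) by blast
  have "W dvd coeff U i * W0" for i
  proof -
    have "Fract (coeff U i) W = Fract (coeff U0 i) W0"
      using arg_cong[OF rr, of "\<lambda>p. coeff p i"] by (simp add: r'_def UW coeff_map_poly Fract_0)
    moreover have "W0 \<noteq> 0" "W \<noteq> 0" using UW can by (auto simp: canonical_def)
    ultimately have "coeff U i * W0 = coeff U0 i * W" by (simp add: eq_fract)
    thus ?thesis by simp
  qed
  moreover obtain u ps where "prime_product UNIV u ps W"
    using factorial_in_ppoly can by (auto simp: factorial_in_def canonical_def)
  ultimately have "W dvd W0" using factorial_coprime_dvd[of u ps W "coeff U" W0] can
    by (auto simp: canonical_def)
  thus W: "ev W \<noteq> 0" using UW by (auto elim!: dvdE simp: ev.hom_mult)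
  have "S r' = poly (map_poly ev U) \<gamma>0 / ev W"
  proof -
    have "map_poly val r' = smult (inverse (ev W)) (map_poly ev U)"
      using W by (intro poly_eqI) (simp add: r'_def coeff_map_poly Fract_0 val.hom_0 val_Fract field_simps)
    thus ?thesis by (simp add: field_simps)
  qed
  thus "poly (map_poly ev U) \<gamma>0 / ev W = S h" using rr r by simp
  show "map_poly (\<lambda>u. Fract u W) U \<in> polys_over regL" "S (map_poly (\<lambda>u. Fract u W) U) = S h"
    using rr r unfolding r'_def by auto
qed

definition "R = {z. \<exists>h\<in>polys_over regL. z = E h}"

lemma spec_E: "h \<in> polys_over regL \<Longrightarrow> sp (E h) = S h"
  using canonF_E(2)[of h] by (auto simp: spec_def split: prod.splits)

lemma in_R_I: "ev (denomF \<phi> \<gamma> z) \<noteq> 0 \<Longrightarrow> z \<in> R"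
proof -
  assume *: "ev (denomF \<phi> \<gamma> z) \<noteq> 0"
  obtain U W where UW: "canonF \<phi> \<gamma> z = (U, W)" by force
  have "canonical z U W" using canonF_canonical[of z] UW by simp
  hence z: "z = E (map_poly (\<lambda>u. Fract u W) U)" by (simp add: canonical_def)
  have "ev W \<noteq> 0" using * UW by (simp add: denomF_def)
  hence "map_poly (\<lambda>u. Fract u W) U \<in> polys_over regL"
    by (auto simp: polys_over_def coeff_map_poly Fract_0 regL_def)
  thus ?thesis using z unfolding R_def by blast
qed

text \<open>By \<open>spec_E\<close> the specialization can be computed from any polynomial over
  \<open>regL\<close> that represents the element; the laws are then those of polynomial
  evaluation.\<close>

lemma spec_hom: "partial_hom R sp"
proof
  have in_R: "h \<in> polys_over regL \<Longrightarrow> E h \<in> R" for h unfolding R_def by blast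
  show "subring_set R" unfolding subring_set_def
  proof (intro conjI ballI)
    show "0 \<in> R" "1 \<in> R" using in_R[OF S.R(1)] in_R[OF S.R(2)] by simp_all
    fix x y assume "x \<in> R" "y \<in> R"
    then obtain h g where *: "h \<in> polys_over regL" "g \<in> polys_over regL" "x = E h" "y = E g"
      unfolding R_def by blast
    show "x + y \<in> R" "x * y \<in> R" "- x \<in> R"
      using in_R[OF S.R(3)[OF *(1,2)]] in_R[OF S.R(4)[OF *(1,2)]] in_R[OF S.R(5)[OF *(1)]] *
      by (simp_all only: E.hom_add E.hom_mult E.hom_uminus)
  qed
  show "sp 0 = 0" "sp 1 = 1" using spec_E[OF S.R(1)] spec_E[OF S.R(2)] by (simp_all add: val.hom_1)
  fix x y assume "x \<in> R" "y \<in> R"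
  then obtain h g where *: "h \<in> polys_over regL" "g \<in> polys_over regL" "x = E h" "y = E g"
    unfolding R_def by blast
  show "sp (x + y) = sp x + sp y" "sp (x * y) = sp x * sp y"
    using spec_E[OF S.R(3)[OF *(1,2)]] spec_E[OF S.R(4)[OF *(1,2)]] spec_E[OF *(1)] spec_E[OF *(2)]
      S.hom_add[OF *(1,2)] S.hom_mult[OF *(1,2)] unfolding *(3,4)
    by (simp_all only: E.hom_add E.hom_mult)
qed

sublocale sp: partial_hom R sp by (rule spec_hom)

lemma Omega_defD:
  assumes "a0 \<in> Omega_def \<phi> \<gamma> C" "finite C"
  shows "C \<subseteq> R"
proof
  fix c assume c: "c \<in> C"
  have "ev (some_lcm (denomF \<phi> \<gamma> ` C)) \<noteq> 0"
    using assms by (simp add: Omega_def_def vanishing_set_def)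
  from ev_some_lcm[OF _ this] c assms(2) show "c \<in> R" by (intro in_R_I) auto
qed

text \<open>Used in the opposite direction: a norm not vanishing at \<open>a0\<close> keeps an
  element from specializing to zero.\<close>

lemma norm_vanishes:
  assumes z: "z \<in> R" "sp z = 0"
  shows "ev (numerL (NormF \<phi> \<gamma> z)) = 0"
proof -
  obtain h where h: "h \<in> polys_over regL" "z = E h" using z by (auto simp: R_def)
  obtain U W where UW: "canonF \<phi> \<gamma> z = (U, W)" by force
  have can: "canonical z U W" using canonF_canonical[of z] UW by simp
  define r where "r = map_poly (\<lambda>u. Fract u W) U"
  have r: "r \<in> polys_over regL" "S r = 0"
    using canonF_E(3,4)[OF h(1), of U W] UW h z spec_E[OF h(1)] by (auto simp: r_def)
  have c: "poly (map_poly val m) \<gamma>0 = 0" by (rule S_min_poly)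
  obtain n where n: "n \<in> regL" "val n = 0"
    "to_ac n = (\<Prod>x | poly (map_poly to_ac m) x = 0. poly (map_poly to_ac r) x)"
    using norm_specialization[OF val_hom min_poly_over min_poly(1) min_poly_degree
        min_poly_separable[OF of_nat_fract_nonzero] r(1) c r(2)] by blast
  have "poly (map_poly to_ac r) x = (\<Sum>i<degree m. to_ac (Fract (coeff U i) W) * x ^ i)" for x
  proof -
    have "degree (map_poly to_ac r) \<le> degree m - 1"
      using can degree_map_poly_le[of "\<lambda>u. Fract u W" U] degree_map_poly_le[of to_ac r]
      unfolding canonical_def r_def by linarith
    hence "poly (map_poly to_ac r) x = (\<Sum>i\<le>degree m - 1. to_ac (Fract (coeff U i) W) * x ^ i)"
      by (subst poly_altdef_le) (auto simp: coeff_map_poly Fract_0 r_def)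
    also have "{..degree m - 1} = {..<degree m}" using min_poly_degree by auto
    finally show ?thesis .
  qed
  \<comment> \<open>The product of the conjugates lies in the image of the ground field, so
    \<open>of_ac\<close> recovers \<open>n\<close>.\<close>
  hence "NormF \<phi> \<gamma> z = n" unfolding NormF_def UW using n(3) by (simp add: of_ac_eqI)
  thus ?thesis using n(1,2) by (auto simp: val_def in_regL_iff)
qed

lemma Omega_nonZD:
  assumes "a0 \<in> Omega_nonZ \<phi> \<gamma> C" "finite C"
  shows "C \<subseteq> R" "\<exists>c\<in>C. sp c \<noteq> 0"
proof -
  have "a0 \<in> Omega_def \<phi> \<gamma> C" using assms by (simp add: Omega_nonZ_def)
  thus CR: "C \<subseteq> R" using assms(2) by (rule Omega_defD)
  obtain c where c: "c \<in> C" "ev (numerL (NormF \<phi> \<gamma> (numerF \<phi> \<gamma> c))) \<noteq> 0"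
    using assms(1) by (auto simp: Omega_nonZ_def vanishing_set_def)
  have "sp c \<noteq> 0"
  proof
    assume 0: "sp c = 0"
    obtain h where h: "h \<in> polys_over regL" "c = E h" using c CR by (auto simp: R_def)
    obtain U W where UW: "canonF \<phi> \<gamma> c = (U, W)" by force
    have W: "ev W \<noteq> 0" using canonF_E(1)[OF h(1), of U W] UW h by simp
    hence S0: "poly (map_poly ev U) \<gamma>0 = 0" using 0 UW by (simp add: spec_def)
    \<comment> \<open>The norm condition concerns the numerator of \<open>c\<close>. Since
      \<open>W\<close> does not vanish at \<open>a0\<close>, the numerator specializes to zero
      together with \<open>c\<close>, and having polynomial coefficients it lies in
      \<open>R\<close>.\<close>
    have vf: "val (to_fract P) = ev P" "to_fract P \<in> regL" for P
      using val_Fract[of 1 P] by (simp_all add: to_fract_def in_regL_iff)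
    have N: "numerF \<phi> \<gamma> c = E (map_poly to_fract U)"
      by (simp add: numerF_def UW map_poly_map_poly o_def)
    have U: "map_poly to_fract U \<in> polys_over regL" by (simp add: polys_over_def coeff_map_poly vf)
    have "map_poly val (map_poly to_fract U) = map_poly ev U"
      by (intro poly_eqI) (simp add: coeff_map_poly val.hom_0 vf)
    hence "sp (numerF \<phi> \<gamma> c) = 0" using spec_E[OF U] S0 N by simp
    moreover have "numerF \<phi> \<gamma> c \<in> R" using U N by (auto simp: R_def)
    ultimately show False using norm_vanishes c by blast
  qed
  thus "\<exists>c\<in>C. sp c \<noteq> 0" using c by blast
qed

end

section \<open>Bivariate polynomials\<close>

lemma eval2_0 [simp]: "eval2 0 x y = 0"
  and eval2_1 [simp]: "eval2 1 x y = 1"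
  and eval2_add: "eval2 (f + g) x y = eval2 f x y + eval2 g x y"
  and eval2_mult: "eval2 (f * g) x y = eval2 f x y * eval2 g x y"
  and eval2_smult: "eval2 (smult c f) x y = poly c x * eval2 f x y"
  and eval2_diff: "eval2 (f - g) x y = eval2 f x y - eval2 g x y"
  and eval2_power: "eval2 (f ^ n) x y = eval2 f x y ^ n"
  and eval2_sum: "eval2 (sum F S) x y = (\<Sum>i\<in>S. eval2 (F i) x y)"
  and eval2_const [simp]: "eval2 [:c:] x y = poly c x"
  and eval2_pCons: "eval2 (pCons c f) x y = poly c x + y * eval2 f x y"
  by (simp_all add: eval2_def poly_sum)

lemma eval2_as_poly: "eval2 f x y = poly (map_poly (\<lambda>c. poly c x) f) y"
  by (induction f) (auto simp: eval2_pCons map_poly_pCons)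

lemma eval2_altdef_le:
  assumes "degree f \<le> n"
  shows "eval2 f x y = (\<Sum>j\<le>n. poly (coeff f j) x * y ^ j)"
proof -
  have "degree (map_poly (\<lambda>c. poly c x) f) \<le> n"
    using degree_map_poly_le[of "\<lambda>c. poly c x" f] assms by linarith
  thus ?thesis unfolding eval2_as_poly by (subst poly_altdef_le) (auto simp: coeff_map_poly)
qed

section \<open>Exchanging the variables\<close>

text \<open>Makes the degree in \<open>x\<close> available as \<open>degree (swap_poly f)\<close>
  and lets every statement about \<open>y\<close> be applied to \<open>x\<close>.\<close>

definition swap_poly :: "'a::comm_ring_1 poly poly \<Rightarrow> 'a poly poly" where
  "swap_poly f = poly (map_poly (map_poly (\<lambda>a. [:a:])) f) [:[:0, 1:]:]"

lemma swap_poly_hom: "comm_ring_hom (swap_poly :: 'a::comm_ring_1 poly poly \<Rightarrow> _)"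
proof -
  interpret c: comm_ring_hom "\<lambda>a :: 'a. [:a:]" by unfold_locales (auto simp: one_pCons mult.commute)
  interpret cp: map_poly_comm_ring_hom "\<lambda>a :: 'a. [:a:]" ..
  interpret cpp: map_poly_comm_ring_hom "map_poly (\<lambda>a :: 'a. [:a:])" ..
  show ?thesis unfolding swap_poly_def[abs_def]
    by unfold_locales (auto simp: cpp.hom_add cpp.hom_mult)
qed

interpretation swap: comm_ring_hom "swap_poly :: 'a::comm_ring_1 poly poly \<Rightarrow> _"
  by (rule swap_poly_hom)

lemma coeff_swap_poly [simp]: "coeff (coeff (swap_poly f) i) j = coeff (coeff f j) i"
proof -
  have pow: "[:[:0, 1 :: 'a:]:] ^ n = [:monom 1 n:]" for n
    by (induction n) (auto simp: one_pCons monom_0 monom_Suc)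
  have "degree (map_poly (map_poly (\<lambda>a. [:a:])) f) \<le> max j (degree f)"
    using degree_map_poly_le[of _ f] by (meson le_max_iff_disj)
  hence "swap_poly f = (\<Sum>l\<le>max j (degree f). map_poly (\<lambda>a. [:a:]) (coeff f l) * [:monom 1 l:])"
    unfolding swap_poly_def by (subst poly_altdef_le) (auto simp: coeff_map_poly pow)
  hence "coeff (coeff (swap_poly f) i) j = (\<Sum>l\<le>max j (degree f). coeff ([:coeff (coeff f l) i:] * monom 1 l) j)"
    by (simp add: coeff_sum coeff_map_poly)
  also have "\<dots> = (\<Sum>l\<le>max j (degree f). if l = j then coeff (coeff f l) i else 0)"
    by (intro sum.cong) auto
  also have "\<dots> = coeff (coeff f j) i" by simp
  finally show ?thesis .
qed

lemma swap_swap_poly [simp]: "swap_poly (swap_poly f) = f"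
  by (intro poly_eqI) simp

lemma swap_poly_eq_iff [simp]: "swap_poly f = swap_poly g \<longleftrightarrow> f = g"
  by (metis swap_swap_poly)

lemma swap_poly_dvd_iff [simp]: "swap_poly f dvd swap_poly g \<longleftrightarrow> f dvd g"
  by (metis swap.hom_dvd swap_swap_poly)

lemma swap_poly_irreducible:
  assumes "Factorial_Ring.irreducible f"
  shows "Factorial_Ring.irreducible (swap_poly f)"
proof (rule Factorial_Ring.irreducibleI)
  show "swap_poly f \<noteq> 0" using assms swap_poly_eq_iff[of f 0] by auto
  show "\<not> swap_poly f dvd 1" using assms swap_poly_dvd_iff[of f 1] by auto
  fix a b assume "swap_poly f = a * b"
  hence "f = swap_poly a * swap_poly b" by (metis swap.hom_mult swap_swap_poly)
  hence "swap_poly a dvd 1 \<or> swap_poly b dvd 1" using assms Factorial_Ring.irreducibleD by blast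
  thus "a dvd 1 \<or> b dvd 1" using swap_poly_dvd_iff[of a 1] swap_poly_dvd_iff[of b 1] by simp
qed

lemma eval2_swap [simp]: "eval2 (swap_poly f) y x = eval2 f x y"
proof (induction f)
  case (pCons c f)
  have "swap_poly (pCons c f) = map_poly (\<lambda>a. [:a:]) c + [:[:0, 1:]:] * swap_poly f"
    unfolding swap_poly_def using pCons.hyps by (subst map_poly_pCons) auto
  moreover have "eval2 (map_poly (\<lambda>a. [:a:]) c) y x = poly c x"
    by (simp add: eval2_def poly_map_const)
  ultimately show ?case using pCons by (simp add: eval2_add eval2_smult eval2_pCons)
qed simp

lemma degree_coeff_le_swap: "degree (coeff f j) \<le> degree (swap_poly f)"
proof (rule degree_le, intro allI impI)
  fix i assume "degree (swap_poly f) < i"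
  hence "coeff (swap_poly f) i = 0" by (rule coeff_eq_0)
  thus "coeff (coeff f j) i = 0" using coeff_swap_poly[of f i j] by simp
qed

section \<open>Intersections of plane curves\<close>

text \<open>Over the factorial ring k[x] elimination leaves a polynomial in \<open>x\<close> alone.
  If \<open>f\<close> has degree zero in \<open>y\<close>, it is such a polynomial itself.\<close>

lemma irreducible_eliminate_x:
  fixes f g :: "'a::field poly poly"
  assumes f: "Factorial_Ring.irreducible f" and fg: "\<not> f dvd g"
  shows "\<exists>c u v. c \<noteq> 0 \<and> [:c:] = u * f + v * g"
proof (cases "degree f = 0")
  case True
  then obtain c where "f = [:c:]" by (auto elim: degree_eq_zeroE)
  thus ?thesis using f by (intro exI[of _ c] exI[of _ 1] exI[of _ 0]) auto
next
  case False
  have "factorial_in (UNIV :: 'a poly set)"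
    using factorial_in_polys_over[OF subring_set_UNIV factorial_in_field] by simp
  from irreducible_in_eliminate[OF subring_set_UNIV this, of f g] show ?thesis
    using f fg False by auto
qed

text \<open>A weak form of Bezout's theorem: the eliminant leaves finitely many \<open>x\<close>,
  and a fibre over \<open>x\<close> could only be infinite if the equation of the vertical line
  divided both polynomials.\<close>

lemma finite_common_zeros:
  fixes f g :: "'a::field poly poly"
  assumes f: "Factorial_Ring.irreducible f" and fg: "\<not> f dvd g"
  shows "finite {(x, y). eval2 f x y = 0 \<and> eval2 g x y = 0}"
proof -
  obtain c u v where c: "c \<noteq> 0" "[:c:] = u * f + v * g" using irreducible_eliminate_x[OF f fg] by blast
  have root: "poly c x = 0" if "eval2 f x y = 0" "eval2 g x y = 0" for x y
    using arg_cong[OF c(2), of "\<lambda>h. eval2 h x y"] that by (simp add: eval2_add eval2_mult)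
  have fib: "finite {y. eval2 f x y = 0 \<and> eval2 g x y = 0}" for x
  proof -
    have l: "[:[:-x, 1:]:] dvd h" if "map_poly (\<lambda>c. poly c x) h = 0" for h
      using that unfolding const_poly_dvd_iff
      by (metis coeff_0 coeff_map_poly poly_0 poly_eq_0_iff_dvd)
    \<comment> \<open>Otherwise \<open>f\<close>, being irreducible, is the equation of that line up
      to a unit and so divides \<open>g\<close>.\<close>
    have "map_poly (\<lambda>c. poly c x) f \<noteq> 0 \<or> map_poly (\<lambda>c. poly c x) g \<noteq> 0"
    proof (rule ccontr)
      assume "\<not> ?thesis"
      hence d: "[:[:-x, 1:]:] dvd f" "[:[:-x, 1:]:] dvd g" using l by auto
      then obtain h where h: "f = [:[:-x, 1:]:] * h" by (auto elim: dvdE)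
      have "\<not> [:[:-x, 1:]:] dvd 1" by (simp add: is_unit_const_poly_iff is_unit_iff_degree)
      hence "h dvd 1" using f h Factorial_Ring.irreducibleD by blast
      hence "f dvd [:[:-x, 1:]:]" unfolding h by (metis mult_unit_dvd_iff dvd_refl)
      thus False using d fg dvd_trans by blast
    qed
    hence "finite {y. poly (map_poly (\<lambda>c. poly c x) f) y = 0} \<or> finite {y. poly (map_poly (\<lambda>c. poly c x) g) y = 0}"
      using poly_roots_finite by blast
    thus ?thesis unfolding eval2_as_poly by (auto elim: rev_finite_subset)
  qed
  have "{(x, y). eval2 f x y = 0 \<and> eval2 g x y = 0} \<subseteq>
      Sigma {x. poly c x = 0} (\<lambda>x. {y. eval2 f x y = 0 \<and> eval2 g x y = 0})"
    using root by auto
  moreover have "finite \<dots>" using poly_roots_finite[OF c(1)] fib by (intro finite_SigmaI) auto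
  ultimately show ?thesis by (rule finite_subset)
qed

section \<open>Substituting a pair of rational functions\<close>

text \<open>
  \<open>homog N c p q\<close> is \<open>q\<^sup>N c(p / q)\<close>, and \<open>pullback N M H p1 q1 p2 q2\<close> is
  \<open>q1\<^sup>N q2\<^sup>M H(p1 / q1, p2 / q2)\<close>.
\<close>

definition homog :: "nat \<Rightarrow> 'a::comm_ring_1 poly \<Rightarrow> 'a poly \<Rightarrow> 'a poly \<Rightarrow> 'a poly" where
  "homog N c p q = (\<Sum>i\<le>N. smult (coeff c i) (p ^ i * q ^ (N - i)))"

definition pullback ::
  "nat \<Rightarrow> nat \<Rightarrow> 'a::comm_ring_1 poly poly \<Rightarrow> 'a poly \<Rightarrow> 'a poly \<Rightarrow> 'a poly \<Rightarrow> 'a poly \<Rightarrow> 'a poly" where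
  "pullback N M H p1 q1 p2 q2 = (\<Sum>j\<le>M. homog N (coeff H j) p1 q1 * p2 ^ j * q2 ^ (M - j))"

lemma power_split_divide:
  fixes a b :: "'b::field"
  assumes "b \<noteq> 0" "i \<le> N"
  shows "a ^ i * b ^ (N - i) = b ^ N * (a / b) ^ i"
  using assms by (simp add: power_divide power_diff field_simps)

lemma hom_homog:
  fixes \<theta> :: "'a::comm_ring_1 poly \<Rightarrow> 'b::field"
  assumes "comm_ring_hom \<theta>" "\<theta> q \<noteq> 0" "degree c \<le> N"
  shows "\<theta> (homog N c p q) = \<theta> q ^ N * poly (map_poly (\<lambda>c. \<theta> [:c:]) c) (\<theta> p / \<theta> q)"
proof -
  interpret comm_ring_hom \<theta> by fact
  have "degree (map_poly (\<lambda>c. \<theta> [:c:]) c) \<le> N"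
    using degree_map_poly_le[of "\<lambda>c. \<theta> [:c:]" c] assms(3) by linarith
  hence "poly (map_poly (\<lambda>c. \<theta> [:c:]) c) (\<theta> p / \<theta> q) = (\<Sum>i\<le>N. \<theta> [:coeff c i:] * (\<theta> p / \<theta> q) ^ i)"
    by (subst poly_altdef_le) (auto simp: coeff_map_poly)
  moreover have "\<theta> (homog N c p q) = (\<Sum>i\<le>N. \<theta> [:coeff c i:] * (\<theta> p ^ i * \<theta> q ^ (N - i)))"
  proof -
    have "smult a r = [:a:] * r" for a and r :: "'a poly" by simp
    thus ?thesis by (simp only: homog_def hom_sum hom_mult hom_power)
  qed
  ultimately show ?thesis using power_split_divide[OF assms(2)]
    by (simp add: sum_distrib_left ac_simps)
qed

text \<open>Stated for an arbitrary \<open>\<theta>\<close> because it is applied both to evaluation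
  at a parameter value and to the embedding of a polynomial ring into its fraction field.\<close>

lemma hom_pullback:
  fixes \<theta> :: "'a::comm_ring_1 poly \<Rightarrow> 'b::field"
  assumes hom: "comm_ring_hom \<theta>" and nz: "\<theta> q1 \<noteq> 0" "\<theta> q2 \<noteq> 0"
    and deg: "degree (swap_poly H) \<le> N" "degree H \<le> M"
  shows "\<theta> (pullback N M H p1 q1 p2 q2) = \<theta> q1 ^ N * \<theta> q2 ^ M *
    eval2 (map_poly (map_poly (\<lambda>c. \<theta> [:c:])) H) (\<theta> p1 / \<theta> q1) (\<theta> p2 / \<theta> q2)"
proof -
  interpret comm_ring_hom \<theta> by fact
  let ?e = "\<lambda>c. poly (map_poly (\<lambda>c. \<theta> [:c:]) c) (\<theta> p1 / \<theta> q1)"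
  have "degree (map_poly (map_poly (\<lambda>c. \<theta> [:c:])) H) \<le> M"
    using degree_map_poly_le[of "map_poly (\<lambda>c. \<theta> [:c:])" H] deg(2) by linarith
  hence "eval2 (map_poly (map_poly (\<lambda>c. \<theta> [:c:])) H) (\<theta> p1 / \<theta> q1) (\<theta> p2 / \<theta> q2) =
      (\<Sum>j\<le>M. ?e (coeff H j) * (\<theta> p2 / \<theta> q2) ^ j)"
    by (subst eval2_altdef_le) (auto simp: coeff_map_poly)
  moreover have "\<theta> (homog N (coeff H j) p1 q1) = \<theta> q1 ^ N * ?e (coeff H j)" for j
    using degree_coeff_le_swap[of H j] deg(1) by (intro hom_homog hom nz) linarith
  hence "\<theta> (pullback N M H p1 q1 p2 q2) =
      (\<Sum>j\<le>M. \<theta> q1 ^ N * ?e (coeff H j) * (\<theta> p2 ^ j * \<theta> q2 ^ (M - j)))"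
    by (simp add: pullback_def hom_sum hom_mult hom_power mult.assoc)
  ultimately show ?thesis using power_split_divide[OF nz(2)]
    by (simp add: sum_distrib_left ac_simps)
qed

lemma poly_pullback:
  fixes H :: "'a::field poly poly"
  assumes "poly q1 t \<noteq> 0" "poly q2 t \<noteq> 0" "degree (swap_poly H) \<le> N" "degree H \<le> M"
  shows "poly (pullback N M H p1 q1 p2 q2) t = poly q1 t ^ N * poly q2 t ^ M *
    eval2 H (poly p1 t / poly q1 t) (poly p2 t / poly q2 t)"
proof -
  have "comm_ring_hom (\<lambda>f. poly f t)" by (rule poly_hom)
  from hom_pullback[OF this assms, of p1 p2] show ?thesis by (simp add: map_poly_idI)
qed

text \<open>The exponents \<open>N\<close> and \<open>M\<close> are fixed in advance, so the formula
  survives a drop of the degrees of \<open>H\<close> under specialization.\<close>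

lemma (in partial_hom) pullback_hom:
  assumes "H \<in> polys_over (polys_over R)" "p1 \<in> polys_over R" "q1 \<in> polys_over R"
    "p2 \<in> polys_over R" "q2 \<in> polys_over R"
  shows "map_poly \<sigma> (pullback N M H p1 q1 p2 q2) =
    pullback N M (map_poly (map_poly \<sigma>) H) (map_poly \<sigma> p1) (map_poly \<sigma> q1) (map_poly \<sigma> p2) (map_poly \<sigma> q2)"
proof -
  interpret p: partial_hom "polys_over R" "map_poly \<sigma>" by (rule partial_hom_map_poly)
  have pow: "x \<in> polys_over R \<Longrightarrow> x ^ n \<in> polys_over R" for x n
    by (rule subring_set_power[OF p.subring])
  have c: "coeff (coeff H j) i \<in> R" for i j
    using assms(1) by (auto simp: polys_over_def)
  have h: "homog N (coeff H j) p1 q1 \<in> polys_over R" for j unfolding homog_def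
    by (intro subring_set_sum[OF p.subring] smult_polys_over[OF subring] p.R c pow assms)
  have hh: "map_poly \<sigma> (homog N (coeff H j) p1 q1) =
      homog N (map_poly \<sigma> (coeff H j)) (map_poly \<sigma> p1) (map_poly \<sigma> q1)" for j
    unfolding homog_def using assms
    by (subst p.hom_sum)
      (auto simp: p.R c pow p.hom_mult p.hom_power map_poly_smult intro!: smult_polys_over[OF subring])
  show ?thesis unfolding pullback_def using assms
    by (subst p.hom_sum) (auto simp: p.R h hh pow p.hom_mult p.hom_power)
qed

section \<open>Parametrized plane curves\<close>

lemma infinite_alg_closed: "infinite (UNIV :: 'a::alg_closed_field set)"
proof
  assume fin: "finite (UNIV :: 'a set)"
  define p where "p = (\<Prod>a\<in>(UNIV :: 'a set). [:-a, 1:]) + 1"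
  have "degree (\<Prod>a\<in>(UNIV :: 'a set). [:-a, 1:]) = card (UNIV :: 'a set)"
    by (subst degree_prod_eq_sum_degree) auto
  moreover have "card (UNIV :: 'a set) > 0" using fin by (simp add: card_gt_0_iff)
  ultimately have "degree p > 0" unfolding p_def by (subst degree_add_eq_left) auto
  then obtain x where "poly p x = 0" using alg_closed_imp_poly_has_root by blast
  moreover have "poly (\<Prod>a\<in>(UNIV :: 'a set). [:-a, 1:]) x = 0"
    using fin by (auto simp: poly_prod prod_zero_iff)
  ultimately show False by (simp add: p_def)
qed

locale rational_pair =
  fixes p1 q1 p2 q2 :: "'a::alg_closed_field poly"
  assumes q0: "q1 \<noteq> 0" "q2 \<noteq> 0"
    and nonconst: "\<not> (\<exists>c1 c2. p1 = smult c1 q1 \<and> p2 = smult c2 q2)"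
begin

abbreviation "xp t \<equiv> poly p1 t / poly q1 t"
abbreviation "yp t \<equiv> poly p2 t / poly q2 t"
abbreviation "regular \<equiv> rat_defined q1 q2"

definition "vanishes H \<longleftrightarrow> (\<forall>t. regular t \<longrightarrow> eval2 H (xp t) (yp t) = 0)"

lemma cofinite_def: "finite {t. \<not> regular t}"
proof -
  have "{t. \<not> regular t} \<subseteq> {t. poly q1 t = 0} \<union> {t. poly q2 t = 0}" by (auto simp: rat_defined_def)
  thus ?thesis using poly_roots_finite[OF q0(1)] poly_roots_finite[OF q0(2)] finite_subset by blast
qed

text \<open>Turns vanishing at infinitely many parameter values into one polynomial identity, the
  form that can be specialized.\<close>

lemma vanishes_iff_pullback:
  assumes deg: "degree (swap_poly H) \<le> N" "degree H \<le> M"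
  shows "vanishes H \<longleftrightarrow> pullback N M H p1 q1 p2 q2 = 0"
proof
  assume v: "vanishes H"
  have "{t. regular t} \<subseteq> {t. poly (pullback N M H p1 q1 p2 q2) t = 0}"
    using v deg by (auto simp: vanishes_def poly_pullback rat_defined_def)
  moreover have "infinite {t. regular t}"
    using cofinite_def infinite_alg_closed by (metis Collect_neg_eq finite_compl)
  ultimately show "pullback N M H p1 q1 p2 q2 = 0"
    using poly_roots_finite finite_subset by blast
next
  assume 0: "pullback N M H p1 q1 p2 q2 = 0"
  show "vanishes H" unfolding vanishes_def
  proof (intro allI impI)
    fix t assume "regular t"
    hence d: "poly q1 t \<noteq> 0" "poly q2 t \<noteq> 0" by (auto simp: rat_defined_def)
    thus "eval2 H (xp t) (yp t) = 0" using poly_pullback[OF d deg, of p1 p2] 0 by simp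
  qed
qed

lemma not_vanishes_cofinite:
  assumes "\<not> vanishes H"
  shows "finite {t. regular t \<longrightarrow> eval2 H (xp t) (yp t) = 0}"
proof -
  let ?g = "pullback (degree (swap_poly H)) (degree H) H p1 q1 p2 q2"
  have "?g \<noteq> 0" using assms vanishes_iff_pullback[of H] by simp
  moreover have "poly ?g t = 0" if "regular t" "eval2 H (xp t) (yp t) = 0" for t
    using that by (simp add: poly_pullback rat_defined_def)
  hence "{t. regular t \<longrightarrow> eval2 H (xp t) (yp t) = 0} \<subseteq> {t. \<not> regular t} \<union> {t. poly ?g t = 0}"
    by blast
  moreover have "finite ({t. \<not> regular t} \<union> {t. poly ?g t = 0})"
    using poly_roots_finite[OF \<open>?g \<noteq> 0\<close>] cofinite_def by simp
  ultimately show ?thesis using finite_subset by blast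
qed

text \<open>The polynomials vanishing along the parametrization form a prime ideal: two finite sets
  cannot cover the parameter line.\<close>

lemma not_vanishes_mult:
  assumes "\<not> vanishes G" "\<not> vanishes H"
  shows "\<not> vanishes (G * H)"
proof
  assume "vanishes (G * H)"
  hence "UNIV = {t. regular t \<longrightarrow> eval2 G (xp t) (yp t) = 0} \<union> {t. regular t \<longrightarrow> eval2 H (xp t) (yp t) = 0}"
    by (auto simp: vanishes_def eval2_mult)
  moreover have "finite ({t. regular t \<longrightarrow> eval2 G (xp t) (yp t) = 0} \<union> {t. regular t \<longrightarrow> eval2 H (xp t) (yp t) = 0})"
    using not_vanishes_cofinite assms by simp
  ultimately show False using infinite_alg_closed by metis
qed

text \<open>If the image were finite, one point would have infinitely many preimages, and both
  coordinates would be constant.\<close>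

lemma infinite_image: "infinite ((\<lambda>t. (xp t, yp t)) ` {t. regular t})"
proof
  assume fin: "finite ((\<lambda>t. (xp t, yp t)) ` {t. regular t})"
  have inf: "infinite {t. regular t}"
    using cofinite_def infinite_alg_closed by (metis Collect_neg_eq finite_compl)
  then obtain t0 where "infinite {t \<in> {t. regular t}. (xp t, yp t) = (xp t0, yp t0)}"
    using pigeonhole_infinite[OF inf fin] by auto
  moreover have "{t \<in> {t. regular t}. (xp t, yp t) = (xp t0, yp t0)} \<subseteq> {t. poly (p1 - smult (xp t0) q1) t = 0}"
    "{t \<in> {t. regular t}. (xp t, yp t) = (xp t0, yp t0)} \<subseteq> {t. poly (p2 - smult (yp t0) q2) t = 0}"
    by (auto simp: rat_defined_def field_simps)
  ultimately have "p1 - smult (xp t0) q1 = 0" "p2 - smult (yp t0) q2 = 0"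
    using poly_roots_finite finite_subset by blast+
  thus False using nonconst by auto
qed

text \<open>Without divisibility the two curves would meet in finitely many points, but both contain
  the infinite image.\<close>

lemma irreducible_vanishes_dvd:
  assumes f: "Factorial_Ring.irreducible f" "vanishes f" and H: "vanishes H"
  shows "f dvd H"
proof (rule ccontr)
  assume "\<not> f dvd H"
  from finite_common_zeros[OF f(1) this] have "finite {(x, y). eval2 f x y = 0 \<and> eval2 H x y = 0}" .
  moreover have "(\<lambda>t. (xp t, yp t)) ` {t. regular t} \<subseteq> {(x, y). eval2 f x y = 0 \<and> eval2 H x y = 0}"
    using f H by (auto simp: vanishes_def)
  ultimately show False using infinite_image finite_subset by blast
qed

lemma dvd_vanishes: "vanishes f \<Longrightarrow> f dvd H \<Longrightarrow> vanishes H"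
  by (auto simp: vanishes_def eval2_mult elim!: dvdE)

lemma irreducible_zero_set:
  assumes f: "Factorial_Ring.irreducible f" "vanishes f"
  shows "irreducible_set2 (zero_set2 {f})"
  unfolding irreducible_set2_def
proof (intro conjI allI impI)
  have "infinite {t. regular t}"
    using cofinite_def infinite_alg_closed by (metis Collect_neg_eq finite_compl)
  then obtain t where "regular t" using infinite_imp_nonempty by blast
  hence "(xp t, yp t) \<in> zero_set2 {f}" using f by (auto simp: zero_set2_def vanishes_def)
  thus "zero_set2 {f} \<noteq> {}" by blast
next
  fix S T assume eq: "zero_set2 {f} = zero_set2 S \<union> zero_set2 T"
  show "zero_set2 {f} = zero_set2 S \<or> zero_set2 {f} = zero_set2 T"
  proof (rule ccontr)
    assume "\<not> ?thesis"
    then obtain z w where z: "z \<in> zero_set2 {f}" "z \<notin> zero_set2 S"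
      and w: "w \<in> zero_set2 {f}" "w \<notin> zero_set2 T" using eq by blast
    \<comment> \<open>A point of the curve outside a closed set yields an equation of that set which
      does not vanish along the parametrization, since \<open>f\<close> cannot divide it.\<close>
    have ex: "\<exists>s\<in>S. \<not> vanishes s" if z: "z \<in> zero_set2 {f}" "z \<notin> zero_set2 S" for z S
    proof -
      obtain s where s: "s \<in> S" "eval2 s (fst z) (snd z) \<noteq> 0" using z(2)
        by (auto simp: zero_set2_def case_prod_unfold)
      have "\<not> f dvd s" using z(1) s(2) by (auto simp: zero_set2_def eval2_mult elim!: dvdE)
      thus ?thesis using s(1) irreducible_vanishes_dvd[OF f] by blast
    qed
    obtain s where s: "s \<in> S" "\<not> vanishes s" using ex[OF z] by blast
    obtain u where u: "u \<in> T" "\<not> vanishes u" using ex[OF w] by blast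
    have "vanishes (s * u)" unfolding vanishes_def
    proof (intro allI impI)
      fix t assume "regular t"
      hence "(xp t, yp t) \<in> zero_set2 {f}" using f by (auto simp: zero_set2_def vanishes_def)
      hence "(xp t, yp t) \<in> zero_set2 S \<union> zero_set2 T" using eq by simp
      thus "eval2 (s * u) (xp t) (yp t) = 0" using s u by (auto simp: zero_set2_def eval2_mult)
    qed
    thus False using not_vanishes_mult s u by blast
  qed
qed

lemma zero_set_finite_outside:
  assumes f: "Factorial_Ring.irreducible f" "vanishes f" and H: "\<not> vanishes H"
  shows "finite {z \<in> zero_set2 {f}. eval2 H (fst z) (snd z) = 0}"
proof -
  have "\<not> f dvd H" using dvd_vanishes[OF f(2)] H by blast
  from finite_common_zeros[OF f(1) this] show ?thesis
    by (rule rev_finite_subset) (auto simp: zero_set2_def)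
qed

text \<open>
  \<open>compose N p A B\<close> is \<open>B\<^sup>N p(A / B)\<close>.
\<close>

definition compose :: "nat \<Rightarrow> 'a poly \<Rightarrow> 'a poly poly \<Rightarrow> 'a poly poly \<Rightarrow> 'a poly poly" where
  "compose N p A B = (\<Sum>i\<le>N. [:[:coeff p i:]:] * A ^ i * B ^ (N - i))"

lemma eval2_compose:
  assumes "degree p \<le> N" "eval2 B x y \<noteq> 0"
  shows "eval2 (compose N p A B) x y = eval2 B x y ^ N * poly p (eval2 A x y / eval2 B x y)"
proof -
  have "eval2 (compose N p A B) x y = (\<Sum>i\<le>N. coeff p i * (eval2 A x y ^ i * eval2 B x y ^ (N - i)))"
    by (simp only: compose_def eval2_sum eval2_mult eval2_power) (simp add: mult.assoc)
  also have "\<dots> = (\<Sum>i\<le>N. coeff p i * (eval2 B x y ^ N * (eval2 A x y / eval2 B x y) ^ i))"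
    using power_split_divide[OF assms(2)] by (intro sum.cong) auto
  also have "\<dots> = eval2 B x y ^ N * poly p (eval2 A x y / eval2 B x y)"
    unfolding poly_altdef_le[OF assms(1)] by (simp add: sum_distrib_left ac_simps)
  finally show ?thesis .
qed

text \<open>A rational left inverse suffices for birationality: the reverse composite is the
  identity along the image, and the equations expressing this are divisible by \<open>f\<close>, so
  they hold on the whole curve.\<close>

theorem proper_if_inverse:
  assumes f: "Factorial_Ring.irreducible f" "vanishes f" "total_degree f > 0"
    and B: "\<not> vanishes B" and AB: "\<And>t. regular t \<Longrightarrow> eval2 A (xp t) (yp t) = t * eval2 B (xp t) (yp t)"
  shows "rational_curve (zero_set2 {f}) \<and> properly_parametrizes (zero_set2 {f}) p1 q1 p2 q2"
proof -
  let ?C = "zero_set2 {f}"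
  have par: "parametrizes ?C p1 q1 p2 q2" unfolding parametrizes_def
    using q0 nonconst f(2) by (auto simp: rat_point_def zero_set2_def vanishes_def)
  have rat: "rational_curve ?C" unfolding rational_curve_def affine_plane_curve_def
    using f(3) irreducible_zero_set[OF f(1,2)] par by blast
  have "birational_onto ?C p1 q1 p2 q2" unfolding birational_onto_def
  proof (intro exI conjI)
    have "finite {t. regular t \<longrightarrow> eval2 B (xp t) (yp t) = 0}" by (rule not_vanishes_cofinite[OF B])
    thus "\<forall>\<^sub>\<infinity>t. rat_defined q1 q2 t \<and> (case rat_point p1 q1 p2 q2 t of (x, y) \<Rightarrow>
        eval2 B x y \<noteq> 0 \<and> eval2 A x y / eval2 B x y = t)"
      unfolding MOST_iff_cofinite by (rule rev_finite_subset) (auto simp: rat_point_def AB)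
    define N where "N = Max {degree p1, degree q1, degree p2, degree q2}"
    have N: "degree p1 \<le> N" "degree q1 \<le> N" "degree p2 \<le> N" "degree q2 \<le> N" by (auto simp: N_def)
    have cofin: "finite {z \<in> ?C. eval2 B (fst z) (snd z) = 0}"
      by (rule zero_set_finite_outside[OF f(1,2) B])
    \<comment> \<open>Along the parametrization \<open>compose N q A B\<close> equals a power of
      \<open>B\<close> times \<open>q\<close>, and neither vanishes at a suitable parameter
      value.\<close>
    have qv: "\<not> vanishes (compose N q A B)" if q: "degree q \<le> N" "\<And>t. regular t \<Longrightarrow> poly q t \<noteq> 0" for q
    proof
      assume v: "vanishes (compose N q A B)"
      obtain t where t: "regular t" "eval2 B (xp t) (yp t) \<noteq> 0" using B by (auto simp: vanishes_def)
      have "eval2 (compose N q A B) (xp t) (yp t) = eval2 B (xp t) (yp t) ^ N * poly q t"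
        using eval2_compose[OF q(1) t(2), of A] AB[OF t(1)] t(2) by simp
      thus False using v q(2)[OF t(1)] t by (auto simp: vanishes_def)
    qed
    have cq1: "finite {z \<in> ?C. eval2 (compose N q1 A B) (fst z) (snd z) = 0}"
      by (rule zero_set_finite_outside[OF f(1,2) qv[OF N(2)]]) (simp add: rat_defined_def)
    have cq2: "finite {z \<in> ?C. eval2 (compose N q2 A B) (fst z) (snd z) = 0}"
      by (rule zero_set_finite_outside[OF f(1,2) qv[OF N(4)]]) (simp add: rat_defined_def)
    define Z where "Z = {z \<in> ?C. eval2 B (fst z) (snd z) = 0}
      \<union> {z \<in> ?C. eval2 (compose N q1 A B) (fst z) (snd z) = 0}
      \<union> {z \<in> ?C. eval2 (compose N q2 A B) (fst z) (snd z) = 0}"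
    have "finite Z" unfolding Z_def using cofin cq1 cq2 by simp
    moreover have "case z of (x, y) \<Rightarrow>
        eval2 B x y \<noteq> 0 \<and> rat_defined q1 q2 (eval2 A x y / eval2 B x y) \<and>
        rat_point p1 q1 p2 q2 (eval2 A x y / eval2 B x y) = (x, y)" if z: "z \<in> ?C" "z \<notin> Z" for z
    proof -
      obtain x y where xy: "z = (x, y)" by (cases z)
      have b: "eval2 B x y \<noteq> 0" "eval2 (compose N q1 A B) x y \<noteq> 0" "eval2 (compose N q2 A B) x y \<noteq> 0"
        using z by (auto simp: Z_def xy)
      let ?t = "eval2 A x y / eval2 B x y"
      have d: "poly q1 ?t \<noteq> 0" "poly q2 ?t \<noteq> 0"
        using b eval2_compose[OF N(2) b(1), of A] eval2_compose[OF N(4) b(1), of A] by auto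
      have van: "vanishes (compose N p A B - V * compose N q A B)"
        if pq: "degree p \<le> N" "degree q \<le> N"
          "\<And>t. regular t \<Longrightarrow> eval2 V (xp t) (yp t) * poly q t = poly p t" for p q V
      proof -
        let ?D = "compose N p A B - V * compose N q A B"
        \<comment> \<open>\<open>eval2_compose\<close> needs \<open>B\<close> nonzero at the point;
          multiplying by \<open>B\<close> covers its zeros, and \<open>B\<close> is cancelled again
          by primality.\<close>
        have "vanishes (B * ?D)" unfolding vanishes_def
        proof (intro allI impI)
          fix t assume t: "regular t"
          show "eval2 (B * ?D) (xp t) (yp t) = 0"
          proof (cases "eval2 B (xp t) (yp t) = 0")
            case False
            thus ?thesis using eval2_compose[OF pq(1) False, of A] eval2_compose[OF pq(2) False, of A]
                pq(3)[OF t] AB[OF t] by (simp add: eval2_mult eval2_diff algebra_simps flip: pq(3)[OF t])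
          qed (simp add: eval2_mult)
        qed
        thus ?thesis using not_vanishes_mult[OF B] by blast
      qed
      \<comment> \<open>\<open>[:[:0, 1:]:]\<close> and \<open>[:0, 1:]\<close> are the coordinates
        \<open>x\<close> and \<open>y\<close>: these are the equations \<open>x = p1 / q1\<close>
        and \<open>y = p2 / q2\<close> at the parameter \<open>A / B\<close>, cleared of
        denominators.\<close>
      have "f dvd compose N p1 A B - [:[:0, 1:]:] * compose N q1 A B"
        by (intro irreducible_vanishes_dvd[OF f(1,2)] van N) (auto simp: rat_defined_def)
      moreover have "f dvd compose N p2 A B - [:0, 1:] * compose N q2 A B"
        by (intro irreducible_vanishes_dvd[OF f(1,2)] van N) (auto simp: rat_defined_def eval2_pCons)
      moreover have "eval2 h x y = 0" if "f dvd h" for h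
        using that z(1) xy by (auto simp: zero_set2_def eval2_mult elim!: dvdE)
      ultimately have "eval2 (compose N p1 A B - [:[:0, 1:]:] * compose N q1 A B) x y = 0"
        "eval2 (compose N p2 A B - [:0, 1:] * compose N q2 A B) x y = 0" by blast+
      hence "eval2 (compose N p1 A B) x y = x * eval2 (compose N q1 A B) x y"
        "eval2 (compose N p2 A B) x y = y * eval2 (compose N q2 A B) x y"
        by (auto simp only: eval2_diff eval2_mult) (auto simp: eval2_pCons)
      hence "poly p1 ?t = x * poly q1 ?t" "poly p2 ?t = y * poly q2 ?t"
        using b(1) by (simp_all add: eval2_compose N)
      thus ?thesis using d b(1) by (simp add: xy rat_defined_def rat_point_def)
    qed
    ultimately show "\<forall>\<^sub>\<infinity>z. z \<in> ?C \<longrightarrow> (case z of (x, y) \<Rightarrow>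
        eval2 B x y \<noteq> 0 \<and> rat_defined q1 q2 (eval2 A x y / eval2 B x y) \<and>
        rat_point p1 q1 p2 q2 (eval2 A x y / eval2 B x y) = (x, y))"
      unfolding MOST_iff_cofinite by (elim rev_finite_subset) blast
  qed
  thus ?thesis using rat par by (simp add: properly_parametrizes_def)
qed

end

section \<open>Degree bounds\<close>

text \<open>The Euclidean argument never leaves the subfield \<open>Q\<close>, so the monic gcd in
  the large field has its coefficients in \<open>Q\<close>. This is the invariance of gcds under
  field extensions.\<close>

lemma bezout_over:
  fixes a b :: "'a::field poly"
  assumes Q: "subring_set Q" "\<And>x. x \<in> Q \<Longrightarrow> inverse x \<in> Q"
    and ab: "a \<in> polys_over Q" "b \<in> polys_over Q" "a \<noteq> 0"
  shows "\<exists>d\<in>polys_over Q. lead_coeff d = 1 \<and> (\<exists>u v. d = u * a + v * b) \<and> d dvd a \<and> d dvd b"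
proof -
  note S = subring_polys_over[OF Q(1)]
  define J where "J = {h. h \<noteq> 0 \<and> (\<exists>u\<in>polys_over Q. \<exists>v\<in>polys_over Q. h = u * a + v * b)}"
  have "a = 1 * a + 0 * b" by simp
  hence "a \<in> J" using ab subring_setD(1,2)[OF S] unfolding J_def by blast
  then obtain e where e: "e \<in> J" "\<And>h. h \<in> J \<Longrightarrow> degree e \<le> degree h"
    using ex_has_least_nat[of "\<lambda>h. h \<in> J" a degree] by blast
  then obtain u0 v0 where uv0: "u0 \<in> polys_over Q" "v0 \<in> polys_over Q" "e = u0 * a + v0 * b" "e \<noteq> 0"
    by (auto simp: J_def)
  define i where "i = inverse (lead_coeff e)"
  have eQ: "e \<in> polys_over Q" unfolding uv0(3) by (intro subring_setD[OF S] uv0 ab)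
  have i: "i \<in> Q" "i \<noteq> 0" unfolding i_def using Q(2) eQ uv0(4) by (auto simp: coeff_polys_over)
  define d where "d = smult i e"
  define u where "u = smult i u0"
  define v where "v = smult i v0"
  have uv: "u \<in> polys_over Q" "v \<in> polys_over Q" "d = u * a + v * b"
    unfolding u_def v_def d_def uv0(3) using i uv0 smult_polys_over[OF Q(1)] by (auto simp: smult_add_right)
  have d: "d \<in> polys_over Q" "lead_coeff d = 1" "degree d = degree e" "d \<noteq> 0"
    unfolding d_def using i uv0 eQ smult_polys_over[OF Q(1)] by (auto simp: i_def)
  have dvd: "d dvd h" if h: "h \<in> polys_over Q" "s \<in> polys_over Q" "t \<in> polys_over Q" "h = s * a + t * b" for h s t
  proof -
    obtain n q r where *: "q \<in> polys_over Q" "r \<in> polys_over Q"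
      "smult (lead_coeff d ^ n) h = q * d + r" "r = 0 \<or> degree r < degree d"
      using pseudo_division_over[OF Q(1) d(1,4) h(1)] by blast
    have "r = h - q * d" using * d(2) by simp
    also have "\<dots> = (s - q * u) * a + (t - q * v) * b" unfolding h(4) uv(3) by (simp add: algebra_simps)
    finally have "r = 0 \<or> r \<in> J" unfolding J_def
      using * uv h by (blast intro: subring_setD[OF S])
    hence "r = 0" using e(2)[of r] *(4) d(3) by auto
    hence "h = q * d" using * d(2) by simp
    thus ?thesis by simp
  qed
  have "d dvd a" by (rule dvd[of a 1 0]) (auto simp: ab subring_setD[OF S])
  moreover have "d dvd b" by (rule dvd[of b 0 1]) (auto simp: ab subring_setD[OF S])
  ultimately show ?thesis using d uv by blast
qed

lemma bezout_if_coprime: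
  fixes a b :: "'a::field poly"
  assumes "\<And>d. d dvd a \<Longrightarrow> d dvd b \<Longrightarrow> degree d = 0" "a \<noteq> 0"
  shows "\<exists>u v. u * a + v * b = 1"
proof -
  obtain d u v where d: "lead_coeff d = 1" "d = u * a + v * b" "d dvd a" "d dvd b"
    using bezout_over[of UNIV a b] assms(2) by auto
  have "degree d = 0" by (rule assms(1)[OF d(3,4)])
  hence "d = 1" using d(1) by (auto elim!: degree_eq_zeroE simp: one_pCons)
  thus ?thesis using d(2) by metis
qed

lemma linear_dependence:
  fixes w :: "nat \<Rightarrow> 'a::field poly"
  assumes deg: "\<And>e. e < m \<Longrightarrow> degree (w e) < d" and dm: "d < m"
  shows "\<exists>c. (\<exists>e<m. c e \<noteq> 0) \<and> (\<Sum>e<m. smult (c e) (w e)) = 0"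
proof -
  \<comment> \<open>The polynomials become the columns of a square matrix, padded to
    \<open>m\<close> rows; since all degrees are below \<open>d < m\<close>, the last row is zero
    and the matrix singular.\<close>
  define A where "A = mat m m (\<lambda>(i, e). coeff (w e) i)"
  have A: "A \<in> carrier_mat m m" by (simp add: A_def)
  have "transpose_mat A *\<^sub>v unit_vec m (m - 1) = 0\<^sub>v m"
  proof (rule eq_vecI)
    fix e assume "e < dim_vec (0\<^sub>v m :: 'a vec)"
    hence e: "e < m" by simp
    have "(transpose_mat A *\<^sub>v unit_vec m (m - 1)) $ e = coeff (w e) (m - 1)"
      using e by (simp add: A_def)
    also have "\<dots> = 0" using deg[OF e] dm by (intro coeff_eq_0) linarith
    finally show "(transpose_mat A *\<^sub>v unit_vec m (m - 1)) $ e = 0\<^sub>v m $ e" using e by simp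
  qed (use A in auto)
  moreover have "unit_vec m (m - 1) $ (m - 1) = (1 :: 'a)" using dm by simp
  hence "unit_vec m (m - 1) \<noteq> (0\<^sub>v m :: 'a vec)" using dm by auto
  moreover have "transpose_mat A \<in> carrier_mat m m" using A by simp
  ultimately have "det (transpose_mat A) = 0"
    using det_0_iff_vec_prod_zero_field unit_vec_carrier by blast
  hence "det A = 0" using det_transpose[OF A] by simp
  then obtain v where v: "v \<in> carrier_vec m" "v \<noteq> 0\<^sub>v m" "A *\<^sub>v v = 0\<^sub>v m"
    using det_0_iff_vec_prod_zero_field[OF A] by blast
  have "(\<Sum>e<m. smult (v $ e) (w e)) = 0"
  proof (rule poly_eqI)
    fix i
    show "coeff (\<Sum>e<m. smult (v $ e) (w e)) i = coeff 0 i"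
    proof (cases "i < m")
      case True
      have "(A *\<^sub>v v) $ i = (\<Sum>e = 0..<m. coeff (w e) i * v $ e)"
        using True v(1) by (simp add: A_def scalar_prod_def)
      thus ?thesis using v(3) True by (simp add: coeff_sum mult.commute atLeast0LessThan)
    next
      case False
      hence "coeff (w e) i = 0" if "e < m" for e
        using deg[OF that] dm by (intro coeff_eq_0) linarith
      thus ?thesis by (simp add: coeff_sum)
    qed
  qed
  moreover have "\<exists>e<m. v $ e \<noteq> 0" using v(1,2) by (metis carrier_vecD eq_vecI index_zero_vec)
  ultimately show ?thesis by blast
qed

section \<open>Wronskians in characteristic zero\<close>

lemma pderiv_eq_0_degree:
  fixes p :: "'a::field poly"
  assumes "\<And>n. n > 0 \<Longrightarrow> of_nat n \<noteq> (0 :: 'a)" "pderiv p = 0"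
  shows "degree p = 0"
proof (rule ccontr)
  assume d: "degree p \<noteq> 0"
  have "coeff (pderiv p) (degree p - 1) = of_nat (degree p) * lead_coeff p"
    using d by (simp add: coeff_pderiv)
  thus False using assms d by auto
qed

text \<open>The numerator of the derivative of \<open>p / q\<close>.\<close>

definition wronskian :: "'a::idom poly \<Rightarrow> 'a poly \<Rightarrow> 'a poly" where
  "wronskian p q = pderiv p * q - p * pderiv q"

text \<open>Coprimality turns a vanishing Wronskian into \<open>q dvd pderiv q\<close>, which in
  characteristic zero makes \<open>q\<close> constant; then \<open>p\<close> is constant too,
  against the degree assumption.\<close>

lemma wronskian_nonzero:
  fixes p q :: "'a::field poly"
  assumes char0: "\<And>n. n > 0 \<Longrightarrow> of_nat n \<noteq> (0 :: 'a)"
    and bez: "u * p + v * q = 1" and deg: "max (degree p) (degree q) > 0"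
  shows "wronskian p q \<noteq> 0"
proof
  assume "wronskian p q = 0"
  hence eq: "pderiv p * q = p * pderiv q" by (simp add: wronskian_def)
  have "pderiv q = (u * p + v * q) * pderiv q" by (simp add: bez)
  also have "\<dots> = u * (p * pderiv q) + v * q * pderiv q" by (simp add: algebra_simps)
  also have "\<dots> = q * (u * pderiv p + v * pderiv q)" unfolding eq[symmetric] by (simp add: algebra_simps)
  finally have "q dvd pderiv q" by (rule dvdI)
  have q: "degree q = 0"
  proof (rule ccontr)
    assume d: "degree q \<noteq> 0"
    hence "pderiv q \<noteq> 0" by (rule contrapos_nn) (rule pderiv_eq_0_degree[OF char0])
    hence "degree q \<le> degree (pderiv q)" using \<open>q dvd pderiv q\<close> by (intro dvd_imp_degree_le)
    thus False using degree_pderiv_le[of q] d by linarith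
  qed
  hence "pderiv q = 0" by (auto elim!: degree_eq_zeroE simp: pderiv_pCons)
  hence "pderiv p * q = 0" using eq by simp
  have "degree p \<noteq> 0" using deg q by simp
  hence "pderiv p \<noteq> 0" by (rule contrapos_nn) (rule pderiv_eq_0_degree[OF char0])
  hence "q = 0" using \<open>pderiv p * q = 0\<close> by simp
  hence "u * p = 1" using bez by simp
  hence "1 = p * u" by (simp add: mult.commute)
  hence "p dvd 1" by (rule dvdI)
  hence "degree p = 0" by (simp add: is_unit_iff_degree)
  thus False using deg q by simp
qed

context rational_pair
begin

text \<open>A dimension count: with degree at most \<open>N\<close> in \<open>x\<close> and
  \<open>n1\<close> in \<open>y\<close>, for large \<open>N\<close>, there are more monomials than
  coefficients in their pullbacks. So a nonzero combination vanishes along the parametrization, and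
  \<open>f\<close> divides it.\<close>

lemma irreducible_degree_le:
  assumes f: "Factorial_Ring.irreducible f" "vanishes f"
  shows "degree f \<le> max (degree p1) (degree q1)"
proof -
  define n1 where "n1 = max (degree p1) (degree q1)"
  define n2 where "n2 = max (degree p2) (degree q2)"
  \<comment> \<open>Index \<open>e\<close> stands for the monomial
    \<open>x ^ (e div K) * y ^ (e mod K)\<close>, so \<open>m\<close> counts monomials, and
    \<open>d\<close> is the dimension of a space containing their pullbacks. The condition
    \<open>d < m\<close> amounts to \<open>n1 * n2 < N + n1\<close>, which this \<open>N\<close>
    satisfies.\<close>
  define N where "N = n1 * n2 + 1"
  define K where "K = n1 + 1"
  define m where "m = (N + 1) * K"
  define d where "d = N * n1 + n1 * n2 + 1"
  define w where "w = (\<lambda>e. p1 ^ (e div K) * q1 ^ (N - e div K) * (p2 ^ (e mod K) * q2 ^ (n1 - e mod K)))"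
  have K0: "K > 0" by (simp add: K_def)
  have e: "e div K \<le> N" "e mod K \<le> n1" if "e < m" for e
  proof -
    have "e div K < N + 1" using that K0 by (simp add: m_def less_mult_imp_div_less)
    thus "e div K \<le> N" by simp
    have "e mod K < K" using K0 by simp
    thus "e mod K \<le> n1" by (simp add: K_def)
  qed
  have pw: "degree (p ^ i * q ^ (n - i)) \<le> n * max (degree p) (degree q)" if "i \<le> n"
    for p q :: "'a poly" and i n
  proof -
    have "degree (p ^ i * q ^ (n - i)) \<le> degree (p ^ i) + degree (q ^ (n - i))" by (rule degree_mult_le)
    also have "\<dots> \<le> degree p * i + degree q * (n - i)" by (intro add_mono degree_power_le)
    also have "\<dots> \<le> max (degree p) (degree q) * i + max (degree p) (degree q) * (n - i)"
      by (intro add_mono mult_right_mono) auto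
    also have "\<dots> = n * max (degree p) (degree q)" using that
      by (metis add_mult_distrib2 le_add_diff_inverse mult.commute)
    finally show ?thesis .
  qed
  have "degree (w e) < d" if "e < m" for e
  proof -
    have "degree (w e) \<le> degree (p1 ^ (e div K) * q1 ^ (N - e div K)) +
        degree (p2 ^ (e mod K) * q2 ^ (n1 - e mod K))"
      unfolding w_def by (rule degree_mult_le)
    also have "\<dots> \<le> N * n1 + n1 * n2"
      using pw[OF e(1)[OF that], of p1 q1] pw[OF e(2)[OF that], of p2 q2]
      unfolding n1_def[symmetric] n2_def[symmetric] by (rule add_mono)
    finally have "degree (w e) \<le> N * n1 + n1 * n2" .
    thus ?thesis by (simp add: d_def)
  qed
  moreover have "d < m" by (simp add: d_def m_def K_def N_def)
  ultimately obtain c where c: "\<exists>e<m. c e \<noteq> 0" "(\<Sum>e<m. smult (c e) (w e)) = 0"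
    using linear_dependence[of m w d] by blast
  define H where "H = (\<Sum>e<m. monom (monom (c e) (e div K)) (e mod K))"
  obtain e0 where e0: "e0 < m" "c e0 \<noteq> 0" using c by blast
  have "coeff (coeff H (e0 mod K)) (e0 div K) = (\<Sum>e<m. if e = e0 then c e else 0)"
    unfolding H_def coeff_sum
    by (intro sum.cong) (auto, metis div_mult_mod_eq)
  hence "H \<noteq> 0" using e0 by auto
  have "degree H \<le> n1" unfolding H_def
    by (intro degree_sum_le order.trans[OF degree_monom_le] e(2)) auto
  have "vanishes H" unfolding vanishes_def
  proof (intro allI impI)
    fix t assume "regular t"
    hence t: "poly q1 t \<noteq> 0" "poly q2 t \<noteq> 0" by (auto simp: rat_defined_def)
    have "eval2 (monom (monom a i) j) x y = a * x ^ i * y ^ j" for a x y :: 'a and i j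
      by (simp add: eval2_def poly_monom)
    hence "eval2 H (xp t) (yp t) = (\<Sum>e<m. c e * xp t ^ (e div K) * yp t ^ (e mod K))"
      by (simp add: H_def eval2_sum)
    hence "poly q1 t ^ N * poly q2 t ^ n1 * eval2 H (xp t) (yp t) =
        (\<Sum>e<m. c e * (poly q1 t ^ N * xp t ^ (e div K)) * (poly q2 t ^ n1 * yp t ^ (e mod K)))"
      by (simp add: sum_distrib_left ac_simps)
    also have "\<dots> = (\<Sum>e<m. poly (smult (c e) (w e)) t)"
      using e by (intro sum.cong)
        (auto simp: w_def power_split_divide[OF t(1), symmetric] power_split_divide[OF t(2), symmetric])
    also have "\<dots> = 0" using c(2) by (metis poly_0 poly_sum)
    finally show "eval2 H (xp t) (yp t) = 0" using t by simp
  qed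
  hence "f dvd H" by (rule irreducible_vanishes_dvd[OF f])
  hence "degree f \<le> degree H" using \<open>H \<noteq> 0\<close> by (intro dvd_imp_degree_le)
  thus ?thesis using \<open>degree H \<le> n1\<close> by (simp add: n1_def)
qed

definition "generically_injective \<longleftrightarrow> (\<exists>B. finite B \<and>
  (\<forall>s t. s \<notin> B \<longrightarrow> t \<notin> B \<longrightarrow> regular s \<longrightarrow> regular t \<longrightarrow> xp s = xp t \<longrightarrow> yp s = yp t \<longrightarrow> s = t))"

text \<open>Over a generic \<open>x0\<close> the equation \<open>xp t = x0\<close> has exactly
  \<open>n1\<close> simple solutions; injectivity gives them distinct values of \<open>yp\<close>,
  all of them roots of \<open>H\<close> at \<open>x = x0\<close>.\<close>

lemma vanishes_degree_ge:
  assumes char0: "\<And>n. n > 0 \<Longrightarrow> of_nat n \<noteq> (0 :: 'a)"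
    and bez: "u * p1 + v * q1 = 1" and deg: "max (degree p1) (degree q1) > 0"
    and inj: "generically_injective" and H: "H \<noteq> 0" "vanishes H"
  shows "max (degree p1) (degree q1) \<le> degree H"
proof -
  define n1 where "n1 = max (degree p1) (degree q1)"
  obtain B where B: "finite B" "\<And>s t. s \<notin> B \<Longrightarrow> t \<notin> B \<Longrightarrow> regular s \<Longrightarrow> regular t \<Longrightarrow>
      xp s = xp t \<Longrightarrow> yp s = yp t \<Longrightarrow> s = t" using inj by (auto simp: generically_injective_def)
  define B' where "B' = B \<union> {t. \<not> regular t} \<union> {t. poly (wronskian p1 q1) t = 0}"
  have fB': "finite B'" unfolding B'_def
    using B(1) cofinite_def poly_roots_finite[OF wronskian_nonzero[OF char0 bez deg]] by auto
  obtain j where j: "coeff H j \<noteq> 0" using H(1) by (metis coeff_0 poly_eqI)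
  \<comment> \<open>Three kinds of \<open>x0\<close> are excluded: images of exceptional parameters,
    the value at which the leading coefficient of \<open>r\<close> cancels (if
    \<open>coeff q1 n1\<close> is zero, the quotient is 0 by convention and just excludes one more
    point), and those where \<open>H\<close> could become the zero polynomial in
    \<open>y\<close>.\<close>
  define Z where "Z = xp ` B' \<union> {coeff p1 n1 / coeff q1 n1} \<union> {x. poly (coeff H j) x = 0}"
  have "finite Z" unfolding Z_def using fB' poly_roots_finite[OF j] by simp
  from ex_new_if_finite[OF infinite_alg_closed this] obtain x0 where "x0 \<notin> Z" ..
  hence x0: "x0 \<notin> xp ` B'" "x0 \<noteq> coeff p1 n1 / coeff q1 n1" "poly (coeff H j) x0 \<noteq> 0"
    unfolding Z_def by simp_all
  define r where "r = p1 - smult x0 q1"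
  have "coeff r n1 \<noteq> 0"
  proof (cases "coeff q1 n1 = 0")
    case True
    hence "coeff p1 n1 \<noteq> 0" using deg unfolding n1_def
      by (metis leading_coeff_0_iff max_def degree_0 less_irrefl)
    thus ?thesis using True by (simp add: r_def)
  next
    case False
    thus ?thesis using x0(2) by (auto simp: r_def field_simps)
  qed
  moreover have "degree r \<le> n1" unfolding r_def n1_def
    by (intro degree_diff_le order.trans[OF degree_smult_le]) auto
  ultimately have dr: "degree r = n1" "r \<noteq> 0" using le_degree[of r n1] by auto
  have root: "t \<notin> B' \<and> regular t \<and> xp t = x0" if t: "poly r t = 0" for t
  proof -
    have eq: "poly p1 t = x0 * poly q1 t" using t by (simp add: r_def)
    have q: "poly q1 t \<noteq> 0"
    proof
      assume "poly q1 t = 0"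
      thus False using arg_cong[OF bez, of "\<lambda>p. poly p t"] eq by simp
    qed
    hence x: "xp t = x0" using eq by simp
    hence "t \<notin> B'" using x0(1) by blast
    thus ?thesis using x by (auto simp: B'_def)
  qed
  have card: "card {t. poly r t = 0} = n1"
  proof -
    \<comment> \<open>The Wronskian equals \<open>q1 * pderiv r - pderiv q1 * r\<close>, so a double
      root of \<open>r\<close> would be one of its zeros, and these were excluded.\<close>
    have "poly (pderiv r) t \<noteq> 0" if t: "poly r t = 0" for t
    proof
      assume 0: "poly (pderiv r) t = 0"
      have q: "poly q1 t \<noteq> 0" using root[OF t] by (auto simp: rat_defined_def)
      have "poly (wronskian p1 q1) t = poly q1 t * poly (pderiv r) t - poly (pderiv q1) t * poly r t"
        by (simp add: wronskian_def r_def pderiv_diff pderiv_smult algebra_simps)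
      hence "poly (wronskian p1 q1) t = 0" using 0 t by simp
      thus False using root[OF t] by (auto simp: B'_def)
    qed
    from card_roots_separable[OF dr(2) this] dr(1) show ?thesis by simp
  qed
  define h where "h = map_poly (\<lambda>c. poly c x0) H"
  have "coeff h j \<noteq> 0" using x0(3) by (simp add: h_def coeff_map_poly)
  hence h0: "h \<noteq> 0" by auto
  have "inj_on yp {t. poly r t = 0}"
  proof (rule inj_onI)
    fix s t assume "s \<in> {t. poly r t = 0}" "t \<in> {t. poly r t = 0}" and y: "yp s = yp t"
    hence "s \<notin> B'" "t \<notin> B'" "regular s" "regular t" "xp s = xp t" using root by auto
    thus "s = t" using B(2)[of s t] y by (simp add: B'_def)
  qed
  hence "n1 = card (yp ` {t. poly r t = 0})" using card by (simp add: card_image)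
  also have "yp ` {t. poly r t = 0} \<subseteq> {y. poly h y = 0}"
    using H(2) root by (auto simp: vanishes_def h_def eval2_as_poly)
  hence "card (yp ` {t. poly r t = 0}) \<le> card {y. poly h y = 0}"
    using poly_roots_finite[OF h0] by (intro card_mono)
  also have "\<dots> \<le> degree h" by (rule poly_roots_degree[OF h0])
  also have "\<dots> \<le> degree H" unfolding h_def by (rule degree_map_poly_le)
  finally show ?thesis by (simp add: n1_def)
qed

end

section \<open>Common divisors of the two polynomials \<open>G_poly\<close>\<close>

lemma eval2_map_const: "eval2 (map_poly (\<lambda>c. [:c:]) q) x y = poly q (y :: 'a::comm_ring_1)"
  by (induction q) (auto simp: map_poly_pCons eval2_pCons)

lemma eval2_G_poly: "eval2 (G_poly p q) h t = poly p h * poly q t - poly q h * poly p t"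
  by (simp add: G_poly_def eval2_diff eval2_smult eval2_map_const)

lemma map_poly_G_poly: "map_poly (\<lambda>c. poly c h) (G_poly p q) = smult (poly p h) q - smult (poly q h) p"
  by (rule poly_eqI) (simp add: G_poly_def coeff_map_poly)

context rational_pair
begin

text \<open>
  A root \<open>t\<close> of \<open>w(h, \<cdot>)\<close> has the same image as \<open>h\<close>, so \<open>t = h\<close> for generic \<open>h\<close>; but then
  \<open>h\<close> is a double root of \<open>G\<^sub>1(h, \<cdot>)\<close>, and the Wronskian vanishes at \<open>h\<close>.
\<close>

lemma common_divisor_G_poly:
  assumes char0: "\<And>n. n > 0 \<Longrightarrow> of_nat n \<noteq> (0 :: 'a)"
    and bez1: "u1 * p1 + v1 * q1 = 1" and deg1: "max (degree p1) (degree q1) > 0"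
    and bez2: "u2 * p2 + v2 * q2 = 1"
    and inj: "generically_injective"
    and w: "[:-[:0, 1:], 1:] * w dvd G_poly p1 q1" "[:-[:0, 1:], 1:] * w dvd G_poly p2 q2"
    and w0: "w \<noteq> 0"
  shows "degree w = 0"
proof (rule ccontr)
  assume dw: "degree w \<noteq> 0"
  obtain B where B: "finite B" "\<And>s t. s \<notin> B \<Longrightarrow> t \<notin> B \<Longrightarrow> regular s \<Longrightarrow> regular t \<Longrightarrow>
      xp s = xp t \<Longrightarrow> yp s = yp t \<Longrightarrow> s = t" using inj by (auto simp: generically_injective_def)
  \<comment> \<open>For fixed \<open>t0\<close> with \<open>q1\<close> nonzero there, the regular
    roots \<open>h\<close> of \<open>r t0\<close> have the same first coordinate as
    \<open>t0\<close>; avoiding them for the finitely many such \<open>t0\<close> in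
    \<open>B\<close> keeps the partner \<open>t\<close> of a generic \<open>h\<close> out of
    \<open>B\<close>.\<close>
  define r where "r = (\<lambda>t0. smult (poly q1 t0) p1 - smult (poly p1 t0) q1)"
  have r0: "r t0 \<noteq> 0" if "poly q1 t0 \<noteq> 0" for t0
  proof
    assume 0: "r t0 = 0"
    hence "smult (poly q1 t0) p1 = smult (poly p1 t0) q1" by (simp add: r_def)
    hence "smult (inverse (poly q1 t0)) (smult (poly q1 t0) p1) = smult (inverse (poly q1 t0) * poly p1 t0) q1"
      by simp
    hence p1: "p1 = smult (inverse (poly q1 t0) * poly p1 t0) q1" using that by simp
    have "(u1 * [:inverse (poly q1 t0) * poly p1 t0:] + v1) * q1 = 1"
      using bez1 by (subst (asm) p1) (simp add: algebra_simps)
    hence "q1 dvd 1" by (metis dvd_triv_right)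
    hence "degree q1 = 0" by (simp add: is_unit_iff_degree)
    moreover have "degree p1 \<le> degree q1" by (subst p1) (rule degree_smult_le)
    ultimately show False using deg1 by simp
  qed
  define bad where "bad = B \<union> {t. \<not> regular t} \<union> {t. poly (wronskian p1 q1) t = 0}
    \<union> {h. poly (lead_coeff w) h = 0} \<union> (\<Union>t0\<in>{t0\<in>B. poly q1 t0 \<noteq> 0}. {h. poly (r t0) h = 0})"
  have "finite bad" unfolding bad_def
    using B(1) cofinite_def poly_roots_finite[OF wronskian_nonzero[OF char0 bez1 deg1]]
      poly_roots_finite[of "lead_coeff w"] w0 r0 poly_roots_finite by auto
  from ex_new_if_finite[OF infinite_alg_closed this] obtain h where h: "h \<notin> bad" ..
  interpret e: comm_ring_hom "\<lambda>c :: 'a poly. poly c h" by (rule poly_hom)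
  interpret ep: map_poly_comm_ring_hom "\<lambda>c :: 'a poly. poly c h" ..
  define wh where "wh = map_poly (\<lambda>c. poly c h) w"
  have "degree wh = degree w" unfolding wh_def using h w0
    by (intro degree_map_poly) (auto simp: bad_def)
  then obtain t where t: "poly wh t = 0" using alg_closed_imp_poly_has_root[of wh] dw by auto
  have wt: "eval2 w h t = 0" using t by (simp add: wh_def eval2_as_poly)
  have G: "poly p1 h * poly q1 t = poly q1 h * poly p1 t" "poly p2 h * poly q2 t = poly q2 h * poly p2 t"
  proof -
    have z: "eval2 G h t = 0" if "[:-[:0, 1:], 1:] * w dvd G" for G
      using that wt by (auto simp: eval2_mult elim!: dvdE simp del: mult_pCons_left)
    thus "poly p1 h * poly q1 t = poly q1 h * poly p1 t" "poly p2 h * poly q2 t = poly q2 h * poly p2 t"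
      using z[OF w(1)] z[OF w(2)] by (simp_all add: eval2_G_poly)
  qed
  have hreg: "poly q1 h \<noteq> 0" "poly q2 h \<noteq> 0" "regular h" "h \<notin> B" using h by (auto simp: bad_def rat_defined_def)
  \<comment> \<open>If \<open>q1\<close> vanished at \<open>t\<close>, then by the first relation in
    \<open>G\<close> so would \<open>p1\<close>, contradicting the Bezout identity.\<close>
  have q1t: "poly q1 t \<noteq> 0"
  proof
    assume "poly q1 t = 0"
    thus False using arg_cong[OF bez1, of "\<lambda>p. poly p t"] G(1) hreg by simp
  qed
  have q2t: "poly q2 t \<noteq> 0"
  proof
    assume "poly q2 t = 0"
    thus False using arg_cong[OF bez2, of "\<lambda>p. poly p t"] G(2) hreg by simp
  qed
  have "t \<notin> B"
  proof
    assume "t \<in> B"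
    moreover have "poly (r t) h = 0" using G(1) by (simp add: r_def mult.commute)
    ultimately show False using h q1t by (auto simp: bad_def)
  qed
  moreover have "xp h = xp t" "yp h = yp t" using G hreg q1t q2t by (auto simp: field_simps)
  ultimately have th: "t = h" using B(2)[of h t] hreg q1t q2t by (auto simp: rat_defined_def)
  obtain s where s: "G_poly p1 q1 = [:-[:0, 1:], 1:] * w * s" using w(1) by (rule dvdE)
  \<comment> \<open>This is \<open>G_poly p1 q1\<close> at the fixed \<open>h\<close>. The factor
    \<open>l\<close> and the root \<open>t = h\<close> of \<open>wh\<close> make \<open>h\<close> a
    double root.\<close>
  define g where "g = smult (poly p1 h) q1 - smult (poly q1 h) p1"
  define l where "l = [:-h, 1:]"
  have "map_poly (\<lambda>c. poly c h) [:-[:0, 1:], 1:] = l" by (simp add: l_def map_poly_pCons)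
  hence "g = l * (wh * map_poly (\<lambda>c. poly c h) s)"
    unfolding g_def wh_def map_poly_G_poly[symmetric] s ep.hom_mult by (simp only: mult.assoc)
  moreover have "poly l h = 0" by (simp add: l_def)
  ultimately have "poly (pderiv g) h = 0" using t th by (simp add: pderiv_mult)
  hence "poly (wronskian p1 q1) h = 0"
    by (simp add: g_def wronskian_def pderiv_diff pderiv_smult algebra_simps)
  thus False using h by (auto simp: bad_def)
qed

end

section \<open>Inversion of a parametrization\<close>

lemma coeff_G_poly: "coeff (G_poly p q) i = p * [:coeff q i:] - q * [:coeff p i:]"
  by (simp add: G_poly_def coeff_map_poly)

context rational_pair
begin

text \<open>
  In \<open>k(h)[t]\<close> the polynomials \<open>p\<^sub>i(t) - x\<^sub>i q\<^sub>i(t)\<close>, \<open>x\<^sub>i = p\<^sub>i(h) / q\<^sub>i(h)\<close>, have gcd \<open>t - h\<close>.  Their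
  coefficients lie in the subfield \<open>k(x\<^sub>1, x\<^sub>2)\<close>, hence so do those of the gcd.
\<close>

lemma inverse_if_gcd:
  assumes G: "G_poly p1 q1 = s1 * ([:-[:0, 1:], 1:] * [:w0:])" "G_poly p2 q2 = s2 * ([:-[:0, 1:], 1:] * [:w0:])"
    and w0: "w0 \<noteq> 0" and s1: "s1 \<noteq> 0" and res: "resultant s1 s2 \<noteq> 0"
  shows "\<exists>A B. \<not> vanishes B \<and> (\<forall>t. regular t \<longrightarrow> eval2 A (xp t) (yp t) = t * eval2 B (xp t) (yp t))"
proof -
  interpret \<theta>: inj_idom_hom "to_fract :: 'a poly \<Rightarrow> 'a poly fract" by unfold_locales auto
  interpret \<theta>p: map_poly_inj_idom_hom "to_fract :: 'a poly \<Rightarrow> 'a poly fract" ..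
  define \<theta> :: "'a poly \<Rightarrow> 'a poly fract" where "\<theta> = to_fract"
  define cst where "cst = (\<lambda>c. \<theta> [:c:])"
  have cst: "comm_ring_hom cst" unfolding cst_def \<theta>_def
    by unfold_locales (auto simp: one_pCons[symmetric] simp flip: to_fract_add to_fract_mult)
  interpret cst: comm_ring_hom cst by (rule cst)
  interpret cp: map_poly_comm_ring_hom cst ..
  interpret cpp: map_poly_comm_ring_hom "map_poly cst" ..
  define x where "x = \<theta> p1 / \<theta> q1"
  define y where "y = \<theta> p2 / \<theta> q2"
  define \<tau> where "\<tau> = \<theta> [:0, 1:]"
  have q: "\<theta> q1 \<noteq> 0" "\<theta> q2 \<noteq> 0" using q0 by (auto simp: \<theta>_def)
  \<comment> \<open>Substitution of the two coordinate functions for \<open>x\<close> and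
    \<open>y\<close>; the quotients of its values form the subfield \<open>Q\<close> generated by
    them over the constants.\<close>
  define ev where "ev = (\<lambda>H. eval2 (map_poly (map_poly cst) H) x y)"
  interpret ev: comm_ring_hom ev unfolding ev_def
    by unfold_locales (auto simp: cpp.hom_add cpp.hom_mult eval2_add eval2_mult)
  define Q where "Q = {z. \<exists>A B. ev B \<noteq> 0 \<and> z = ev A / ev B}"
  have evQ: "ev A \<in> Q" for A unfolding Q_def by (intro CollectI exI[of _ A] exI[of _ 1]) simp
  have Q: "subring_set Q" unfolding subring_set_def
  proof (intro conjI ballI)
    show "0 \<in> Q" "1 \<in> Q" using evQ[of 0] evQ[of 1] by simp_all
    fix z w assume "z \<in> Q" "w \<in> Q"
    then obtain A B A' B' where *: "ev B \<noteq> 0" "z = ev A / ev B" "ev B' \<noteq> 0" "w = ev A' / ev B'"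
      by (auto simp: Q_def)
    have "z + w = ev (A * B' + A' * B) / ev (B * B')" using *
      by (simp add: add_frac_eq ev.hom_add ev.hom_mult)
    moreover have "z * w = ev (A * A') / ev (B * B')" using * by (simp add: ev.hom_mult)
    moreover have "ev (B * B') \<noteq> 0" using * by (simp add: ev.hom_mult)
    ultimately show "z + w \<in> Q" "z * w \<in> Q" unfolding Q_def by blast+
    have "- z = ev (- A) / ev B" using * by (simp add: ev.hom_uminus)
    thus "- z \<in> Q" unfolding Q_def using *(1) by blast
  qed
  have Qinv: "inverse z \<in> Q" if z: "z \<in> Q" for z
  proof -
    obtain A B where *: "ev B \<noteq> 0" "z = ev A / ev B" using z by (auto simp: Q_def)
    show ?thesis
    proof (cases "ev A = 0")
      case True
      thus ?thesis using * subring_setD(1)[OF Q] by simp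
    next
      case False
      have "inverse z = ev B / ev A" using * by simp
      thus ?thesis unfolding Q_def using False by blast
    qed
  qed
  have "ev [:[:c:]:] = cst c" for c by (simp add: ev_def cst.map_poly_pCons_hom cp.map_poly_pCons_hom)
  hence cstQ: "cst c \<in> Q" for c using evQ[of "[:[:c:]:]"] by simp
  have "ev [:[:0, 1:]:] = x" by (simp add: ev_def cst.map_poly_pCons_hom cp.map_poly_pCons_hom)
  hence xQ: "x \<in> Q" using evQ[of "[:[:0, 1:]:]"] by simp
  have "ev [:0, 1:] = y" by (simp add: ev_def cst.map_poly_pCons_hom cp.map_poly_pCons_hom eval2_pCons)
  hence yQ: "y \<in> Q" using evQ[of "[:0, 1:]"] by simp
  have cstp: "map_poly cst p \<in> polys_over Q" for p using cstQ by (simp add: polys_over_def)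
  define M1 where "M1 = map_poly cst p1 - smult x (map_poly cst q1)"
  define M2 where "M2 = map_poly cst p2 - smult y (map_poly cst q2)"
  have M: "M1 \<in> polys_over Q" "M2 \<in> polys_over Q" unfolding M1_def M2_def
    by (intro subring_setD(6)[OF subring_polys_over[OF Q]] cstp smult_polys_over[OF Q] xQ yQ)+
  have GM: "map_poly \<theta> (G_poly p r) = smult (- \<theta> r) (map_poly cst p - smult (\<theta> p / \<theta> r) (map_poly cst r))"
    if "\<theta> r \<noteq> 0" for p r
    using that unfolding \<theta>_def cst_def
    by (intro poly_eqI) (simp add: coeff_G_poly coeff_map_poly algebra_simps del: mult_pCons_right)
  have GM1: "map_poly \<theta> (G_poly p1 q1) = smult (- \<theta> q1) M1" unfolding M1_def x_def by (rule GM[OF q(1)])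
  have GM2: "map_poly \<theta> (G_poly p2 q2) = smult (- \<theta> q2) M2" unfolding M2_def y_def by (rule GM[OF q(2)])
  define L where "L = smult (\<theta> w0) [:-\<tau>, 1:]"
  have L: "map_poly \<theta> ([:-[:0, 1:], 1:] * [:w0:]) = L"
  proof -
    have "[:-[:0, 1:], 1:] * [:w0:] = smult w0 [:-[:0, 1:], 1 :: 'a poly:]" by simp
    thus ?thesis unfolding \<theta>_def L_def \<tau>_def
      by (simp only: \<theta>.map_poly_hom_smult \<theta>.map_poly_pCons_hom \<theta>.hom_uminus \<theta>.hom_one map_poly_0)
  qed
  have sL: "map_poly \<theta> s1 * L = smult (- \<theta> q1) M1" "map_poly \<theta> s2 * L = smult (- \<theta> q2) M2"
  proof -
    have "map_poly \<theta> s1 * L = map_poly \<theta> (G_poly p1 q1)" "map_poly \<theta> s2 * L = map_poly \<theta> (G_poly p2 q2)"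
      unfolding G L[symmetric] unfolding \<theta>_def by (simp_all only: \<theta>p.hom_mult)
    thus "map_poly \<theta> s1 * L = smult (- \<theta> q1) M1" "map_poly \<theta> s2 * L = smult (- \<theta> q2) M2"
      by (simp_all only: GM1 GM2)
  qed
  have "map_poly \<theta> s1 \<noteq> 0" using s1 by (simp add: \<theta>_def)
  moreover have "resultant (map_poly \<theta> s1) (map_poly \<theta> s2) \<noteq> 0"
    using res unfolding \<theta>_def \<theta>.resultant_hom by simp
  \<comment> \<open>The cofactors are coprime because their resultant is not zero, so
    \<open>L\<close> is a combination of \<open>M1\<close> and \<open>M2\<close>.\<close>
  ultimately obtain u v where uv: "u * map_poly \<theta> s1 + v * map_poly \<theta> s2 = 1"
    using bezout_if_coprime[of "map_poly \<theta> s1" "map_poly \<theta> s2"] resultant_nonzero_coprime by blast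
  have w0': "\<theta> w0 \<noteq> 0" using w0 by (simp add: \<theta>_def)
  hence "L \<noteq> 0" by (simp add: L_def)
  have "M1 \<noteq> 0"
  proof
    assume "M1 = 0"
    hence "map_poly \<theta> s1 * L = 0" using sL by simp
    thus False using \<open>map_poly \<theta> s1 \<noteq> 0\<close> \<open>L \<noteq> 0\<close> by simp
  qed
  \<comment> \<open>The gcd \<open>d\<close> has coefficients in \<open>Q\<close>. It divides
    \<open>L\<close>, hence the linear polynomial with root \<open>\<tau>\<close>, and it vanishes
    at \<open>\<tau>\<close>; being monic it equals that polynomial, and its constant coefficient
    puts \<open>\<tau>\<close> into \<open>Q\<close>.\<close>
  from bezout_over[OF Q Qinv M this] obtain d a b where
    d: "d \<in> polys_over Q" "lead_coeff d = 1" "d = a * M1 + b * M2" "d dvd M1" "d dvd M2" by blast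
  have "L = (u * map_poly \<theta> s1 + v * map_poly \<theta> s2) * L" by (simp add: uv)
  also have "\<dots> = u * (map_poly \<theta> s1 * L) + v * (map_poly \<theta> s2 * L)" by (simp add: algebra_simps)
  finally have "L = u * smult (- \<theta> q1) M1 + v * smult (- \<theta> q2) M2" by (simp only: sL)
  hence "d dvd L" using d(4,5) by (auto intro!: dvd_add dvd_mult dvd_smult dvd_diff)
  hence dl: "d dvd [:-\<tau>, 1:]" unfolding L_def dvd_smult_iff[OF w0'] .
  have \<theta>poly: "poly (map_poly cst p) \<tau> = \<theta> p" for p
  proof (induction p)
    case (pCons c p)
    have "\<theta> (pCons c p) = \<theta> ([:c:] + [:0, 1:] * p)" by simp
    also have "\<dots> = cst c + \<tau> * \<theta> p" unfolding \<theta>_def cst_def \<tau>_def by (simp only: to_fract_add to_fract_mult)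
    finally show ?case using pCons by (simp add: cst.map_poly_pCons_hom)
  qed (simp add: \<theta>_def)
  have "poly M1 \<tau> = 0" "poly M2 \<tau> = 0" using q by (simp_all add: M1_def M2_def \<theta>poly x_def y_def)
  hence "poly d \<tau> = 0" unfolding d(3) by simp
  then obtain k where k: "d = [:-\<tau>, 1:] * k" using poly_eq_0_iff_dvd by (metis dvdE)
  have "d \<noteq> 0" using d(2) by auto
  hence "k \<noteq> 0" using k by auto
  have "degree d \<le> 1" using dvd_imp_degree_le[OF dl] by simp
  moreover have "degree d = 1 + degree k" unfolding k using \<open>k \<noteq> 0\<close> by (subst degree_mult_eq) auto
  ultimately have "degree k = 0" by simp
  moreover have "lead_coeff k = 1" using d(2) unfolding k lead_coeff_mult by simp
  ultimately have "k = 1" by (auto elim!: degree_eq_zeroE simp: one_pCons)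
  hence "coeff d 0 = - \<tau>" using k by simp
  hence "- \<tau> \<in> Q" using d(1) by (metis coeff_polys_over)
  hence "\<tau> \<in> Q" using subring_setD(5)[OF Q] by force
  then obtain A B where AB: "ev B \<noteq> 0" "\<tau> = ev A / ev B" by (auto simp: Q_def)
  \<comment> \<open>One pair of exponents serves \<open>A\<close> and \<open>B\<close>, so that the
    same product of powers of \<open>q1\<close> and \<open>q2\<close> can be cancelled from both
    pullbacks.\<close>
  define N where "N = max (degree (swap_poly A)) (degree (swap_poly B))"
  define M where "M = max (degree A) (degree B)"
  have NM: "degree (swap_poly A) \<le> N" "degree (swap_poly B) \<le> N" "degree A \<le> M" "degree B \<le> M"
    by (auto simp: N_def M_def)
  have hom: "comm_ring_hom \<theta>" unfolding \<theta>_def ..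
  let ?pb = "\<lambda>H. pullback N M H p1 q1 p2 q2"
  have pA: "\<theta> (?pb A) = \<theta> q1 ^ N * \<theta> q2 ^ M * ev A"
    using hom_pullback[OF hom q NM(1,3)] unfolding ev_def cst_def x_def y_def .
  have pB: "\<theta> (?pb B) = \<theta> q1 ^ N * \<theta> q2 ^ M * ev B"
    using hom_pullback[OF hom q NM(2,4)] unfolding ev_def cst_def x_def y_def .
  have "?pb B \<noteq> 0" using pB AB(1) q by (auto simp: \<theta>_def)
  hence nv: "\<not> vanishes B" using vanishes_iff_pullback[OF NM(2,4)] by simp
  have "ev A = \<tau> * ev B" using AB by simp
  hence "\<theta> (?pb A) = \<theta> ([:0, 1:] * ?pb B)" unfolding \<theta>_def to_fract_mult
    unfolding \<theta>_def[symmetric] pA pB by (simp add: \<tau>_def ac_simps)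
  hence eq: "?pb A = [:0, 1:] * ?pb B" unfolding \<theta>_def by (simp only: to_fract_eq_iff)
  have "eval2 A (xp t) (yp t) = t * eval2 B (xp t) (yp t)" if "regular t" for t
  proof -
    have t: "poly q1 t \<noteq> 0" "poly q2 t \<noteq> 0" using that by (auto simp: rat_defined_def)
    have "poly (?pb A) t = t * poly (?pb B) t" unfolding eq by simp
    thus ?thesis using t unfolding poly_pullback[OF t NM(1,3)] poly_pullback[OF t NM(2,4)] by simp
  qed
  thus ?thesis using nv by blast
qed

lemma generically_injective_if_inverse:
  assumes B: "\<not> vanishes B" and AB: "\<And>t. regular t \<Longrightarrow> eval2 A (xp t) (yp t) = t * eval2 B (xp t) (yp t)"
  shows generically_injective
  unfolding generically_injective_def
proof (intro exI conjI allI impI)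
  show "finite {t. regular t \<longrightarrow> eval2 B (xp t) (yp t) = 0}" by (rule not_vanishes_cofinite[OF B])
  fix s t assume st: "s \<notin> {t. regular t \<longrightarrow> eval2 B (xp t) (yp t) = 0}" "regular s" "regular t"
    "xp s = xp t" "yp s = yp t"
  have "s * eval2 B (xp t) (yp t) = t * eval2 B (xp t) (yp t)"
    by (rule trans[OF sym[OF AB[OF st(2), unfolded st(4,5)]] AB[OF st(3)]])
  moreover have "eval2 B (xp t) (yp t) \<noteq> 0" using st by auto
  ultimately show "s = t" by (metis mult_right_cancel)
qed

lemma generically_injective_if_birational:
  assumes "birational_onto C p1 q1 p2 q2"
  shows generically_injective
proof -
  obtain A B where "\<forall>\<^sub>\<infinity>t. rat_defined q1 q2 t \<and> (case rat_point p1 q1 p2 q2 t of (x, y) \<Rightarrow>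
      eval2 B x y \<noteq> 0 \<and> eval2 A x y / eval2 B x y = t)"
    using assms unfolding birational_onto_def by blast
  hence "finite {t. \<not> (regular t \<and> eval2 B (xp t) (yp t) \<noteq> 0 \<and> eval2 A (xp t) (yp t) / eval2 B (xp t) (yp t) = t)}"
    by (simp add: MOST_iff_cofinite rat_point_def)
  moreover have "s = t" if "s \<notin> {t. \<not> (regular t \<and> eval2 B (xp t) (yp t) \<noteq> 0 \<and> eval2 A (xp t) (yp t) / eval2 B (xp t) (yp t) = t)}"
    "t \<notin> {t. \<not> (regular t \<and> eval2 B (xp t) (yp t) \<noteq> 0 \<and> eval2 A (xp t) (yp t) / eval2 B (xp t) (yp t) = t)}"
    "xp s = xp t" "yp s = yp t" for s t
    using that by force
  ultimately show ?thesis unfolding generically_injective_def by blast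
qed

lemma swap_rational_pair: "rational_pair p2 q2 p1 q1"
  using q0 nonconst by unfold_locales auto

lemma vanishes_swap: "rational_pair.vanishes p2 q2 p1 q1 (swap_poly H) \<longleftrightarrow> vanishes H"
  unfolding vanishes_def rational_pair.vanishes_def[OF swap_rational_pair]
  by (auto simp: rat_defined_def)

lemma generically_injective_swap:
  "generically_injective \<Longrightarrow> rational_pair.generically_injective p2 q2 p1 q1"
  unfolding generically_injective_def rational_pair.generically_injective_def[OF swap_rational_pair]
    rat_defined_def by blast

end

section \<open>Irreducibility from partial degrees\<close>

lemma const_if_degrees_0:
  fixes b :: "'a::field poly poly"
  assumes "degree b = 0" "degree (swap_poly b) = 0" "b \<noteq> 0"
  shows "b dvd 1"
proof -
  obtain c where c: "b = [:c:]" using assms(1) by (auto elim: degree_eq_zeroE)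
  have "degree c = 0" using degree_coeff_le_swap[of b 0] assms(2) by (simp add: c)
  thus ?thesis using assms(3) by (simp add: c is_unit_const_poly_iff is_unit_iff_degree)
qed

lemma degree_swap_mult:
  fixes f g :: "'a::idom poly poly"
  assumes "f \<noteq> 0" "g \<noteq> 0"
  shows "degree (swap_poly (f * g)) = degree (swap_poly f) + degree (swap_poly g)"
  using assms swap_poly_eq_iff[of f 0] swap_poly_eq_iff[of g 0]
  by (simp add: swap.hom_mult degree_mult_eq)

context rational_pair
begin

text \<open>Minimize the sum of the partial degrees among the nonzero vanishing polynomials: in a
  factorization one factor vanishes by primality, and the other then has both degrees zero.\<close>

lemma irreducible_vanishing_exists:
  assumes "F \<noteq> 0" "vanishes F"
  shows "\<exists>f. Factorial_Ring.irreducible f \<and> vanishes f"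
proof -
  define \<mu> where "\<mu> = (\<lambda>f :: 'a poly poly. degree f + degree (swap_poly f))"
  obtain f where f: "f \<noteq> 0" "vanishes f" "\<And>g. g \<noteq> 0 \<Longrightarrow> vanishes g \<Longrightarrow> \<mu> f \<le> \<mu> g"
    using ex_has_least_nat[of "\<lambda>f. f \<noteq> 0 \<and> vanishes f" F \<mu>] assms by blast
  have unit: "b dvd 1" if ab: "f = a * b" "vanishes a" for a b
  proof -
    have nz: "a \<noteq> 0" "b \<noteq> 0" using ab f(1) by auto
    have "\<mu> f = \<mu> a + \<mu> b" unfolding \<mu>_def ab using nz by (simp add: degree_mult_eq degree_swap_mult)
    moreover have "\<mu> f \<le> \<mu> a" using f(3) nz ab by blast
    ultimately have "\<mu> b = 0" by simp
    thus ?thesis using nz by (intro const_if_degrees_0) (auto simp: \<mu>_def)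
  qed
  have "Factorial_Ring.irreducible f"
  proof (rule Factorial_Ring.irreducibleI)
    show "f \<noteq> 0" by fact
    show "\<not> f dvd 1"
    proof
      assume "f dvd 1"
      hence "vanishes 1" by (rule dvd_vanishes[OF f(2)])
      hence "\<not> regular t" for t by (auto simp: vanishes_def)
      thus False using cofinite_def infinite_alg_closed[where 'a = 'a] by simp
    qed
    fix a b assume ab: "f = a * b"
    hence "vanishes a \<or> vanishes b" using f(2) not_vanishes_mult by blast
    thus "a dvd 1 \<or> b dvd 1" using unit[of a b] unit[of b a] ab by (auto simp: mult.commute)
  qed
  thus ?thesis using f(2) by blast
qed

text \<open>The partial degrees of \<open>F\<close> are too small for a second factor.\<close>

lemma irreducible_if_degrees_le:
  assumes char0: "\<And>n. n > 0 \<Longrightarrow> of_nat n \<noteq> (0 :: 'a)"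
    and bez1: "u1 * p1 + v1 * q1 = 1" and deg1: "max (degree p1) (degree q1) > 0"
    and bez2: "u2 * p2 + v2 * q2 = 1" and deg2: "max (degree p2) (degree q2) > 0"
    and inj: generically_injective and F: "F \<noteq> 0" "vanishes F"
    and le: "degree F \<le> max (degree p1) (degree q1)" "degree (swap_poly F) \<le> max (degree p2) (degree q2)"
  shows "Factorial_Ring.irreducible F"
proof -
  obtain f where f: "Factorial_Ring.irreducible f" "vanishes f"
    using irreducible_vanishing_exists[OF F] by blast
  obtain c where c: "F = f * c" using irreducible_vanishes_dvd[OF f F(2)] by (rule dvdE)
  have nz: "f \<noteq> 0" "c \<noteq> 0" using c F by auto
  have "max (degree p1) (degree q1) \<le> degree f"
    by (rule vanishes_degree_ge[OF char0 bez1 deg1 inj nz(1) f(2)])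
  moreover have "degree F = degree f + degree c" using nz by (simp add: c degree_mult_eq)
  ultimately have "degree c = 0" using le(1) by linarith
  interpret sw: rational_pair p2 q2 p1 q1 by (rule swap_rational_pair)
  \<comment> \<open>The same bound with the coordinates exchanged; together the two bounds leave
    degree zero in each variable to the cofactor \<open>c\<close>.\<close>
  have "max (degree p2) (degree q2) \<le> degree (swap_poly f)"
    using nz f(2) swap_poly_eq_iff[of f 0]
    by (intro sw.vanishes_degree_ge[OF char0 bez2 deg2 generically_injective_swap[OF inj]])
      (auto simp: vanishes_swap)
  moreover have "degree (swap_poly F) = degree (swap_poly f) + degree (swap_poly c)"
    using nz by (simp add: c degree_swap_mult)
  ultimately have "degree (swap_poly c) = 0" using le(2) by linarith
  hence "c dvd 1" using const_if_degrees_0 \<open>degree c = 0\<close> nz by blast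
  thus ?thesis using f(1) c by (simp add: irreducible_mult_unit_right)
qed

end

section \<open>Total degree\<close>

lemma total_degree_set:
  "{i + j | i j. coeff (coeff f j) i \<noteq> 0} \<subseteq> {..degree f + degree (swap_poly f)}"
proof
  fix n assume "n \<in> {i + j | i j. coeff (coeff f j) i \<noteq> 0}"
  then obtain i j where n: "n = i + j" "coeff (coeff f j) i \<noteq> 0" by blast
  have "coeff f j \<noteq> 0" using n(2) by auto
  hence "j \<le> degree f" by (rule le_degree)
  have "coeff (swap_poly f) i \<noteq> 0" using n(2) by (metis coeff_0 coeff_swap_poly)
  hence "i \<le> degree (swap_poly f)" by (rule le_degree)
  thus "n \<in> {..degree f + degree (swap_poly f)}" using n \<open>j \<le> degree f\<close> by simp
qed

lemma finite_total_degree_set: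
  fixes f :: "'a::comm_ring_1 poly poly"
  shows "finite {i + j | i j. coeff (coeff f j) i \<noteq> 0}"
  by (rule finite_subset[OF total_degree_set]) simp

lemma total_degree_ge:
  fixes f :: "'a::comm_ring_1 poly poly"
  shows "coeff (coeff f j) i \<noteq> 0 \<Longrightarrow> i + j \<le> total_degree f"
  unfolding total_degree_def using finite_total_degree_set[of f] by (intro Max_ge) auto

lemma total_degree_le: "total_degree f \<le> degree f + degree (swap_poly f)"
  unfolding total_degree_def using finite_total_degree_set[of f] total_degree_set[of f]
  by (intro Max.boundedI) auto

lemma total_degree_map:
  assumes "\<And>x. h x = 0 \<longleftrightarrow> x = 0"
  shows "total_degree (map_poly (map_poly h) f) = total_degree f"
  using assms by (simp add: total_degree_def coeff_map_poly)

lemma coeff_top_form: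
  "coeff (coeff (top_form f) j) i = (if i + j = total_degree f then coeff (coeff f j) i else 0)"
proof -
  let ?d = "total_degree f"
  have "coeff (coeff (top_form f) j) i =
      (\<Sum>l\<le>?d. if l = j then (if i + j = ?d then coeff (coeff f j) i else 0) else 0)"
    unfolding top_form_def Let_def coeff_sum by (intro sum.cong) auto
  thus ?thesis by auto
qed

lemma irreducible_linear_y:
  fixes f :: "'a::field poly poly"
  assumes "degree f = 1" "coeff f 1 = [:\<beta>:]" "\<beta> \<noteq> 0"
  shows "Factorial_Ring.irreducible f"
proof (rule Factorial_Ring.irreducibleI)
  show f0: "f \<noteq> 0" using assms by auto
  show "\<not> f dvd 1" using assms(1) by (metis degree_1 dvd_1_left dvd_imp_degree_le le_zero_eq one_neq_zero)
  have unit: "a dvd 1" if ab: "f = a * b" "degree a = 0" for a b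
  proof -
    obtain c where c: "a = [:c:]" using ab(2) by (auto elim: degree_eq_zeroE)
    have "[:\<beta>:] = c * coeff b 1" using assms(2) ab(1) c by simp
    hence "c dvd [:\<beta>:]" by (rule dvdI)
    moreover have "[:\<beta>:] dvd 1" using assms(3) by (simp add: is_unit_iff_degree)
    ultimately have "c dvd 1" by (rule dvd_trans)
    thus ?thesis by (simp add: c is_unit_const_poly_iff)
  qed
  fix a b assume ab: "f = a * b"
  hence "degree a + degree b = 1" using assms(1) f0 by (auto simp: degree_mult_eq)
  hence "degree a = 0 \<or> degree b = 0" by linarith
  thus "a dvd 1 \<or> b dvd 1" using unit[of a b] unit[of b a] ab by (auto simp: mult.commute)
qed

lemma irreducible_linear:
  fixes f :: "'a::field poly poly"
  assumes 0: "\<And>i j. i + j > 1 \<Longrightarrow> coeff (coeff f j) i = 0"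
    and nz: "coeff (coeff f 1) 0 \<noteq> 0 \<or> coeff (coeff f 0) 1 \<noteq> 0"
  shows "Factorial_Ring.irreducible f"
proof -
  have y: "Factorial_Ring.irreducible g"
    if g: "\<And>i j. i + j > 1 \<Longrightarrow> coeff (coeff g j) i = 0" "coeff (coeff g 1) 0 \<noteq> 0"
    for g :: "'a poly poly"
  proof (rule irreducible_linear_y)
    have "coeff g j = 0" if "j > 1" for j using g(1)[of _ j] that by (intro poly_eqI) auto
    hence "degree g \<le> 1" by (intro degree_le) auto
    moreover have "coeff g 1 \<noteq> 0" using g(2) by auto
    hence "1 \<le> degree g" by (rule le_degree)
    ultimately show "degree g = 1" by simp
    show "coeff g 1 = [:coeff (coeff g 1) 0:]"
      using g(1) by (intro poly_eqI) (auto simp: coeff_pCons split: nat.splits)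
  qed (rule g(2))
  show ?thesis
  proof (cases "coeff (coeff f 1) 0 = 0")
    case False
    thus ?thesis using y[of f] 0 by blast
  next
    case True
    hence "coeff (coeff (swap_poly f) 1) 0 \<noteq> 0" using nz by simp
    hence "Factorial_Ring.irreducible (swap_poly f)"
      using y[of "swap_poly f"] 0 by (simp add: add.commute)
    thus ?thesis using swap_poly_irreducible by fastforce
  qed
qed

section \<open>Coefficient sets\<close>

lemma in_lift_coeffs: "c \<in> lift_coeffs cf H \<Longrightarrow> \<exists>i. c \<in> cf (coeff H i)"
proof -
  assume "c \<in> lift_coeffs cf H"
  then obtain d where d: "d \<in> set (coeffs H)" "c \<in> cf d" by (auto simp: lift_coeffs_def)
  hence "d \<in> range (coeff H)" unfolding range_coeff by simp
  thus ?thesis using d(2) by blast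
qed

lemma lift_coeffs_I: "c \<in> cf (coeff H i) \<Longrightarrow> coeff H i \<noteq> 0 \<Longrightarrow> c \<in> lift_coeffs cf H"
proof -
  assume c: "c \<in> cf (coeff H i)" "coeff H i \<noteq> 0"
  have "coeff H i \<in> insert 0 (set (coeffs H))" unfolding range_coeff[symmetric] by blast
  thus ?thesis using c by (auto simp: lift_coeffs_def)
qed

lemma in_coeffs1_iff: "c \<in> coeffs1 H \<longleftrightarrow> c \<noteq> 0 \<and> (\<exists>i. c = coeff H i)"
  using lift_coeffs_I[of c coeffs0 H] in_lift_coeffs[of c coeffs0 H]
  by (auto simp: coeffs1_def coeffs0_def)

lemma in_coeffs2_iff: "c \<in> coeffs2 H \<longleftrightarrow> c \<noteq> 0 \<and> (\<exists>i j. c = coeff (coeff H j) i)"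
proof
  assume "c \<in> coeffs2 H"
  thus "c \<noteq> 0 \<and> (\<exists>i j. c = coeff (coeff H j) i)"
    using in_lift_coeffs[of c coeffs1 H] by (auto simp: coeffs2_def in_coeffs1_iff)
next
  assume *: "c \<noteq> 0 \<and> (\<exists>i j. c = coeff (coeff H j) i)"
  then obtain i j where c: "c = coeff (coeff H j) i" by blast
  hence "coeff H j \<noteq> 0" using * by auto
  moreover have "c \<in> coeffs1 (coeff H j)" using * c by (auto simp: in_coeffs1_iff)
  ultimately show "c \<in> coeffs2 H" unfolding coeffs2_def by (intro lift_coeffs_I)
qed

lemma finite_coeffs0 [simp]: "finite (coeffs0 c)"
  by (simp add: coeffs0_def)

lemma finite_coeffs1 [simp]: "finite (coeffs1 H)"
  by (simp add: coeffs1_def lift_coeffs_def)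

lemma finite_coeffs2 [simp]: "finite (coeffs2 H)"
  by (simp add: coeffs2_def lift_coeffs_def)

context specialization
begin

lemma Omega_def_coeffs1: "a0 \<in> Omega_def \<phi> \<gamma> (coeffs1 H) \<Longrightarrow> H \<in> polys_over R"
  using Omega_defD[of "coeffs1 H"] sp.R(1)
  by (auto simp: polys_over_def in_coeffs1_iff subset_iff) metis

lemma Omega_def_coeffs2: "a0 \<in> Omega_def \<phi> \<gamma> (coeffs2 H) \<Longrightarrow> H \<in> polys_over (polys_over R)"
  using Omega_defD[of "coeffs2 H"] sp.R(1)
  by (auto simp: polys_over_def in_coeffs2_iff subset_iff) metis

lemma Omega_nonZ_coeffs0: "a0 \<in> Omega_nonZ \<phi> \<gamma> (coeffs0 c) \<Longrightarrow> sp c \<noteq> 0"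
  using Omega_nonZD(2)[of "coeffs0 c"] by (auto simp: coeffs0_def)

lemma Omega_nonZ_coeffs1: "a0 \<in> Omega_nonZ \<phi> \<gamma> (coeffs1 H) \<Longrightarrow> map_poly sp H \<noteq> 0"
proof
  assume *: "a0 \<in> Omega_nonZ \<phi> \<gamma> (coeffs1 H)" "map_poly sp H = 0"
  obtain i where "sp (coeff H i) \<noteq> 0" using Omega_nonZD(2)[OF *(1)] by (auto simp: in_coeffs1_iff)
  thus False using arg_cong[OF *(2), of "\<lambda>p. coeff p i"] by simp
qed

lemma Omega_nonZ_def: "a0 \<in> Omega_nonZ \<phi> \<gamma> C \<Longrightarrow> a0 \<in> Omega_def \<phi> \<gamma> C"
  by (simp add: Omega_nonZ_def)

end

text \<open>Formulated for cofactors \<open>f1\<close>, \<open>f2\<close> over an arbitrary domain,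
  so that it serves polynomials in one and in two variables. Nonvanishing leading coefficients of
  the products pass to the factors, so no degree drops and the resultant specializes with the
  cofactors.\<close>

lemma gcd_specialization:
  fixes \<sigma> :: "'a::idom \<Rightarrow> 'b::idom"
  assumes hom: "partial_hom S \<sigma>"
    and S: "f1 \<in> polys_over S" "f2 \<in> polys_over S" "g \<in> polys_over S"
    and lc: "\<sigma> (lead_coeff (f1 * g)) \<noteq> 0" "\<sigma> (lead_coeff (f2 * g)) \<noteq> 0"
    and res: "\<sigma> (resultant f1 f2) \<noteq> 0"
  shows "map_poly \<sigma> (f1 * g) = map_poly \<sigma> f1 * map_poly \<sigma> g"
    "map_poly \<sigma> (f2 * g) = map_poly \<sigma> f2 * map_poly \<sigma> g"
    "degree (map_poly \<sigma> (f1 * g)) = degree (f1 * g)" "degree (map_poly \<sigma> (f2 * g)) = degree (f2 * g)"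
    "map_poly \<sigma> f1 \<noteq> 0" "resultant (map_poly \<sigma> f1) (map_poly \<sigma> f2) \<noteq> 0"
proof -
  interpret partial_hom S \<sigma> by fact
  interpret p: partial_hom "polys_over S" "map_poly \<sigma>" by (rule partial_hom_map_poly)
  show "map_poly \<sigma> (f1 * g) = map_poly \<sigma> f1 * map_poly \<sigma> g"
    "map_poly \<sigma> (f2 * g) = map_poly \<sigma> f2 * map_poly \<sigma> g" using S by (auto simp: p.hom_mult)
  show "degree (map_poly \<sigma> (f1 * g)) = degree (f1 * g)" "degree (map_poly \<sigma> (f2 * g)) = degree (f2 * g)"
    using lc by (auto intro: degree_map_poly_eq)
  have l: "\<sigma> (lead_coeff f1) \<noteq> 0" "\<sigma> (lead_coeff f2) \<noteq> 0"
    using lc S by (auto simp: lead_coeff_mult hom_mult coeff_polys_over)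
  thus "map_poly \<sigma> f1 \<noteq> 0" by (metis coeff_0 coeff_hom)
  show "resultant (map_poly \<sigma> f1) (map_poly \<sigma> f2) \<noteq> 0"
    using res hom_resultant(2)[OF S(1) degree_map_poly_eq[OF l(1)] S(2) degree_map_poly_eq[OF l(2)]] by simp
qed

lemma (in partial_hom) G_poly_hom:
  assumes "p \<in> polys_over R" "q \<in> polys_over R"
  shows "map_poly (map_poly \<sigma>) (G_poly p q) = G_poly (map_poly \<sigma> p) (map_poly \<sigma> q)"
proof -
  interpret p: partial_hom "polys_over R" "map_poly \<sigma>" by (rule partial_hom_map_poly)
  have c: "[:coeff r i:] \<in> polys_over R" if "r \<in> polys_over R" for r i
    using that R(1) by (simp add: coeff_polys_over)
  have mc: "map_poly \<sigma> [:a:] = [:\<sigma> a:]" for a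
    by (rule poly_eqI) (auto simp: coeff_pCons hom_0 split: nat.splits)
  show ?thesis
    by (rule poly_eqI) (simp add: coeff_G_poly p.hom_diff p.hom_mult p.R assms c mc del: mult_pCons_right)
qed

lemma bezout_if_coprime_class:
  fixes p q :: "'a::field poly"
  assumes "Rings.coprime p q" "q \<noteq> 0"
  shows "\<exists>u v. u * p + v * q = 1"
proof -
  have "degree d = 0" if "d dvd q" "d dvd p" for d
    using assms(1) that by (auto simp: is_unit_iff_degree dest: coprime_common_divisor)
  from bezout_if_coprime[OF this assms(2)] obtain u v where "u * q + v * p = 1" by blast
  thus ?thesis by (intro exI[of _ v] exI[of _ u]) (simp add: add.commute)
qed

lemma nonconst_if_bezout:
  fixes p q :: "'a::field poly"
  assumes "u * p + v * q = 1" "max (degree p) (degree q) > 0"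
  shows "p \<noteq> smult c q"
proof
  assume p: "p = smult c q"
  have "1 = q * (smult c u + v)" using assms(1) by (simp add: p algebra_simps)
  hence "q dvd 1" by (rule dvdI)
  hence "degree q = 0" by (simp add: is_unit_iff_degree)
  moreover have "degree p \<le> degree q" unfolding p by (rule degree_smult_le)
  ultimately show False using assms(2) by simp
qed

section \<open>Specialization of the parametrization\<close>

lemma swap_poly_map:
  fixes h :: "'a::comm_ring_1 \<Rightarrow> 'b::comm_ring_1"
  assumes "h 0 = 0"
  shows "swap_poly (map_poly (map_poly h) F) = map_poly (map_poly h) (swap_poly F)"
  using assms by (intro poly_eqI) (simp add: coeff_map_poly)

lemma degree_swap_map_le:
  fixes h :: "'a::comm_ring_1 \<Rightarrow> 'b::comm_ring_1"
  assumes "h 0 = 0"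
  shows "degree (swap_poly (map_poly (map_poly h) F)) \<le> degree (swap_poly F)"
  by (simp add: swap_poly_map[of h, OF assms] degree_map_poly_le)

lemma to_ac_partial_hom: "partial_hom UNIV (to_ac :: 'a::field \<Rightarrow> _)"
  by unfold_locales auto

lemma is_gcd_unit_degree:
  fixes p q g :: "'a::field poly"
  assumes "is_gcd g p q" "Rings.coprime p q"
  shows "degree g = 0"
proof -
  have "g dvd 1" using assms unfolding is_gcd_def by (auto dest: coprime_common_divisor)
  thus ?thesis by (simp add: is_unit_iff_degree)
qed

context rational_pair
begin

text \<open>A constant coordinate puts the curve on a line parallel to an axis, whose equation the
  irreducible \<open>f\<close> must divide. For curves other than lines both coordinates are
  therefore nonconstant.\<close>

lemma total_degree_if_const:
  assumes f: "Factorial_Ring.irreducible f" "vanishes f"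
    and const: "max (degree p1) (degree q1) = 0 \<or> max (degree p2) (degree q2) = 0"
  shows "total_degree f \<le> 1"
proof -
  have van: "\<exists>l. l \<noteq> 0 \<and> vanishes l \<and> degree l + degree (swap_poly l) \<le> 1" using const
  proof
    assume "max (degree p1) (degree q1) = 0"
    then obtain a b where ab: "p1 = [:a:]" "q1 = [:b:]" by (auto elim!: degree_eq_zeroE)
    define l where "l = [:[:-(a / b), 1:]:]"
    have "vanishes l" unfolding vanishes_def by (simp add: ab l_def)
    moreover have "degree (swap_poly l) \<le> 1"
    proof (rule degree_le, intro allI impI)
      fix i :: nat assume "1 < i"
      thus "coeff (swap_poly l) i = 0"
        by (intro poly_eqI) (auto simp: l_def coeff_pCons split: nat.splits)
    qed
    ultimately show ?thesis by (intro exI[of _ l]) (auto simp: l_def)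
  next
    assume "max (degree p2) (degree q2) = 0"
    then obtain a b where ab: "p2 = [:a:]" "q2 = [:b:]" by (auto elim!: degree_eq_zeroE)
    define l where "l = [:[:-(a / b):], 1:]"
    have "vanishes l" unfolding vanishes_def by (simp add: ab l_def eval2_pCons)
    moreover have "degree (swap_poly l) \<le> 0"
    proof (rule degree_le, intro allI impI)
      fix i :: nat assume "0 < i"
      thus "coeff (swap_poly l) i = 0"
        by (intro poly_eqI) (auto simp: l_def coeff_pCons split: nat.splits)
    qed
    ultimately show ?thesis by (intro exI[of _ l]) (auto simp: l_def)
  qed
  then obtain l where l: "l \<noteq> 0" "vanishes l" "degree l + degree (swap_poly l) \<le> 1" by blast
  obtain c where c: "l = f * c" using irreducible_vanishes_dvd[OF f l(2)] by (rule dvdE)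
  have nz: "f \<noteq> 0" "c \<noteq> 0" using c l by auto
  have "degree f + degree (swap_poly f) \<le> degree l + degree (swap_poly l)"
    unfolding c using nz by (simp add: degree_mult_eq degree_swap_mult)
  thus ?thesis using total_degree_le[of f] l(3) by linarith
qed

end

text \<open>That \<open>F\<close> vanishes on the parametrization is the identity
  \<open>pullback = 0\<close>. It descends from the closure because \<open>to_ac\<close> is
  injective, and specializes because all polynomials involved have their coefficients in
  \<open>R\<close>.\<close>

lemma (in specialization) spec_vanishes:
  assumes F: "F \<in> polys_over (polys_over R)"
    and P: "p1 \<in> polys_over R" "q1 \<in> polys_over R" "p2 \<in> polys_over R" "q2 \<in> polys_over R"
    and g: "rational_pair (map_poly to_ac p1) (map_poly to_ac q1) (map_poly to_ac p2) (map_poly to_ac q2)"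
    and van: "rational_pair.vanishes (map_poly to_ac p1) (map_poly to_ac q1) (map_poly to_ac p2)
      (map_poly to_ac q2) (map_poly (map_poly to_ac) F)"
    and s: "rational_pair (map_poly sp p1) (map_poly sp q1) (map_poly sp p2) (map_poly sp q2)"
  shows "rational_pair.vanishes (map_poly sp p1) (map_poly sp q1) (map_poly sp p2) (map_poly sp q2)
    (map_poly (map_poly sp) F)"
proof -
  interpret g: rational_pair "map_poly to_ac p1" "map_poly to_ac q1" "map_poly to_ac p2" "map_poly to_ac q2"
    by (rule g)
  interpret s: rational_pair "map_poly sp p1" "map_poly sp q1" "map_poly sp p2" "map_poly sp q2"
    by (rule s)
  interpret t: partial_hom UNIV "to_ac :: 'f \<Rightarrow> 'f alg_closure" by (rule to_ac_partial_hom)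
  let ?N = "degree (swap_poly F)" and ?M = "degree F"
  have "map_poly to_ac (pullback ?N ?M F p1 q1 p2 q2) = pullback ?N ?M (map_poly (map_poly to_ac) F)
      (map_poly to_ac p1) (map_poly to_ac q1) (map_poly to_ac p2) (map_poly to_ac q2)"
    by (rule t.pullback_hom) auto
  also have "\<dots> = 0"
    using van by (subst g.vanishes_iff_pullback[symmetric]) (auto intro: degree_swap_map_le degree_map_poly_le)
  finally have "pullback ?N ?M F p1 q1 p2 q2 = 0"
    by (metis inj_to_ac injD map_poly_eq_0_iff to_ac_0 to_ac_eq_0_iff)
  hence "map_poly sp (pullback ?N ?M F p1 q1 p2 q2) = 0" by simp
  hence "pullback ?N ?M (map_poly (map_poly sp) F) (map_poly sp p1) (map_poly sp q1)
      (map_poly sp p2) (map_poly sp q2) = 0"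
    by (simp only: sp.pullback_hom[OF F P])
  thus ?thesis
    by (subst s.vanishes_iff_pullback[of _ ?N ?M]) (auto intro: degree_swap_map_le degree_map_poly_le sp.hom_0)
qed

text \<open>The gcd of \<open>p\<close> and \<open>q\<close> is a constant, nonzero after
  specialization, so a common divisor of the specialized pair divides the specialized cofactors,
  whose resultant is nonzero.\<close>

lemma (in specialization) bezout_spec:
  assumes cop: "Rings.coprime p q" and gcd: "is_gcd g p q" "a0 \<in> Omega_gcd \<phi> \<gamma> coeffs0 p q g"
  shows "\<exists>u v. u * map_poly sp p + v * map_poly sp q = 1"
    "degree (map_poly sp p) = degree p" "degree (map_poly sp q) = degree q"
proof -
  define r s where "r = p div g" and "s = q div g"
  note rs = r_def s_def
  have O: "a0 \<in> Omega_def \<phi> \<gamma> (coeffs1 r)" "a0 \<in> Omega_def \<phi> \<gamma> (coeffs1 s)"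
    "a0 \<in> Omega_def \<phi> \<gamma> (coeffs1 g)"
    "a0 \<in> Omega_nonZ \<phi> \<gamma> (coeffs0 (lead_coeff p))" "a0 \<in> Omega_nonZ \<phi> \<gamma> (coeffs0 (lead_coeff q))"
    "a0 \<in> Omega_nonZ \<phi> \<gamma> (coeffs0 (resultant r s))"
    using gcd(2) unfolding Omega_gcd_def Let_def coeffs1_def rs by auto
  have "g dvd p" "g dvd q" using gcd(1) by (auto simp: is_gcd_def)
  hence pq: "r * g = p" "s * g = q" by (auto simp: rs)
  have S: "r \<in> polys_over R" "s \<in> polys_over R" "g \<in> polys_over R"
    using O Omega_def_coeffs1 by auto
  note spec = gcd_specialization[OF spec_hom S, unfolded pq, OF Omega_nonZ_coeffs0[OF O(4)]
      Omega_nonZ_coeffs0[OF O(5)] Omega_nonZ_coeffs0[OF O(6)]]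
  show "degree (map_poly sp p) = degree p" "degree (map_poly sp q) = degree q" by (fact spec)+
  have "map_poly sp p \<noteq> 0" using Omega_nonZ_coeffs0[OF O(4)]
    by (metis coeff_0 sp.coeff_hom)
  obtain c where c: "g = [:c:]" using is_gcd_unit_degree[OF gcd(1) cop] by (auto elim: degree_eq_zeroE)
  have mc: "map_poly sp g = [:sp c:]"
    by (rule poly_eqI) (auto simp: c coeff_pCons sp.hom_0 split: nat.splits)
  have c0: "sp c \<noteq> 0" using \<open>map_poly sp p \<noteq> 0\<close> spec(1) mc by auto
  have "degree d = 0" if "d dvd map_poly sp p" "d dvd map_poly sp q" for d
  proof -
    have "d dvd smult (sp c) (map_poly sp r)" "d dvd smult (sp c) (map_poly sp s)"
      using that unfolding spec(1,2) mc by (simp_all add: mult.commute)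
    hence "d dvd map_poly sp r" "d dvd map_poly sp s" unfolding dvd_smult_iff[OF c0] by auto
    thus ?thesis using resultant_nonzero_coprime[OF spec(6,5)] by blast
  qed
  from bezout_if_coprime[OF this \<open>map_poly sp p \<noteq> 0\<close>]
  show "\<exists>u v. u * map_poly sp p + v * map_poly sp q = 1" by blast
qed

lemma linear_dvd_G_poly: "[:-[:0, 1:], 1:] dvd G_poly p (q :: 'a::comm_ring_1 poly)"
proof -
  have "poly (map_poly (\<lambda>c. [:c:]) r) [:0, 1:] = r" for r :: "'a poly"
    by (induction r) (auto simp: map_poly_pCons)
  hence "poly (G_poly p q) [:0, 1:] = 0" by (simp add: G_poly_def mult.commute)
  thus ?thesis by (simp add: poly_eq_0_iff_dvd)
qed

context specialization
begin

lemma of_nat_ac_nonzero: "n > 0 \<Longrightarrow> of_nat n \<noteq> (0 :: 'f alg_closure)"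
  using of_nat_ext_nonzero[of n] by (metis to_ac_eq_0_iff to_ac_of_nat)

text \<open>The condition on the top form saves one coefficient of highest total degree, so the
  specialized polynomial still defines a curve.\<close>

lemma total_degree_spec_pos:
  assumes "a0 \<in> Omega_F \<phi> \<gamma> F" "total_degree F > 0"
  shows "\<exists>i j. i + j = total_degree F \<and> sp (coeff (coeff F j) i) \<noteq> 0"
    "total_degree (map_poly (map_poly sp) F) > 0" "map_poly (map_poly sp) F \<noteq> 0"
proof -
  have "a0 \<in> Omega_nonZ \<phi> \<gamma> (coeffs2 (top_form F))" using assms by (simp add: Omega_F_def)
  from Omega_nonZD(2)[OF this] obtain i j where c: "sp (coeff (coeff (top_form F) j) i) \<noteq> 0"
    by (auto simp: in_coeffs2_iff)
  hence ij: "i + j = total_degree F" "sp (coeff (coeff F j) i) \<noteq> 0"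
    by (auto simp: coeff_top_form sp.hom_0 split: if_splits)
  thus "\<exists>i j. i + j = total_degree F \<and> sp (coeff (coeff F j) i) \<noteq> 0" by blast
  have "coeff (coeff (map_poly (map_poly sp) F) j) i \<noteq> 0" using ij by (simp add: coeff_map_poly)
  thus "total_degree (map_poly (map_poly sp) F) > 0" "map_poly (map_poly sp) F \<noteq> 0"
    using total_degree_ge[of "map_poly (map_poly sp) F" j i] ij assms(2) by auto
qed

lemma proper_not_line:
  assumes td: "total_degree F > 0" "total_degree F \<noteq> 1"
    and irr: "Factorial_Ring.irreducible (map_poly (map_poly to_ac) F)"
    and cop: "Rings.coprime p1 q1" "Rings.coprime p2 q2"
    and pp: "properly_parametrizes (curve_closure F)
           (map_poly to_ac p1) (map_poly to_ac q1) (map_poly to_ac p2) (map_poly to_ac q2)"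
    and g: "is_gcd g (G_poly p1 q1) (G_poly p2 q2)" and g1: "is_gcd g1 p1 q1" and g2: "is_gcd g2 p2 q2"
    and OF: "a0 \<in> Omega_F \<phi> \<gamma> F"
    and Op: "a0 \<in> Omega_def \<phi> \<gamma> (coeffs1 p1)" "a0 \<in> Omega_def \<phi> \<gamma> (coeffs1 p2)"
    and Oq: "a0 \<in> Omega_nonZ \<phi> \<gamma> (coeffs1 q1)" "a0 \<in> Omega_nonZ \<phi> \<gamma> (coeffs1 q2)"
    and Og: "a0 \<in> Omega_gcd \<phi> \<gamma> coeffs1 (G_poly p1 q1) (G_poly p2 q2) g"
    and Og1: "a0 \<in> Omega_gcd \<phi> \<gamma> coeffs0 p1 q1 g1" and Og2: "a0 \<in> Omega_gcd \<phi> \<gamma> coeffs0 p2 q2 g2"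
  shows "rational_curve (spec_curve \<phi> \<gamma> a0 \<gamma>0 F) \<and>
         properly_parametrizes (spec_curve \<phi> \<gamma> a0 \<gamma>0 F)
           (map_poly sp p1) (map_poly sp q1) (map_poly sp p2) (map_poly sp q2)"
proof -
  interpret tpp: map_poly_inj_idom_hom "map_poly to_ac :: 'f poly \<Rightarrow> 'f alg_closure poly" ..
  interpret t: partial_hom UNIV "to_ac :: 'f \<Rightarrow> 'f alg_closure" by (rule to_ac_partial_hom)
  let ?T = "map_poly to_ac" and ?F' = "map_poly (map_poly to_ac) F"
  have par: "parametrizes (zero_set2 {?F'}) (?T p1) (?T q1) (?T p2) (?T q2)"
    and bir: "birational_onto (zero_set2 {?F'}) (?T p1) (?T q1) (?T p2) (?T q2)"
    using pp by (auto simp: properly_parametrizes_def curve_closure_def)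
  interpret g: rational_pair "?T p1" "?T q1" "?T p2" "?T q2"
    using par by unfold_locales (auto simp: parametrizes_def)
  have van: "g.vanishes ?F'" using par
    by (auto simp: parametrizes_def g.vanishes_def rat_point_def zero_set2_def)
  have inj: "g.generically_injective" by (rule g.generically_injective_if_birational[OF bir])
  have "total_degree ?F' = total_degree F" by (rule total_degree_map) simp
  \<comment> \<open>A constant coordinate would force total degree at most one, the case treated
    separately.\<close>
  hence n: "max (degree p1) (degree q1) > 0" "max (degree p2) (degree q2) > 0"
  proof -
    have "\<not> (max (degree (?T p1)) (degree (?T q1)) = 0 \<or> max (degree (?T p2)) (degree (?T q2)) = 0)"
    proof
      assume "max (degree (?T p1)) (degree (?T q1)) = 0 \<or> max (degree (?T p2)) (degree (?T q2)) = 0"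
      from g.total_degree_if_const[OF irr van this] show False
        using td \<open>total_degree ?F' = total_degree F\<close> by linarith
    qed
    thus "max (degree p1) (degree q1) > 0" "max (degree p2) (degree q2) > 0"
      unfolding neq0_conv[symmetric] by simp_all
  qed
  have q0: "q1 \<noteq> 0" "q2 \<noteq> 0" using g.q0 by auto
  have bezT: "\<exists>u v. u * ?T p + v * ?T q = 1" if "u * p + v * q = 1" for u v p q :: "'f poly"
  proof -
    have "?T u * ?T p + ?T v * ?T q = ?T 1" by (simp only: that[symmetric] to_ac_poly.hom_add to_ac_poly.hom_mult)
    thus ?thesis by auto
  qed
  obtain u1 v1 where b1: "u1 * ?T p1 + v1 * ?T q1 = 1"
    using bezout_if_coprime_class[OF cop(1) q0(1)] bezT by blast
  obtain u2 v2 where b2: "u2 * ?T p2 + v2 * ?T q2 = 1"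
    using bezout_if_coprime_class[OF cop(2) q0(2)] bezT by blast
  obtain a1 c1 where s1: "a1 * map_poly sp p1 + c1 * map_poly sp q1 = 1"
    using bezout_spec(1)[OF cop(1) g1 Og1] by blast
  obtain a2 c2 where s2: "a2 * map_poly sp p2 + c2 * map_poly sp q2 = 1"
    using bezout_spec(1)[OF cop(2) g2 Og2] by blast
  note deg1 = bezout_spec(2,3)[OF cop(1) g1 Og1]
  note deg2 = bezout_spec(2,3)[OF cop(2) g2 Og2]
  interpret s: rational_pair "map_poly sp p1" "map_poly sp q1" "map_poly sp p2" "map_poly sp q2"
  proof
    show "map_poly sp q1 \<noteq> 0" "map_poly sp q2 \<noteq> 0" using Oq Omega_nonZ_coeffs1 by auto
    show "\<not> (\<exists>c1 c2. map_poly sp p1 = smult c1 (map_poly sp q1) \<and> map_poly sp p2 = smult c2 (map_poly sp q2))"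
      using nonconst_if_bezout[OF s1] n(1) deg1 by simp
  qed
  define lin where "lin = [:-[:0, 1:], 1 :: 'f poly:]"
  have Xg: "lin dvd g" using g linear_dvd_G_poly unfolding is_gcd_def lin_def by blast
  then obtain w where w: "g = lin * w" by (rule dvdE)
  define f1 f2 where "f1 = G_poly p1 q1 div g" and "f2 = G_poly p2 q2 div g"
  note f = f1_def f2_def
  have OG: "a0 \<in> Omega_def \<phi> \<gamma> (coeffs2 f1)" "a0 \<in> Omega_def \<phi> \<gamma> (coeffs2 f2)"
    "a0 \<in> Omega_def \<phi> \<gamma> (coeffs2 g)"
    "a0 \<in> Omega_nonZ \<phi> \<gamma> (coeffs1 (lead_coeff (G_poly p1 q1)))"
    "a0 \<in> Omega_nonZ \<phi> \<gamma> (coeffs1 (lead_coeff (G_poly p2 q2)))"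
    "a0 \<in> Omega_nonZ \<phi> \<gamma> (coeffs1 (lead_coeff g))"
    "a0 \<in> Omega_nonZ \<phi> \<gamma> (coeffs1 (resultant f1 f2))"
    using Og unfolding Omega_gcd_def Let_def coeffs2_def f by auto
  have gG: "g dvd G_poly p1 q1" "g dvd G_poly p2 q2" using g by (auto simp: is_gcd_def)
  hence Gf: "f1 * g = G_poly p1 q1" "f2 * g = G_poly p2 q2" by (auto simp: f)
  have "map_poly sp (lead_coeff g) \<noteq> 0" by (rule Omega_nonZ_coeffs1[OF OG(6)])
  hence "g \<noteq> 0" by auto
  hence "w \<noteq> 0" using w by auto
  \<comment> \<open>The genericity argument needs an algebraically closed field, so the
    divisibilities are first carried to the closure of \<open>'f\<close>; \<open>to_ac\<close>
    preserves the degree of \<open>w\<close>.\<close>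
  have "degree w = 0"
  proof -
    have lin': "map_poly ?T lin = [:-[:0, 1:], 1:]" unfolding lin_def
      by (rule poly_eqI) (auto simp: coeff_map_poly coeff_pCons to_ac_poly.hom_uminus split: nat.splits)
    have dvd: "[:-[:0, 1:], 1:] * map_poly ?T w dvd G_poly (?T p) (?T q)" if "g dvd G_poly p q" for p q
    proof -
      have "map_poly ?T g dvd map_poly ?T (G_poly p q)" using that by (rule tpp.hom_dvd)
      thus ?thesis unfolding w tpp.hom_mult lin' using t.G_poly_hom[of p q] by simp
    qed
    have "degree (map_poly ?T w) = 0"
      using n \<open>w \<noteq> 0\<close> by (intro g.common_divisor_G_poly[OF of_nat_ac_nonzero b1 _ b2 inj dvd[OF gG(1)] dvd[OF gG(2)]]) auto
    thus ?thesis by simp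
  qed
  then obtain w0 where w0: "w = [:w0:]" by (auto elim: degree_eq_zeroE)
  interpret p: partial_hom "polys_over R" "map_poly sp" by (rule sp.partial_hom_map_poly)
  interpret p2: partial_hom "polys_over (polys_over R)" "map_poly (map_poly sp)"
    by (rule p.partial_hom_map_poly)
  have S: "f1 \<in> polys_over (polys_over R)" "f2 \<in> polys_over (polys_over R)" "g \<in> polys_over (polys_over R)"
    using OG Omega_def_coeffs2 by auto
  note spec = gcd_specialization[OF sp.partial_hom_map_poly S, unfolded Gf, OF Omega_nonZ_coeffs1[OF OG(4)]
      Omega_nonZ_coeffs1[OF OG(5)] Omega_nonZ_coeffs1[OF OG(7)]]
  have pR: "p1 \<in> polys_over R" "q1 \<in> polys_over R" "p2 \<in> polys_over R" "q2 \<in> polys_over R"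
    using Op Oq Omega_nonZ_def Omega_def_coeffs1 by auto
  \<comment> \<open>Now \<open>g\<close> is linear in the outer variable and \<open>w0\<close> is
    its leading coefficient, so the nonvanishing condition on the gcd applies to
    \<open>w0\<close>.\<close>
  have "coeff g 1 = w0" by (simp add: w w0 lin_def)
  hence w0R: "w0 \<in> polys_over R" using S(3) by (metis coeff_polys_over)
  have lg: "lead_coeff g = w0" using \<open>w \<noteq> 0\<close> by (simp add: w w0 lin_def)
  have w0s: "map_poly sp w0 \<noteq> 0" using Omega_nonZ_coeffs1[OF OG(6)] lg by simp
  have mX: "map_poly sp [:0, 1:] = [:0, 1:]"
    by (rule poly_eqI) (auto simp: coeff_pCons sp.hom_0 sp.hom_1 split: nat.splits)
  have XR: "[:0, 1:] \<in> polys_over R"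
    using sp.R by (auto simp: polys_over_def coeff_pCons split: nat.splits)
  have mg: "map_poly (map_poly sp) g = [:-[:0, 1:], 1:] * [:map_poly sp w0:]"
  proof (rule poly_eqI)
    fix i
    have "coeff g 0 = - ([:0, 1:] * w0)" by (simp add: w w0 lin_def)
    hence 0: "map_poly sp (coeff g 0) = - ([:0, 1:] * map_poly sp w0)"
      using XR w0R by (simp only: p.hom_uminus p.hom_mult p.R mX)
    have 2: "coeff g i = 0" if "i > 1" using that by (auto simp: w w0 lin_def coeff_pCons split: nat.splits)
    show "coeff (map_poly (map_poly sp) g) i = coeff ([:-[:0, 1:], 1:] * [:map_poly sp w0:]) i"
      using 0 2 \<open>coeff g 1 = w0\<close>
      by (cases "i = 0"; cases "i = 1") (auto simp: coeff_map_poly coeff_pCons p.hom_0 split: nat.splits)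
  qed
  obtain A B where B: "\<not> s.vanishes B"
    and AB: "\<And>t. s.regular t \<Longrightarrow> eval2 A (s.xp t) (s.yp t) = t * eval2 B (s.xp t) (s.yp t)"
    using s.inverse_if_gcd[OF _ _ w0s spec(5,6)] spec(1,2) sp.G_poly_hom pR unfolding mg by metis
  have inj0: "s.generically_injective" by (rule s.generically_injective_if_inverse[OF B AB])
  let ?F0 = "map_poly (map_poly sp) F"
  have FR: "F \<in> polys_over (polys_over R)" using OF by (intro Omega_def_coeffs2) (simp add: Omega_F_def)
  have van0: "s.vanishes ?F0"
    by (rule spec_vanishes[OF FR pR g.rational_pair_axioms van s.rational_pair_axioms])
  note td0 = total_degree_spec_pos(2,3)[OF OF td(1)]
  \<comment> \<open>The degree of \<open>F\<close> can only drop; before that it is bounded by the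
    degrees of the generic parametrization, and these survive specialization.\<close>
  have "degree ?F0 \<le> degree F" by (rule degree_map_poly_le)
  also have "degree F = degree ?F'" by simp
  also have "\<dots> \<le> max (degree p1) (degree q1)" using g.irreducible_degree_le[OF irr van] by simp
  finally have d1: "degree ?F0 \<le> max (degree (map_poly sp p1)) (degree (map_poly sp q1))"
    using deg1 by simp
  \<comment> \<open>The bound for the degree in \<open>x\<close> is the same statement for the
    parametrization with exchanged coordinates.\<close>
  interpret gs: rational_pair "?T p2" "?T q2" "?T p1" "?T q1" by (rule g.swap_rational_pair)
  have "degree (swap_poly ?F0) \<le> degree (swap_poly F)" by (rule degree_swap_map_le) (rule sp.hom_0)
  also have "degree (swap_poly F) = degree (swap_poly ?F')"
    by (simp add: swap_poly_map[of to_ac])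
  also have "\<dots> \<le> max (degree p2) (degree q2)"
    using gs.irreducible_degree_le[OF swap_poly_irreducible[OF irr]] van by (simp add: g.vanishes_swap)
  finally have d2: "degree (swap_poly ?F0) \<le> max (degree (map_poly sp p2)) (degree (map_poly sp q2))"
    using deg2 by simp
  have "Factorial_Ring.irreducible ?F0"
    using s.irreducible_if_degrees_le[OF _ s1 _ s2 _ inj0 td0(2) van0 d1 d2] n deg1 deg2 by simp
  from s.proper_if_inverse[OF this van0 td0(1) B AB]
  show ?thesis by (simp add: spec_curve_def)
qed

text \<open>A linear polynomial stays irreducible as long as one of its top coefficients survives,
  and a coordinate whose linear coefficient survives is inverted explicitly.\<close>

lemma proper_line:
  assumes td: "total_degree F = 1"
    and pp: "properly_parametrizes (curve_closure F)
           (map_poly to_ac p1) (map_poly to_ac 1) (map_poly to_ac p2) (map_poly to_ac 1)"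
    and deg: "degree p1 \<le> 1" "degree p2 \<le> 1"
    and OF: "a0 \<in> Omega_F \<phi> \<gamma> F"
    and Op: "a0 \<in> Omega_def \<phi> \<gamma> (coeffs1 p1)" "a0 \<in> Omega_def \<phi> \<gamma> (coeffs1 p2)"
    and O1: "a0 \<in> Omega_nonZ \<phi> \<gamma> (coeffs0 (coeff p1 1)) \<union> Omega_nonZ \<phi> \<gamma> (coeffs0 (coeff p2 1))"
  shows "rational_curve (spec_curve \<phi> \<gamma> a0 \<gamma>0 F) \<and>
         properly_parametrizes (spec_curve \<phi> \<gamma> a0 \<gamma>0 F)
           (map_poly sp p1) (map_poly sp 1) (map_poly sp p2) (map_poly sp 1)"
proof -
  interpret p: partial_hom "polys_over R" "map_poly sp" by (rule sp.partial_hom_map_poly)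
  let ?T = "map_poly to_ac" and ?F' = "map_poly (map_poly to_ac) F"
  have par: "parametrizes (zero_set2 {?F'}) (?T p1) (?T 1) (?T p2) (?T 1)"
    using pp by (auto simp: properly_parametrizes_def curve_closure_def)
  interpret g: rational_pair "?T p1" "?T 1" "?T p2" "?T 1"
    using par by unfold_locales (auto simp: parametrizes_def)
  have van: "g.vanishes ?F'" using par
    unfolding g.vanishes_def parametrizes_def rat_point_def zero_set2_def by auto
  have lc: "sp (coeff p1 1) \<noteq> 0 \<or> sp (coeff p2 1) \<noteq> 0" using O1 Omega_nonZ_coeffs0 by blast
  interpret s: rational_pair "map_poly sp p1" "map_poly sp 1" "map_poly sp p2" "map_poly sp 1"
  proof
    show "map_poly sp 1 \<noteq> 0" by (simp add: p.hom_1)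
    show "\<not> (\<exists>c1 c2. map_poly sp p1 = smult c1 (map_poly sp 1) \<and> map_poly sp p2 = smult c2 (map_poly sp 1))"
    proof
      assume "\<exists>c1 c2. map_poly sp p1 = smult c1 (map_poly sp 1) \<and> map_poly sp p2 = smult c2 (map_poly sp 1)"
      then obtain c1 c2 where "map_poly sp p1 = smult c1 1" "map_poly sp p2 = smult c2 1"
        by (auto simp: p.hom_1)
      hence "coeff (map_poly sp p1) 1 = 0" "coeff (map_poly sp p2) 1 = 0" by (simp_all add: one_pCons)
      thus False using lc by simp
    qed
  qed
  let ?F0 = "map_poly (map_poly sp) F"
  have FR: "F \<in> polys_over (polys_over R)" using OF by (intro Omega_def_coeffs2) (simp add: Omega_F_def)
  have pR: "p1 \<in> polys_over R" "1 \<in> polys_over R" "p2 \<in> polys_over R" "1 \<in> polys_over R"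
    using Op Omega_def_coeffs1 p.R by auto
  have van0: "s.vanishes ?F0"
    by (rule spec_vanishes[OF FR pR g.rational_pair_axioms van s.rational_pair_axioms])
  have td': "total_degree F > 0" using td by simp
  obtain i j where ij: "i + j = 1" "sp (coeff (coeff F j) i) \<noteq> 0"
    using total_degree_spec_pos(1)[OF OF td'] td by auto
  have irr: "Factorial_Ring.irreducible ?F0"
  proof (rule irreducible_linear)
    fix i j :: nat assume "i + j > 1"
    hence "coeff (coeff F j) i = 0" using total_degree_ge[of F j i] td by force
    thus "coeff (coeff ?F0 j) i = 0" by (simp add: coeff_map_poly sp.hom_0)
  next
    have "(i = 0 \<and> j = 1) \<or> (i = 1 \<and> j = 0)" using ij(1) by linarith
    thus "coeff (coeff ?F0 1) 0 \<noteq> 0 \<or> coeff (coeff ?F0 0) 1 \<noteq> 0"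
      using ij(2) by (auto simp: coeff_map_poly)
  qed
  have ev: "poly (map_poly sp p) t = sp (coeff p 0) + sp (coeff p 1) * t" if "degree p \<le> 1" for p t
    using that degree_map_poly_le[of sp p] by (subst poly_altdef_le[of _ 1]) auto
  \<comment> \<open>The inverse subtracts the constant coefficient and divides by the linear one, in
    the first coordinate if possible and otherwise in the second.\<close>
  have "\<exists>A B. \<not> s.vanishes B \<and> (\<forall>t. s.regular t \<longrightarrow> eval2 A (s.xp t) (s.yp t) = t * eval2 B (s.xp t) (s.yp t))"
  proof (cases "sp (coeff p1 1) = 0")
    case False
    have "\<not> s.vanishes [:[:sp (coeff p1 1):]:]"
      using False unfolding s.vanishes_def by (auto simp: p.hom_1 rat_defined_def)
    moreover have "eval2 [:[:- sp (coeff p1 0), 1:]:] (s.xp t) (s.yp t) = t * sp (coeff p1 1)" for t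
      using deg by (simp add: p.hom_1 ev)
    ultimately show ?thesis
      by (intro exI[of _ "[:[:- sp (coeff p1 0), 1:]:]"] exI[of _ "[:[:sp (coeff p1 1):]:]"]) simp
  next
    case True
    hence nz: "sp (coeff p2 1) \<noteq> 0" using lc by blast
    have "\<not> s.vanishes [:[:sp (coeff p2 1):]:]"
      using nz unfolding s.vanishes_def by (auto simp: p.hom_1 rat_defined_def)
    moreover have "eval2 [:[:- sp (coeff p2 0):], 1:] (s.xp t) (s.yp t) = t * sp (coeff p2 1)" for t
      using deg by (simp add: p.hom_1 ev eval2_pCons)
    ultimately show ?thesis
      by (intro exI[of _ "[:[:- sp (coeff p2 0):], 1:]"] exI[of _ "[:[:sp (coeff p2 1):]:]"]) simp
  qed
  then obtain A B where B: "\<not> s.vanishes B"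
    and AB: "\<And>t. s.regular t \<Longrightarrow> eval2 A (s.xp t) (s.yp t) = t * eval2 B (s.xp t) (s.yp t)" by blast
  from s.proper_if_inverse[OF irr van0 total_degree_spec_pos(2)[OF OF td'] B AB]
  show ?thesis by (simp add: spec_curve_def)
qed

end

theorem theorem5p5:
  fixes \<phi> :: "('n::{finite,linorder}, 'k::field_char_0) ppoly fract \<Rightarrow> 'f::field"
    and \<gamma> \<gamma>1 :: 'f
    and F :: "'f poly poly"
    and p1 q1 p2 q2 g1 g2 :: "'f poly"
    and g :: "'f poly poly"
    and a0 :: "'n \<Rightarrow> 'k alg_closure"
    and \<gamma>0 :: "'k alg_closure"
  assumes "simple_algebraic_extension \<phi> \<gamma>"
    and "total_degree F > 0"
    and "\<forall>c\<in>coeffs2 F. \<exists>U. c = poly (map_poly (\<lambda>P. \<phi> (to_fract P)) U) \<gamma>1"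
    and "Factorial_Ring.irreducible (map_poly (map_poly to_ac) F)"
    and "rational_curve (curve_closure F)"
    and "coprime p1 q1" and "coprime p2 q2"
    and "properly_parametrizes (curve_closure F)
           (map_poly to_ac p1) (map_poly to_ac q1) (map_poly to_ac p2) (map_poly to_ac q2)"
    and "total_degree F = 1 \<Longrightarrow> q1 = 1 \<and> q2 = 1 \<and> degree p1 \<le> 1 \<and> degree p2 \<le> 1"
    and "is_gcd g (G_poly p1 q1) (G_poly p2 q2)" and "is_gcd g1 p1 q1" and "is_gcd g2 p2 q2"
    and "a0 \<in> Omega_proper \<phi> \<gamma> F p1 q1 p2 q2 g g1 g2"
    and "poly (spec_min_poly \<phi> \<gamma> a0) \<gamma>0 = 0"
  shows "rational_curve (spec_curve \<phi> \<gamma> a0 \<gamma>0 F) \<and>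
         properly_parametrizes (spec_curve \<phi> \<gamma> a0 \<gamma>0 F)
           (map_poly (spec \<phi> \<gamma> a0 \<gamma>0) p1) (map_poly (spec \<phi> \<gamma> a0 \<gamma>0) q1)
           (map_poly (spec \<phi> \<gamma> a0 \<gamma>0) p2) (map_poly (spec \<phi> \<gamma> a0 \<gamma>0) q2)"
proof -
  \<comment> \<open>\<open>Omega_F\<close> is part of both cases of the definition and lies inside
    \<open>Omega_gamma\<close>, so the specialization can be set up before the case split.\<close>
  have a0: "a0 \<in> Omega_F \<phi> \<gamma> F"
    using assms(13) unfolding Omega_proper_def by (auto split: if_splits)
  interpret specialization a0 \<phi> \<gamma> \<gamma>0
  proof
    show "simple_algebraic_extension \<phi> \<gamma>" by fact
    show "a0 \<in> Omega_gamma \<phi> \<gamma>" using a0 by (simp add: Omega_F_def Omega_def_def)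
    show "poly (spec_min_poly \<phi> \<gamma> a0) \<gamma>0 = 0" by fact
  qed
  show ?thesis
  proof (cases "total_degree F = 1")
    case True
    have q: "q1 = 1" "q2 = 1" and deg: "degree p1 \<le> 1" "degree p2 \<le> 1" using assms(9)[OF True] by auto
    have "a0 \<in> Omega_def \<phi> \<gamma> (coeffs1 p1)" "a0 \<in> Omega_def \<phi> \<gamma> (coeffs1 p2)"
      "a0 \<in> Omega_nonZ \<phi> \<gamma> (coeffs0 (coeff p1 1)) \<union> Omega_nonZ \<phi> \<gamma> (coeffs0 (coeff p2 1))"
      using assms(13) True unfolding Omega_proper_def by simp_all
    thus ?thesis using proper_line[OF True _ deg a0] assms(8) unfolding q by blast
  next
    case False
    have "a0 \<in> Omega_def \<phi> \<gamma> (coeffs1 p1)" "a0 \<in> Omega_def \<phi> \<gamma> (coeffs1 p2)"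
      "a0 \<in> Omega_nonZ \<phi> \<gamma> (coeffs1 q1)" "a0 \<in> Omega_nonZ \<phi> \<gamma> (coeffs1 q2)"
      "a0 \<in> Omega_gcd \<phi> \<gamma> coeffs1 (G_poly p1 q1) (G_poly p2 q2) g"
      "a0 \<in> Omega_gcd \<phi> \<gamma> coeffs0 p1 q1 g1" "a0 \<in> Omega_gcd \<phi> \<gamma> coeffs0 p2 q2 g2"
      using assms(13) False unfolding Omega_proper_def by simp_all
    from proper_not_line[OF assms(2) False assms(4,6,7,8,10,11,12) a0 this] show ?thesis .
  qed
qed

end
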